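(* Let $\delta>0$, let $\theta_0\in\Theta^\delta$ be the true regression function, and let the prior $\Pi$ on $\Theta^\delta$ satisfy assumption (A) (all defined in the context). Put $\epsilon_n=1/\sqrt n$. Then for every sequence $M_n\to\infty$, $$\Pi^n\big(\theta\in\Theta^\delta:\ \|\theta-\theta_0\|>M_n\epsilon_n\big)\to0\quad\text{in }P_0^n\text{-probability as }n\to\infty .$$
   Context: Model space. Fix an integer $k_{max}\ge 1$, $K>0$ and $\delta>0$. For $k\ge1$ let $T_k^\delta$ be the set of tuples $t=(t_0,\dots,t_k)$ with $0=t_0<t_1<\dots<t_k=1$ and $\min_{1\le j\le k}|t_j-t_{j-1}|\ge\delta$ (identified with a subset of $\mathbb{R}^{k-1}$ through $(t_1,\dots,t_{k-1})$). A pair $(a,t)\in[-K,K]^k\times T_k^\delta$ is identified with the step function $\theta(x)=\sum_{j=1}^k a_j I(t_{j-1}\le x<t_j)$ on $[0,1)$. $\Theta_k^\delta$ is the set of such $\theta=(a,t)$ ("functions with $k$ change-points", i.e. $k$ segments), and $\Theta^\delta=\bigcup_{k=1}^{k_{max}}\Theta_k^\delta$. The norm is $\|\theta\|=(\int_0^1\theta^2(x)\,dx)^{1/2}$. Data. One observes i.i.d. $Z_i=(X_i,Y_i)$, $i=1,\dots,n$, with $X_i$ uniform on $[0,1)$ and $Y_i=\theta_0(X_i)+\varepsilon_i$, where the $\varepsilon_i\sim N(0,1)$ are i.i.d. and independent of the $X_i$. The true function is $\theta_0=\sum_{j=1}^{k_0}a_j^0I(t_{j-1}^0\le x<t_j^0)\in\Theta_{k_0}^\delta\subset\Theta^\delta$,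 $k_0\le k_{max}$, with $a_j^0\ne a_{j-1}^0$ for $2\le j\le k_0$. $P_\theta$ is the law of one observation under $\theta$, with density $p_\theta$; $P_0=P_{\theta_0}$, and $P_0^n$ is the law of $(Z_1,\dots,Z_n)$ under $\theta_0$. Prior. $\Pi=\sum_{k=1}^{k_{max}}p(k)\Pi_k$ with $p(k)>0$, $\sum_kp(k)=1$, where $\Pi_k$ is a probability measure on $\Theta_k^\delta$ with density $\pi_k(a,t)=\pi_k^a(a|t)\pi_k^t(t)$ with respect to Lebesgue measure. Assumption (A) (version for $\Theta^\delta$): for each $k$, the densities $\pi_k^a(a|t)$ and $\pi_k^t(t)$ are bounded away from zero and infinity on $[-K,K]^k$ and $T_k^\delta$ respectively. Posterior. $\Pi^n(A)=\int_A\prod_{i=1}^np_\theta(Z_i)\,d\Pi(\theta)\big/\int\prod_{i=1}^np_\theta(Z_i)\,d\Pi(\theta)$. *)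

theory Defs
  imports "HOL-Probability.Probability"
begin

text \<open>
  A parameter is a triple \<open>(k, a, t)\<close>: the number \<open>k\<close> of segments, the levels
  \<open>a 1, \<dots>, a k\<close> and the interior change-points \<open>t 1, \<dots>, t (k - 1)\<close>. The vectors
  \<open>a\<close> and \<open>t\<close> are extensional functions on their index sets, so that Lebesgue measure on
  \<open>\<real>\<^sup>k \<times> \<real>\<^sup>k\<^sup>-\<^sup>1\<close> is a product of copies of \<open>lborel\<close>; for \<open>k = 1\<close> the second
  factor is the unit point mass on the one-point space.
\<close>

type_synonym param = "nat \<times> (nat \<Rightarrow> real) \<times> (nat \<Rightarrow> real)"

definition knot :: "nat \<Rightarrow> (nat \<Rightarrow> real) \<Rightarrow> nat \<Rightarrow> real" where
  "knot k t j = (if j = 0 then 0 else if j = k then 1 else t j)"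

definition levels :: "real \<Rightarrow> nat \<Rightarrow> (nat \<Rightarrow> real) set" where
  "levels K k = (\<Pi>\<^sub>E j\<in>{1..k}. {-K..K})"

definition changepoints :: "real \<Rightarrow> nat \<Rightarrow> (nat \<Rightarrow> real) set" where
  "changepoints \<delta> k = {t \<in> (\<Pi>\<^sub>E j\<in>{1..<k}. UNIV).
     \<forall>j\<in>{1..k}. knot k t (j - 1) < knot k t j \<and> \<bar>knot k t j - knot k t (j - 1)\<bar> \<ge> \<delta>}"

definition Theta :: "nat \<Rightarrow> real \<Rightarrow> real \<Rightarrow> param set" where
  "Theta kmax K \<delta> = (\<Union>k\<in>{1..kmax}. {k} \<times> levels K k \<times> changepoints \<delta> k)"

definition step_fun :: "param \<Rightarrow> real \<Rightarrow> real" where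
  "step_fun = (\<lambda>(k, a, t) x. \<Sum>j=1..k. a j * indicator {knot k t (j - 1)..<knot k t j} x)"

definition L2_norm :: "(real \<Rightarrow> real) \<Rightarrow> real" where
  "L2_norm f = sqrt (LINT x:{0..<1}|lborel. (f x)\<^sup>2)"

text \<open>The law of \<open>(X, f X + \<epsilon>)\<close> with \<open>X\<close> uniform on \<open>[0, 1)\<close> and independent standard
  normal noise \<open>\<epsilon>\<close>, and its Lebesgue density.\<close>

definition obs_law :: "(real \<Rightarrow> real) \<Rightarrow> (real \<times> real) measure" where
  "obs_law f = distr (uniform_measure lborel {0..<1} \<Otimes>\<^sub>M density lborel std_normal_density)
     borel (\<lambda>(x, e). (x, f x + e))"

definition obs_density :: "(real \<Rightarrow> real) \<Rightarrow> real \<times> real \<Rightarrow> real" where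
  "obs_density f = (\<lambda>(x, y). indicator {0..<1} x * normal_density (f x) 1 y)"

definition sample_law :: "nat \<Rightarrow> (real \<Rightarrow> real) \<Rightarrow> (nat \<Rightarrow> real \<times> real) measure" where
  "sample_law n f = (\<Pi>\<^sub>M i\<in>{1..n}. obs_law f)"

lemma obs_law_eq_density:
  assumes [measurable]: "f \<in> borel_measurable borel"
  shows "obs_law f = density lborel (\<lambda>z. ennreal (obs_density f z))"
proof (rule measure_eqI)
  fix A assume "A \<in> sets (obs_law f)"
  then have [measurable]: "A \<in> sets (borel \<Otimes>\<^sub>M borel :: (real \<times> real) measure)"
    unfolding borel_prod obs_law_def by simp
  have [measurable]: "(\<lambda>(x, e). (x, f x + e)) \<in> borel \<Otimes>\<^sub>M borel \<rightarrow>\<^sub>M borel \<Otimes>\<^sub>M (borel :: real measure)"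
    by measurable
  interpret N: prob_space "density lborel std_normal_density"
    by (rule prob_space_normal_density) simp
  have mp: "(\<lambda>(x, e). (x, f x + e)) \<in> uniform_measure lborel {0..<1} \<Otimes>\<^sub>M density lborel std_normal_density \<rightarrow>\<^sub>M borel"
    unfolding borel_prod[symmetric] by (simp cong: measurable_cong_sets)
  have "emeasure (obs_law f) A = (\<integral>\<^sup>+ z. indicator A (case z of (x, e) \<Rightarrow> (x, f x + e))
      \<partial>(uniform_measure lborel {0..<1} \<Otimes>\<^sub>M density lborel std_normal_density))"
  proof -
    have A: "indicator A \<in> borel_measurable (borel :: (real \<times> real) measure)"
      using \<open>A \<in> sets (obs_law f)\<close> by (simp add: obs_law_def)
    have "emeasure (obs_law f) A = (\<integral>\<^sup>+ z. indicator A z \<partial>obs_law f)"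
      using \<open>A \<in> sets (obs_law f)\<close> by simp
    also have "\<dots> = (\<integral>\<^sup>+ z. indicator A (case z of (x, e) \<Rightarrow> (x, f x + e))
        \<partial>(uniform_measure lborel {0..<1} \<Otimes>\<^sub>M density lborel std_normal_density))"
      unfolding obs_law_def by (rule nn_integral_distr[OF mp]) (simp add: A)
    finally show ?thesis .
  qed
  also have "\<dots> = (\<integral>\<^sup>+ x. \<integral>\<^sup>+ e. indicator A (x, f x + e) \<partial>density lborel std_normal_density
      \<partial>uniform_measure lborel {0..<1})"
    by (subst N.nn_integral_fst[symmetric]) (simp_all cong: measurable_cong_sets)
  also have "\<dots> = (\<integral>\<^sup>+ x. indicator {0..<1} x * (\<integral>\<^sup>+ e. ennreal (std_normal_density e) * indicator A (x, f x + e) \<partial>lborel) \<partial>lborel)"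
    by (simp add: nn_integral_uniform_measure nn_integral_density mult.commute divide_ennreal_def)
  also have "\<dots> = (\<integral>\<^sup>+ x. \<integral>\<^sup>+ y. ennreal (obs_density f (x, y)) * indicator A (x, y) \<partial>lborel \<partial>lborel)"
  proof (rule nn_integral_cong)
    fix x :: real
    have "(\<integral>\<^sup>+ y. ennreal (normal_density (f x) 1 y) * indicator A (x, y) \<partial>lborel) =
      (\<integral>\<^sup>+ e. ennreal (normal_density (f x) 1 (f x + e)) * indicator A (x, f x + e) \<partial>lborel)"
      using nn_integral_real_affine[of "\<lambda>y. ennreal (normal_density (f x) 1 y) * indicator A (x, y)" 1 "f x"]
      by simp
    then show "indicator {0..<1} x * (\<integral>\<^sup>+ e. ennreal (std_normal_density e) * indicator A (x, f x + e) \<partial>lborel) =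
      (\<integral>\<^sup>+ y. ennreal (obs_density f (x, y)) * indicator A (x, y) \<partial>lborel)"
      by (cases "x \<in> {0..<1}") (simp_all add: obs_density_def normal_density_def)
  qed
  also have "\<dots> = emeasure (density lborel (\<lambda>z. ennreal (obs_density f z))) A"
  proof -
    have obs: "obs_density f \<in> borel_measurable (borel \<Otimes>\<^sub>M borel)"
      unfolding obs_density_def normal_density_def by measurable
    have sets_eq: "sets (lborel \<Otimes>\<^sub>M lborel) = sets (borel \<Otimes>\<^sub>M borel :: (real \<times> real) measure)"
      by (intro sets_pair_measure_cong) simp_all
    have A: "A \<in> sets (lborel \<Otimes>\<^sub>M lborel)"
      unfolding sets_eq by measurable
    have dens: "(\<lambda>z. ennreal (obs_density f z)) \<in> borel_measurable (lborel \<Otimes>\<^sub>M lborel)"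
      unfolding measurable_cong_sets[OF sets_eq refl]
      by (rule measurable_compose[OF obs measurable_ennreal])
    have "(\<integral>\<^sup>+ x. \<integral>\<^sup>+ y. ennreal (obs_density f (x, y)) * indicator A (x, y) \<partial>lborel \<partial>lborel) =
      (\<integral>\<^sup>+ z. ennreal (obs_density f z) * indicator A z \<partial>(lborel \<Otimes>\<^sub>M lborel))"
      by (rule lborel.nn_integral_fst[OF borel_measurable_times_ennreal[OF dens borel_measurable_indicator[OF A]]])
    also have "\<dots> = emeasure (density (lborel \<Otimes>\<^sub>M lborel) (\<lambda>z. ennreal (obs_density f z))) A"
      by (rule emeasure_density[OF dens A, symmetric])
    finally show ?thesis
      by (simp only: lborel_prod)
  qed
  finally show "emeasure (obs_law f) A = emeasure (density lborel (\<lambda>z. ennreal (obs_density f z))) A" .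
qed (simp add: obs_law_def)

definition lebesgue_levels :: "nat \<Rightarrow> (nat \<Rightarrow> real) measure" where
  "lebesgue_levels k = (\<Pi>\<^sub>M j\<in>{1..k}. lborel)"

definition lebesgue_changepoints :: "nat \<Rightarrow> (nat \<Rightarrow> real) measure" where
  "lebesgue_changepoints k = (\<Pi>\<^sub>M j\<in>{1..<k}. lborel)"

text \<open>\<open>\<pi>t\<close> is a probability density on the change-points and \<open>\<pi>a a t\<close>, read
  \<open>\<pi>a(a | t)\<close>, is a conditional probability density on the levels. Their values off
  \<open>changepoints \<delta> k\<close> and \<open>levels K k\<close> are never used.\<close>

definition prior_densities ::
  "real \<Rightarrow> real \<Rightarrow> nat \<Rightarrow> ((nat \<Rightarrow> real) \<Rightarrow> (nat \<Rightarrow> real) \<Rightarrow> real) \<Rightarrow> ((nat \<Rightarrow> real) \<Rightarrow> real) \<Rightarrow> bool" where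
  "prior_densities K \<delta> k \<pi>a \<pi>t \<longleftrightarrow>
     (\<lambda>(a, t). \<pi>a a t) \<in> borel_measurable (lebesgue_levels k \<Otimes>\<^sub>M lebesgue_changepoints k) \<and>
     \<pi>t \<in> borel_measurable (lebesgue_changepoints k) \<and>
     (\<forall>t\<in>changepoints \<delta> k. \<forall>a\<in>levels K k. \<pi>a a t \<ge> 0) \<and>
     (\<forall>t\<in>changepoints \<delta> k. \<pi>t t \<ge> 0) \<and>
     (\<forall>t\<in>changepoints \<delta> k. (\<integral>\<^sup>+a\<in>levels K k. ennreal (\<pi>a a t) \<partial>lebesgue_levels k) = 1) \<and>
     (\<integral>\<^sup>+t\<in>changepoints \<delta> k. ennreal (\<pi>t t) \<partial>lebesgue_changepoints k) = 1"

definition prior_bounds ::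
  "real \<Rightarrow> real \<Rightarrow> nat \<Rightarrow> ((nat \<Rightarrow> real) \<Rightarrow> (nat \<Rightarrow> real) \<Rightarrow> real) \<Rightarrow> ((nat \<Rightarrow> real) \<Rightarrow> real) \<Rightarrow> bool" where
  "prior_bounds K \<delta> k \<pi>a \<pi>t \<longleftrightarrow>
     (\<exists>c>0. \<exists>C. \<forall>t\<in>changepoints \<delta> k.
        c \<le> \<pi>t t \<and> \<pi>t t \<le> C \<and> (\<forall>a\<in>levels K k. c \<le> \<pi>a a t \<and> \<pi>a a t \<le> C))"

definition prior_component ::
  "real \<Rightarrow> real \<Rightarrow> nat \<Rightarrow> ((nat \<Rightarrow> real) \<Rightarrow> (nat \<Rightarrow> real) \<Rightarrow> real) \<Rightarrow> ((nat \<Rightarrow> real) \<Rightarrow> real) \<Rightarrow>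
     ((nat \<Rightarrow> real) \<times> (nat \<Rightarrow> real)) measure" where
  "prior_component K \<delta> k \<pi>a \<pi>t =
     density (lebesgue_levels k \<Otimes>\<^sub>M lebesgue_changepoints k)
       (\<lambda>(a, t). ennreal (\<pi>a a t * \<pi>t t) * indicator (levels K k \<times> changepoints \<delta> k) (a, t))"

lemma prob_space_prior_component:
  assumes "prior_densities K \<delta> k \<pi>a \<pi>t"
  shows "prob_space (prior_component K \<delta> k \<pi>a \<pi>t)"
proof -
  let ?LA = "lebesgue_levels k" and ?LT = "lebesgue_changepoints k"
  have [measurable]: "(\<lambda>(a, t). \<pi>a a t) \<in> borel_measurable (?LA \<Otimes>\<^sub>M ?LT)" "\<pi>t \<in> borel_measurable ?LT"
    and int_a: "\<And>t. t \<in> changepoints \<delta> k \<Longrightarrow> (\<integral>\<^sup>+a\<in>levels K k. ennreal (\<pi>a a t) \<partial>?LA) = 1"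
    and int_t: "(\<integral>\<^sup>+t\<in>changepoints \<delta> k. ennreal (\<pi>t t) \<partial>?LT) = 1"
    and pos: "\<And>t. t \<in> changepoints \<delta> k \<Longrightarrow> \<pi>t t \<ge> 0"
    using assms by (auto simp: prior_densities_def)
  interpret A: sigma_finite_measure ?LA
    unfolding lebesgue_levels_def by (intro product_sigma_finite.sigma_finite)
      (simp_all add: product_sigma_finite_def sigma_finite_lborel)
  interpret T: sigma_finite_measure ?LT
    unfolding lebesgue_changepoints_def by (intro product_sigma_finite.sigma_finite)
      (simp_all add: product_sigma_finite_def sigma_finite_lborel)
  interpret AT: pair_sigma_finite ?LA ?LT ..
  have [measurable]: "levels K k \<in> sets ?LA"
    unfolding levels_def lebesgue_levels_def by (intro sets_PiM_I_finite) auto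
  have kn: "(\<lambda>t. knot k t j) \<in> borel_measurable ?LT" if "j \<le> k" for j
  proof (cases "j = 0 \<or> j = k")
    case False
    then have "(\<lambda>t. t j) \<in> borel_measurable ?LT"
      using that unfolding lebesgue_changepoints_def by simp
    then show ?thesis using False by (simp add: knot_def)
  next
    case True
    then have "(\<lambda>t. knot k t j) = (\<lambda>t. if j = 0 then 0 else 1)"
      by (auto simp: knot_def)
    then show ?thesis by simp
  qed
  have "Measurable.pred ?LT (\<lambda>t. knot k t (j - 1) < knot k t j \<and> \<bar>knot k t j - knot k t (j - 1)\<bar> \<ge> \<delta>)"
    if "j \<in> {1..k}" for j
  proof -
    have [measurable]: "(\<lambda>t. knot k t j) \<in> borel_measurable ?LT" "(\<lambda>t. knot k t (j - 1)) \<in> borel_measurable ?LT"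
      using that by (auto intro!: kn)
    show ?thesis by measurable
  qed
  then have "{t \<in> space ?LT. \<forall>j\<in>{1..k}. knot k t (j - 1) < knot k t j \<and> \<bar>knot k t j - knot k t (j - 1)\<bar> \<ge> \<delta>} \<in> sets ?LT"
    by (intro sets.sets_Collect_finite_All) (auto simp: pred_def)
  then have [measurable]: "changepoints \<delta> k \<in> sets ?LT"
    by (simp add: changepoints_def lebesgue_changepoints_def space_PiM)
  have dens: "(\<lambda>(a, t). ennreal (\<pi>a a t * \<pi>t t) * indicator (levels K k \<times> changepoints \<delta> k) (a, t))
      \<in> borel_measurable (?LA \<Otimes>\<^sub>M ?LT)"
    by measurable
  have "emeasure (prior_component K \<delta> k \<pi>a \<pi>t) (space (prior_component K \<delta> k \<pi>a \<pi>t)) =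
      (\<integral>\<^sup>+ z. (case z of (a, t) \<Rightarrow> ennreal (\<pi>a a t * \<pi>t t) * indicator (levels K k \<times> changepoints \<delta> k) (a, t))
        \<partial>(?LA \<Otimes>\<^sub>M ?LT))"
    unfolding prior_component_def using dens
    by (simp add: emeasure_density cong: nn_integral_cong)
  also have "\<dots> = (\<integral>\<^sup>+ t. \<integral>\<^sup>+ a. ennreal (\<pi>a a t * \<pi>t t) * indicator (levels K k \<times> changepoints \<delta> k) (a, t) \<partial>?LA \<partial>?LT)"
    using AT.nn_integral_snd[OF dens] by simp
  also have "\<dots> = (\<integral>\<^sup>+t\<in>changepoints \<delta> k. ennreal (\<pi>t t) \<partial>?LT)"
  proof (rule nn_integral_cong)
    fix t assume t: "t \<in> space ?LT"
    have [measurable]: "(\<lambda>a. \<pi>a a t) \<in> borel_measurable ?LA"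
      using measurable_compose[OF measurable_Pair2'[OF t]
          \<open>(\<lambda>(a, t). \<pi>a a t) \<in> borel_measurable (?LA \<Otimes>\<^sub>M ?LT)\<close>] by simp
    show "(\<integral>\<^sup>+ a. ennreal (\<pi>a a t * \<pi>t t) * indicator (levels K k \<times> changepoints \<delta> k) (a, t) \<partial>?LA) =
        ennreal (\<pi>t t) * indicator (changepoints \<delta> k) t"
    proof (cases "t \<in> changepoints \<delta> k")
      case True
      have "(\<integral>\<^sup>+ a. ennreal (\<pi>a a t * \<pi>t t) * indicator (levels K k \<times> changepoints \<delta> k) (a, t) \<partial>?LA) =
          (\<integral>\<^sup>+ a. ennreal (\<pi>t t) * (ennreal (\<pi>a a t) * indicator (levels K k) a) \<partial>?LA)"
        using True pos[OF True]
        by (intro nn_integral_cong) (simp add: indicator_def ennreal_mult' mult_ac)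
      also have "\<dots> = ennreal (\<pi>t t)"
        by (subst nn_integral_cmult) (simp_all add: int_a[OF True])
      finally show ?thesis using True by simp
    qed simp
  qed
  also have "\<dots> = 1" by (rule int_t)
  finally show ?thesis by (rule prob_spaceI)
qed

text \<open>A common measurable space containing \<open>{k} \<times> levels K k \<times> changepoints \<delta> k\<close> for every \<open>k\<close>.\<close>

definition param_space :: "param measure" where
  "param_space = count_space UNIV \<Otimes>\<^sub>M (\<Pi>\<^sub>M j\<in>UNIV. borel) \<Otimes>\<^sub>M (\<Pi>\<^sub>M j\<in>UNIV. borel)"

definition prior ::
  "nat \<Rightarrow> real \<Rightarrow> real \<Rightarrow> (nat \<Rightarrow> real) \<Rightarrow> (nat \<Rightarrow> (nat \<Rightarrow> real) \<Rightarrow> (nat \<Rightarrow> real) \<Rightarrow> real) \<Rightarrow>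
     (nat \<Rightarrow> (nat \<Rightarrow> real) \<Rightarrow> real) \<Rightarrow> param measure" where
  "prior kmax K \<delta> p \<pi>a \<pi>t = measure_of (space param_space) (sets param_space)
     (\<lambda>A. \<Sum>k=1..kmax. ennreal (p k) *
        emeasure (distr (prior_component K \<delta> k (\<pi>a k) (\<pi>t k)) param_space (Pair k)) A)"

lemma space_prior [simp]: "space (prior kmax K \<delta> p \<pi>a \<pi>t) = UNIV"
  by (simp add: prior_def param_space_def space_pair_measure space_PiM)

lemma sets_prior [simp, measurable_cong]: "sets (prior kmax K \<delta> p \<pi>a \<pi>t) = sets param_space"
  by (simp add: prior_def)

lemma emeasure_prior:
  assumes "A \<in> sets param_space"
  shows "emeasure (prior kmax K \<delta> p \<pi>a \<pi>t) A = (\<Sum>k=1..kmax. ennreal (p k) *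
    emeasure (distr (prior_component K \<delta> k (\<pi>a k) (\<pi>t k)) param_space (Pair k)) A)"
  unfolding prior_def
proof (rule emeasure_measure_of_sigma)
  show "sigma_algebra (space param_space) (sets param_space)"
    by (rule sets.sigma_algebra_axioms)
  show "positive (sets param_space) (\<lambda>A. \<Sum>k=1..kmax. ennreal (p k) *
      emeasure (distr (prior_component K \<delta> k (\<pi>a k) (\<pi>t k)) param_space (Pair k)) A)"
    by (simp add: positive_def)
  show "countably_additive (sets param_space) (\<lambda>A. \<Sum>k=1..kmax. ennreal (p k) *
      emeasure (distr (prior_component K \<delta> k (\<pi>a k) (\<pi>t k)) param_space (Pair k)) A)"
  proof (rule countably_additiveI)
    fix B :: "nat \<Rightarrow> param set"
    assume B: "range B \<subseteq> sets param_space" "disjoint_family B"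
    show "(\<Sum>i. \<Sum>k=1..kmax. ennreal (p k) *
        emeasure (distr (prior_component K \<delta> k (\<pi>a k) (\<pi>t k)) param_space (Pair k)) (B i)) =
      (\<Sum>k=1..kmax. ennreal (p k) *
        emeasure (distr (prior_component K \<delta> k (\<pi>a k) (\<pi>t k)) param_space (Pair k)) (\<Union>i. B i))"
      using B by (subst suminf_sum) (simp_all add: ennreal_suminf_cmult suminf_emeasure)
  qed
qed (use assms in auto)

lemma measurable_Pair_param_space:
  "Pair k \<in> prior_component K \<delta> k \<pi>a \<pi>t \<rightarrow>\<^sub>M param_space"
proof -
  have incl: "(\<lambda>f. f) \<in> (\<Pi>\<^sub>M j\<in>I. lborel) \<rightarrow>\<^sub>M (\<Pi>\<^sub>M j\<in>UNIV. (borel :: real measure))" for I :: "nat set"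
  proof (rule measurable_PiM_single')
    fix j :: nat
    show "(\<lambda>f. f j) \<in> (\<Pi>\<^sub>M j\<in>I. lborel) \<rightarrow>\<^sub>M (borel :: real measure)"
    proof (cases "j \<in> I")
      case False
      have "(\<lambda>f. f j) \<in> (\<Pi>\<^sub>M j\<in>I. lborel) \<rightarrow>\<^sub>M (borel :: real measure) \<longleftrightarrow>
        (\<lambda>f. undefined) \<in> (\<Pi>\<^sub>M j\<in>I. lborel :: real measure) \<rightarrow>\<^sub>M (borel :: real measure)"
        using False by (intro measurable_cong) (auto simp: space_PiM PiE_def extensional_def)
      then show ?thesis by simp
    qed simp
  qed (auto simp: space_PiM)
  have "(\<lambda>x. (k, fst x, snd x)) \<in> lebesgue_levels k \<Otimes>\<^sub>M lebesgue_changepoints k \<rightarrow>\<^sub>M param_space"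
    unfolding param_space_def lebesgue_levels_def lebesgue_changepoints_def
    by (intro measurable_Pair measurable_const measurable_compose[OF measurable_fst incl]
        measurable_compose[OF measurable_snd incl]) auto
  then show ?thesis
    by (simp add: prior_component_def cong: measurable_cong_sets)
qed

lemma prob_space_prior:
  assumes "\<And>k. k \<in> {1..kmax} \<Longrightarrow> p k > 0" "(\<Sum>k=1..kmax. p k) = 1"
    and "\<And>k. k \<in> {1..kmax} \<Longrightarrow> prior_densities K \<delta> k (\<pi>a k) (\<pi>t k)"
  shows "prob_space (prior kmax K \<delta> p \<pi>a \<pi>t)"
proof (rule prob_spaceI)
  have sp: "space param_space = UNIV"
    by (simp add: param_space_def space_pair_measure space_PiM)
  have "emeasure (prior kmax K \<delta> p \<pi>a \<pi>t) UNIV = (\<Sum>k=1..kmax. ennreal (p k) *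
      emeasure (distr (prior_component K \<delta> k (\<pi>a k) (\<pi>t k)) param_space (Pair k)) UNIV)"
    using sets.top[of param_space] by (intro emeasure_prior) (simp add: sp)
  also have "\<dots> = (\<Sum>k=1..kmax. ennreal (p k))"
  proof (rule sum.cong)
    fix k assume "k \<in> {1..kmax}"
    then interpret C: prob_space "prior_component K \<delta> k (\<pi>a k) (\<pi>t k)"
      by (intro prob_space_prior_component assms(3))
    interpret D: prob_space "distr (prior_component K \<delta> k (\<pi>a k) (\<pi>t k)) param_space (Pair k)"
      by (rule C.prob_space_distr[OF measurable_Pair_param_space])
    show "ennreal (p k) * emeasure (distr (prior_component K \<delta> k (\<pi>a k) (\<pi>t k)) param_space (Pair k)) UNIV =
        ennreal (p k)"
      using D.emeasure_space_1 by (simp add: sp)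
  qed simp
  also have "\<dots> = 1"
    using assms(1,2) by (subst sum_ennreal) (auto intro: less_imp_le)
  finally show "emeasure (prior kmax K \<delta> p \<pi>a \<pi>t) (space (prior kmax K \<delta> p \<pi>a \<pi>t)) = 1"
    by simp
qed

definition likelihood :: "nat \<Rightarrow> (nat \<Rightarrow> real \<times> real) \<Rightarrow> param \<Rightarrow> real" where
  "likelihood n z \<theta> = (\<Prod>i=1..n. obs_density (step_fun \<theta>) (z i))"

definition posterior ::
  "param measure \<Rightarrow> nat \<Rightarrow> (nat \<Rightarrow> real \<times> real) \<Rightarrow> param set \<Rightarrow> real" where
  "posterior \<nu> n z A = (LINT \<theta>:A|\<nu>. likelihood n z \<theta>) / (LINT \<theta>|\<nu>. likelihood n z \<theta>)"

end

(*
  The rate carries no logarithmic factor because tests and prior mass are both handled locally, at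
  scale r around the true function.

  Tests: if the difference h of two step functions has norm at least r, then it has constant sign
  and modulus of order r on a cell of a fixed grid, or modulus of order 1 on an interval of length of
  order r^2 on one side of a true change-point. So one of boundedly many tests based on residuals
  summed over an interval has error probabilities exp(- c n r^2), without any covering argument.

  Prior mass: with D = k0 + 2 (k0 - 1), a ball of radius r has mass at most C r^D, since k0 levels are
  then determined up to O(r) and k0 - 1 change-points up to O(r^2); and the functions with levels
  within r and change-points within r^2 of the true ones have mass at least c r^D.

  Normalising integral: for norm h = O(1 / sqrt n) the expected inverse likelihood ratio under the true
  law is (integral of exp (h^2))^n = O(1), so with large probability the integral is at least a
  constant multiple of the prior mass of such a neighbourhood. Summing C ((j + 1) / sqrt n)^D
  exp (- c j^2) over the shells j / sqrt n <= norm h < (j + 1) / sqrt n with j >= M_n, and dividing by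
  c n^(- D / 2), leaves the tail of a convergent series.
*)
theory Submission
  imports Defs
begin

text \<open>Moving a change-point by d changes the squared norm by an amount of order d, not of
  order d squared. This is why each change-point counts twice in the exponent D and why intervals of
  length of order r^2 appear next to the true change-points. Models with more than k0 segments do
  not spoil the upper bound on the prior mass: a function near the true one must reproduce k0 levels
  and k0 - 1 change-points by some of its own, and there are finitely many ways to choose which; the
  remaining coordinates stay bounded and contribute a constant. The spacing \<delta> makes the
  arguments uniform: every segment of either function contains a cell of a grid whose mesh depends
  on \<delta> alone. The true function may sit on the boundary of the parameter set (a level equal
  to K or -K, a spacing equal to \<delta>), so the boxes in the lower bound cannot be centred at it.
  All likelihoods are divided by that of the true function. The common factor cancels from the
  posterior, and what remains are exponential moments of Gaussian residuals.\<close>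

section \<open>Knots, segments and values of step functions\<close>

lemma knot_0 [simp]: "knot k t 0 = 0"
  by (simp add: knot_def)

lemma knot_last [simp]: "k \<ge> 1 \<Longrightarrow> knot k t k = 1"
  by (simp add: knot_def)

lemma knot_interior: "j \<in> {1..<k} \<Longrightarrow> knot k t j = t j"
  by (simp add: knot_def)

lemma changepoints_knot_gap:
  assumes t: "t \<in> changepoints \<delta> k" and "i < j" "j \<le> k"
  shows "knot k t i + \<delta> \<le> knot k t j"
  using assms(2,3)
proof (induction j)
  case (Suc j)
  have s: "knot k t j < knot k t (Suc j)" "\<delta> \<le> \<bar>knot k t (Suc j) - knot k t j\<bar>"
    using t Suc.prems unfolding changepoints_def by (auto dest!: bspec[of _ _ "Suc j"])
  show ?case
  proof (cases "i = j")
    case True with s show ?thesis by auto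
  next
    case False
    then have "knot k t i + \<delta> \<le> knot k t j" using Suc by auto
    then show ?thesis using s by linarith
  qed
qed simp

lemma changepoints_knot_mono:
  assumes "t \<in> changepoints \<delta> k" "0 < \<delta>" "i \<le> j" "j \<le> k"
  shows "knot k t i \<le> knot k t j"
  using changepoints_knot_gap[OF assms(1), of i j] assms by (cases "i = j") auto

lemma changepoints_knot_bounds:
  assumes "t \<in> changepoints \<delta> k" "0 < \<delta>" "j \<le> k" "k \<ge> 1"
  shows "0 \<le> knot k t j" "knot k t j \<le> 1"
  using changepoints_knot_mono[OF assms(1,2), of 0 j] changepoints_knot_mono[OF assms(1,2), of j k] assms
  by auto

text \<open>The least index whose knot exceeds \<open>x\<close> works, because the knots with
  indices 0 and \<open>k\<close> are 0 and 1 by definition; no order among the interior knots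
  enters.\<close>

lemma ex_segment:
  assumes "k \<ge> 1" "0 \<le> x" "x < 1"
  obtains j where "j \<in> {1..k}" "knot k t (j - 1) \<le> x" "x < knot k t j"
proof -
  let ?P = "\<lambda>j. x < knot k t j"
  have P: "?P k" using assms by simp
  let ?j = "LEAST j. ?P j"
  have 1: "?P ?j" by (rule LeastI[of ?P, OF P])
  have 2: "?j \<le> k" by (rule Least_le[of ?P, OF P])
  have 3: "?j \<noteq> 0" using 1 assms by (metis knot_0 not_le)
  have "\<not> ?P (?j - 1)" using 3 by (intro not_less_Least) auto
  then show ?thesis using 1 2 3 by (intro that[of ?j]) auto
qed

lemma step_fun_segment:
  assumes t: "t \<in> changepoints \<delta> k" and "0 < \<delta>" and j: "j \<in> {1..k}"
    and x: "knot k t (j - 1) \<le> x" "x < knot k t j"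
  shows "step_fun (k, a, t) x = a j"
proof -
  have "indicator {knot k t (i - 1)..<knot k t i} x = (if i = j then 1 else 0 :: real)" if "i \<in> {1..k}" for i
  proof -
    consider "i < j" | "i = j" | "j < i" by linarith
    then show ?thesis
    proof cases
      case 1
      have "knot k t i \<le> knot k t (j - 1)"
        using 1 j by (intro changepoints_knot_mono[OF t]) (auto simp: assms)
      then show ?thesis using 1 x by (auto simp: indicator_def)
    next
      case 3
      have "knot k t j \<le> knot k t (i - 1)"
        using 3 that by (intro changepoints_knot_mono[OF t]) (auto simp: assms)
      then show ?thesis using 3 x by (auto simp: indicator_def)
    qed (use x in auto)
  qed
  then have "step_fun (k, a, t) x = (\<Sum>i=1..k. a i * (if i = j then 1 else 0))"
    unfolding step_fun_def prod.case by (intro sum.cong refl arg_cong2[where f="(*)"]) blast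
  also have "\<dots> = a j" using j by (simp add: sum.delta if_distrib cong: if_cong)
  finally show ?thesis .
qed

lemma Theta_iff:
  "(k, a, t) \<in> Theta kmax K \<delta> \<longleftrightarrow> k \<in> {1..kmax} \<and> a \<in> levels K k \<and> t \<in> changepoints \<delta> k"
  by (auto simp: Theta_def)

lemma levels_abs_le: "a \<in> levels K k \<Longrightarrow> j \<in> {1..k} \<Longrightarrow> \<bar>a j\<bar> \<le> K"
  unfolding levels_def by (auto simp: abs_le_iff dest!: PiE_mem)

lemma Theta_step_fun_abs_le:
  assumes "(k, a, t) \<in> Theta kmax K \<delta>" "0 < \<delta>" "x \<in> {0..<1}"
  shows "\<bar>step_fun (k, a, t) x\<bar> \<le> K"
proof -
  obtain j where j: "j \<in> {1..k}" "knot k t (j - 1) \<le> x" "x < knot k t j"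
    using ex_segment[of k x t] assms by (auto simp: Theta_iff)
  then have "step_fun (k, a, t) x = a j"
    using assms by (intro step_fun_segment) (auto simp: Theta_iff)
  then show ?thesis using levels_abs_le j assms by (auto simp: Theta_iff)
qed

lemma step_fun_measurable [measurable]: "step_fun \<theta> \<in> borel_measurable borel"
proof (cases \<theta>)
  case (fields k a t)
  show ?thesis unfolding step_fun_def fields prod.case by measurable
qed

section \<open>Bounds between the norm and values on intervals\<close>

lemma L2_norm_nonneg [simp]: "0 \<le> L2_norm f"
  unfolding L2_norm_def set_lebesgue_integral_def by (auto intro!: integral_nonneg_AE)

lemma L2_norm_power2: "(L2_norm f)\<^sup>2 = (LINT x:{0..<1}|lborel. (f x)\<^sup>2)"
  unfolding L2_norm_def set_lebesgue_integral_def by (auto intro!: integral_nonneg_AE)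

text \<open>The dominating function is integrated over the whole line, so the intervals may overlap
  and may leave [0, 1). A square that is not integrable has Bochner integral 0, which keeps the
  bound true without measurability of \<open>f\<close>.\<close>

lemma L2_norm_power2_le:
  fixes l u :: "'i \<Rightarrow> real"
  assumes I: "finite I" "\<And>i. i \<in> I \<Longrightarrow> l i \<le> u i" and ab: "0 \<le> \<alpha>" "0 \<le> \<beta>"
    and le: "\<And>x. x \<in> {0..<1} \<Longrightarrow> (f x)\<^sup>2 \<le> \<alpha> + \<beta> * (\<Sum>i\<in>I. indicator {l i..<u i} x)"
  shows "(L2_norm f)\<^sup>2 \<le> \<alpha> + \<beta> * (\<Sum>i\<in>I. u i - l i)"
proof -
  let ?g = "\<lambda>x. \<alpha> * indicator {0..<1} x + \<beta> * (\<Sum>i\<in>I. indicator {l i..<u i} x)"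
  have int: "integrable lborel (\<lambda>x. indicator {l i..<u i} x :: real)" if "i \<in> I" for i
    using I(2)[OF that] by (simp add: integrable_indicator_iff)
  have "(L2_norm f)\<^sup>2 \<le> (LINT x|lborel. ?g x)"
    unfolding L2_norm_power2 set_lebesgue_integral_def
  proof (rule integral_mono')
    show "integrable lborel ?g"
      using int I(1) by (intro Bochner_Integration.integrable_add integrable_mult_right integrable_sum) auto
    show "indicat_real {0..<1} x *\<^sub>R (f x)\<^sup>2 \<le> ?g x" for x
      using le[of x] ab by (cases "x \<in> {0..<1}") (auto intro!: mult_nonneg_nonneg sum_nonneg)
    show "0 \<le> ?g x" for x using ab by (auto intro!: add_nonneg_nonneg mult_nonneg_nonneg sum_nonneg)
  qed
  also have "\<dots> = \<alpha> + \<beta> * (\<Sum>i\<in>I. u i - l i)"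
    using int I by (subst Bochner_Integration.integral_add) (auto simp: Bochner_Integration.integral_sum)
  finally show ?thesis .
qed

text \<open>The bound \<open>B\<close> is there to make the square integrable on [0, 1); otherwise
  the integral inside \<open>L2_norm\<close> could be 0 by default and no lower bound would
  hold.\<close>

lemma interval_le_L2_norm_power2:
  assumes [measurable]: "f \<in> borel_measurable borel"
    and bd: "\<And>x. x \<in> {0..<1} \<Longrightarrow> \<bar>f x\<bar> \<le> B"
    and lu: "0 \<le> l" "l \<le> u" "u \<le> 1" and b: "0 \<le> b" "\<And>x. l \<le> x \<Longrightarrow> x < u \<Longrightarrow> b \<le> \<bar>f x\<bar>"
  shows "b\<^sup>2 * (u - l) \<le> (L2_norm f)\<^sup>2"
proof -
  have "b\<^sup>2 * (u - l) = (LINT x|lborel. b\<^sup>2 * indicator {l..<u} x)"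
    using lu by simp
  also have "\<dots> \<le> (LINT x|lborel. indicator {0..<1} x *\<^sub>R (f x)\<^sup>2)"
  proof (rule integral_mono')
    have bd2: "(f x)\<^sup>2 \<le> B\<^sup>2" if "x \<in> {0..<1}" for x
      using bd[OF that] by (meson abs_ge_zero order_trans power2_abs power_mono abs_le_square_iff abs_ge_self)
    show "integrable lborel (\<lambda>x. indicat_real {0..<1} x *\<^sub>R (f x)\<^sup>2)"
      by (rule Bochner_Integration.integrable_bound[of _ "\<lambda>x. B\<^sup>2 * indicator {0..<1} x"])
        (auto intro!: AE_I2 integrable_mult_right integrable_real_indicator split: split_indicator simp: bd2
          simp del: integrable_indicator_iff)
    show "b\<^sup>2 * indicator {l..<u} x \<le> indicator {0..<1} x *\<^sub>R (f x)\<^sup>2" for x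
      using lu b by (auto simp: indicator_def abs_le_square_iff[symmetric])
    show "0 \<le> indicat_real {0..<1} x *\<^sub>R (f x)\<^sup>2" for x by simp
  qed
  finally show ?thesis unfolding L2_norm_power2 set_lebesgue_integral_def .
qed

section \<open>Detecting a large difference on one of finitely many intervals\<close>

text \<open>The first grid point at or after \<open>u\<close> lies less than one mesh width after
  \<open>u\<close>, so the cell that starts there ends before \<open>u + 2 / N\<close>.\<close>

lemma grid_interval_subset:
  fixes u v :: real and N :: nat
  assumes N: "N > 0" and "0 \<le> u" "v \<le> 1" "2 / N \<le> v - u"
  obtains m where "m < N" "u \<le> m / N" "(m + 1) / N \<le> v"
proof -
  define m where "m = nat \<lceil>u * N\<rceil>"
  have 1: "u * N \<le> m" "m < u * N + 1"
    using assms unfolding m_def by (auto simp: of_nat_nat) linarith+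
  have "u * N + 2 \<le> v * N" using assms by (simp add: field_simps)
  then have 2: "m + 1 \<le> v * N" using 1 by linarith
  also have "\<dots> \<le> N" using mult_right_mono[of v 1 "real N"] assms by simp
  finally have "real m + 1 \<le> real N" by simp
  then have "m < N" by linarith
  then show ?thesis using 1 2 N by (intro that[of m]) (auto simp: field_simps)
qed

text \<open>A test interval \<open>(l, u, b)\<close> serves to detect a difference function that has constant sign and
  modulus at least \<open>b\<close> on \<open>[l, u)\<close>; the reference change-points need intervals of length of
  the order of the squared distance.\<close>

definition test_intervals ::
  "nat \<Rightarrow> real \<Rightarrow> real \<Rightarrow> nat \<Rightarrow> (nat \<Rightarrow> real) \<Rightarrow> real \<Rightarrow> real \<Rightarrow> (real \<times> real \<times> real) set" where
  "test_intervals N c J k0 t0 w r =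
     (\<lambda>m. (real m / N, (real m + 1) / N, c * r)) ` {..<N} \<union>
     (\<lambda>i. (t0 i, t0 i + w, J / 2)) ` {1..<k0} \<union>
     (\<lambda>i. (t0 i - w, t0 i, J / 2)) ` {1..<k0}"

lemma finite_test_intervals [simp]: "finite (test_intervals N c J k0 t0 w r)"
  by (simp add: test_intervals_def)

text \<open>The bound is free of \<open>r\<close>, so a union bound over the tests costs only a
  constant factor at every distance.\<close>

lemma card_test_intervals_le: "card (test_intervals N c J k0 t0 w r) \<le> N + k0 + k0"
proof -
  have "card (test_intervals N c J k0 t0 w r) \<le> card {..<N} + card {1..<k0} + card {1..<k0}"
    unfolding test_intervals_def
    by (rule order.trans[OF card_Un_le] add_mono card_image_le finite_lessThan finite_atLeastLessThan)+
  then show ?thesis by simp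
qed

text \<open>Think of intervals from \<open>p\<close> to \<open>q\<close> and from \<open>p'\<close>
  to \<open>q'\<close>. If their intersection is neither of the two, then the one that starts first
  also ends first. For a segment of each function this tells which end of the overlap is a reference
  change-point.\<close>

lemma max_min_cases:
  fixes p q p' q' :: "'a :: linorder"
  assumes "\<not> (max p p' = p \<and> min q q' = q)" "\<not> (max p p' = p' \<and> min q q' = q')"
  obtains "max p p' = p'" "p < max p p'" "min q q' = q" "min q q' < q'"
    | "max p p' = p" "p' < max p p'" "min q q' = q'" "min q q' < q"
  using assms by (cases p p' rule: linorder_cases; cases q q' rule: linorder_cases) auto

text \<open>By contradiction. Every point lies in an overlap of one segment of each function, where
  the difference is constant. A long overlap contains a grid cell, so an undetected difference is
  below \<open>c * r\<close> there. A short overlap ends at a reference change-point, beyond which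
  the same segment of the first function continues and is compared with the neighbouring reference
  level; it must be close to that level, hence at least \<open>J / 2\<close> away from the level
  inside the overlap. If the point were farther than \<open>w\<close> from the change-point, the
  one-sided interval of length \<open>w\<close> would detect this. So the difference is small off
  the \<open>w\<close>-neighbourhoods of the reference change-points, and its norm is below
  \<open>r\<close>.\<close>

lemma step_difference_detection:
  assumes \<delta>: "0 < \<delta>" and K: "0 < K"
    and \<theta>: "(k, a, t) \<in> Theta kmax K \<delta>" and \<theta>0: "(k0, a0, t0) \<in> Theta kmax K \<delta>"
    and J: "\<And>i. i \<in> {1..<k0} \<Longrightarrow> J \<le> \<bar>a0 (i + 1) - a0 i\<bar>"
    and c: "0 \<le> c" "c \<le> 1 / 2" "c * r \<le> J / 2"
    and N: "N > 0" "4 / real N \<le> \<delta>"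
    and r: "0 < r" "r \<le> L2_norm (\<lambda>x. step_fun (k, a, t) x - step_fun (k0, a0, t0) x)"
    and w: "w = r\<^sup>2 / (32 * k0 * K\<^sup>2)"
  obtains l u b s where "(l, u, b) \<in> test_intervals N c J k0 t0 w r" "0 \<le> l" "l \<le> u" "u \<le> 1"
    "s \<in> {1, -1}" "\<And>x. l \<le> x \<Longrightarrow> x < u \<Longrightarrow> b \<le> s * (step_fun (k, a, t) x - step_fun (k0, a0, t0) x)"
proof (rule ccontr)
  note test = that
  assume neg: "\<not> thesis"
  define h where "h = (\<lambda>x. step_fun (k, a, t) x - step_fun (k0, a0, t0) x)"
  \<comment> \<open>Twice the mesh, so an interval of length \<open>e\<close> contains a whole cell;
    \<open>2 * e \<le> \<delta>\<close> leaves at least \<open>e\<close> of a segment after an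
    overlap shorter than \<open>e\<close> is cut off.\<close>
  define e where "e = 2 / real N"
  have N4: "2 * e \<le> \<delta>" "0 < e" using N by (auto simp: e_def)
  have t: "t \<in> changepoints \<delta> k" "k \<ge> 1" and t0: "t0 \<in> changepoints \<delta> k0" "k0 \<ge> 1"
    using \<theta> \<theta>0 by (auto simp: Theta_iff)
  have w0: "0 < w" using w r K t0 by simp
  have small: "\<bar>d\<bar> < b" if "(l, u, b) \<in> test_intervals N c J k0 t0 w r" "0 \<le> l" "l \<le> u" "u \<le> 1"
    "\<And>x. l \<le> x \<Longrightarrow> x < u \<Longrightarrow> h x = d" for l u b d
  proof (rule ccontr)
    assume "\<not> \<bar>d\<bar> < b"
    then have "b \<le> (if d \<ge> 0 then 1 else -1) * d" by auto
    with that have thesis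
      by (intro test[of l u b "if d \<ge> 0 then 1 else -1"]) (auto simp: h_def split: if_splits)
    with neg show False by simp
  qed
  have seg: "step_fun (k, a, t) x = a j" if "j \<in> {1..k}" "knot k t (j - 1) \<le> x" "x < knot k t j" for j x
    using step_fun_segment[OF t(1) \<delta>] that by blast
  have seg0: "step_fun (k0, a0, t0) x = a0 j"
    if "j \<in> {1..k0}" "knot k0 t0 (j - 1) \<le> x" "x < knot k0 t0 j" for j x
    using step_fun_segment[OF t0(1) \<delta>] that by blast
  have flat: "\<bar>d\<bar> < c * r" if uv: "0 \<le> u" "v \<le> 1" "e \<le> v - u"
    "\<And>x. u \<le> x \<Longrightarrow> x < v \<Longrightarrow> h x = d" for u v d
  proof -
    obtain m where m: "m < N" "u \<le> m / N" "(m + 1) / N \<le> v"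
      using grid_interval_subset[OF N(1) uv(1,2) uv(3)[unfolded e_def]] by blast
    show ?thesis
    proof (rule small[of "real m / N" "(real m + 1) / N"])
      show "(real m / real N, (real m + 1) / real N, c * r) \<in> test_intervals N c J k0 t0 w r"
        using m by (auto simp: test_intervals_def)
    qed (use m uv in \<open>auto simp: divide_right_mono\<close>)
  qed
  have gap: "knot k t (j - 1) + \<delta> \<le> knot k t j" if "j \<in> {1..k}" for j
    using changepoints_knot_gap[OF t(1), of "j - 1" j] that by auto
  have gap0: "knot k0 t0 (j - 1) + \<delta> \<le> knot k0 t0 j" if "j \<in> {1..k0}" for j
    using changepoints_knot_gap[OF t0(1), of "j - 1" j] that by auto
  have bounds: "0 \<le> knot k t j" "knot k t j \<le> 1" if "j \<le> k" for j
    using changepoints_knot_bounds[OF t(1) \<delta> that t(2)] by auto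
  have bounds0: "0 \<le> knot k0 t0 j" "knot k0 t0 j \<le> 1" if "j \<le> k0" for j
    using changepoints_knot_bounds[OF t0(1) \<delta> that t0(2)] by auto
  have hK: "(h x)\<^sup>2 \<le> 4 * K\<^sup>2" if "x \<in> {0..<1}" for x
  proof -
    have "\<bar>h x\<bar> \<le> 2 * K"
      using Theta_step_fun_abs_le[OF \<theta> \<delta> that] Theta_step_fun_abs_le[OF \<theta>0 \<delta> that]
      unfolding h_def by linarith
    then have "\<bar>h x\<bar>\<^sup>2 \<le> (2 * K)\<^sup>2" by (intro power_mono) auto
    then show ?thesis by (simp add: power_mult_distrib)
  qed
  have cover: "(h x)\<^sup>2 \<le> (c * r)\<^sup>2 + 4 * K\<^sup>2 * (\<Sum>i\<in>{1..<k0}. indicator {t0 i - w..<t0 i + w} x)"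
    if x: "x \<in> {0..<1}" for x
  proof -
    have sum0: "0 \<le> (\<Sum>i\<in>{1..<k0}. indicator {t0 i - w..<t0 i + w} x :: real)"
      by (intro sum_nonneg) auto
    have A: ?thesis if "\<bar>h x\<bar> < c * r"
    proof -
      have "\<bar>h x\<bar>\<^sup>2 \<le> (c * r)\<^sup>2" using that by (intro power_mono) auto
      moreover have "0 \<le> 4 * K\<^sup>2 * (\<Sum>i\<in>{1..<k0}. indicator {t0 i - w..<t0 i + w} x :: real)"
        using sum0 by (intro mult_nonneg_nonneg) auto
      ultimately show ?thesis by simp
    qed
    have B: ?thesis if "i \<in> {1..<k0}" "t0 i - w \<le> x" "x < t0 i + w" for i
    proof -
      have "(1::real) = (\<Sum>i\<in>{i}. indicator {t0 i - w..<t0 i + w} x)"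
        using that by simp
      also have "\<dots> \<le> (\<Sum>i\<in>{1..<k0}. indicator {t0 i - w..<t0 i + w} x)"
        using that by (intro sum_mono2) auto
      finally have "4 * K\<^sup>2 * 1 \<le> 4 * K\<^sup>2 * (\<Sum>i\<in>{1..<k0}. indicator {t0 i - w..<t0 i + w} x)"
        by (intro mult_left_mono) auto
      then show ?thesis using hK[OF x] by (smt (verit) zero_le_power2)
    qed
    obtain j where j: "j \<in> {1..k}" "knot k t (j - 1) \<le> x" "x < knot k t j"
      using ex_segment[of k x t] x t by auto
    obtain i where i: "i \<in> {1..k0}" "knot k0 t0 (i - 1) \<le> x" "x < knot k0 t0 i"
      using ex_segment[of k0 x t0] x t0 by auto
    define u where "u = max (knot k t (j - 1)) (knot k0 t0 (i - 1))"
    define v where "v = min (knot k t j) (knot k0 t0 i)"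
    have bj: "0 \<le> knot k t (j - 1)" "knot k t j \<le> 1"
      using bounds(1)[of "j - 1"] bounds(2)[of j] j by auto
    have uv: "u \<le> x" "x < v" "0 \<le> u" "v \<le> 1"
      using i j bj by (auto simp: u_def v_def le_max_iff_disj min_le_iff_disj)
    have huv: "h y = a j - a0 i" if "u \<le> y" "y < v" for y
      using seg[OF j(1)] seg0[OF i(1)] that by (auto simp: u_def v_def h_def)
    show ?thesis
    proof (cases "e \<le> v - u")
      case True
      have "\<bar>a j - a0 i\<bar> < c * r" by (rule flat[OF uv(3,4) True huv])
      then show ?thesis using huv[OF uv(1,2)] A by simp
    next
      case False
      have "\<not> (u = knot k t (j - 1) \<and> v = knot k t j)"
        using gap[OF j(1)] False N4 \<delta> by auto
      moreover have "\<not> (u = knot k0 t0 (i - 1) \<and> v = knot k0 t0 i)"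
        using gap0[OF i(1)] False N4 \<delta> by auto
      ultimately consider
          "u = knot k0 t0 (i - 1)" "knot k t (j - 1) < u" "v = knot k t j" "v < knot k0 t0 i"
        | "u = knot k t (j - 1)" "knot k0 t0 (i - 1) < u" "v = knot k0 t0 i" "v < knot k t j"
        unfolding u_def v_def by (rule max_min_cases)
      then show ?thesis
      proof cases
        case 1
        have "0 < knot k0 t0 (i - 1)" using 1 bj by linarith
        then have "i - 1 \<noteq> 0" by (metis knot_0 less_irrefl)
        then have i1: "i - 1 \<in> {1..<k0}" using i by auto
        have kn: "knot k0 t0 (i - 1) = t0 (i - 1)" using knot_interior[OF i1] .
        \<comment> \<open>Segment \<open>j\<close> sticks out to the left of the reference
          change-point \<open>u\<close> by at least \<open>e\<close>; there it is compared with the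
          preceding reference level. The second case is the mirror image to the right of
          \<open>v\<close>.\<close>
        have "\<bar>a j - a0 (i - 1)\<bar> < c * r"
        proof (rule flat[of "u - e" u])
          have g0: "knot k0 t0 (i - 1 - 1) + \<delta> \<le> u" using gap0[of "i - 1"] i1 1 by auto
          have g: "knot k t (j - 1) + \<delta> \<le> v" using gap[OF j(1)] 1 by auto
          show "0 \<le> u - e" using g0 bounds0(1)[OF le_trans[OF diff_le_self, of "i - 1" k0 1]] i1 N4 by simp
          show "u \<le> 1" using uv by auto
          show "e \<le> u - (u - e)" by simp
          fix y assume y: "u - e \<le> y" "y < u"
          have "step_fun (k, a, t) y = a j"
            using y g False N4 uv 1 by (intro seg[OF j(1)]) auto
          moreover have "step_fun (k0, a0, t0) y = a0 (i - 1)"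
            using y g0 N4 i1 1 by (intro seg0) auto
          ultimately show "h y = a j - a0 (i - 1)" by (simp add: h_def)
        qed
        moreover have "J \<le> \<bar>a0 i - a0 (i - 1)\<bar>" using J[OF i1] i1 by auto
        ultimately have big: "J / 2 \<le> \<bar>a j - a0 i\<bar>" using c by linarith
        have "x < t0 (i - 1) + w"
        proof (rule ccontr)
          assume "\<not> x < t0 (i - 1) + w"
          then have xw: "u + w \<le> x" using 1 kn by simp
          have "\<bar>a j - a0 i\<bar> < J / 2"
            by (rule small[of u "u + w"]) (use i1 kn 1 uv xw w0 huv in \<open>auto simp: test_intervals_def\<close>)
          with big show False by simp
        qed
        then show ?thesis using uv 1 kn w0 by (intro B[OF i1]) auto
      next
        case 2
        have "knot k0 t0 i < 1" using 2 bj by linarith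
        then have "i \<noteq> k0" using t0 by auto
        then have i1: "i \<in> {1..<k0}" using i by auto
        have kn: "knot k0 t0 i = t0 i" using knot_interior[OF i1] .
        have "\<bar>a j - a0 (i + 1)\<bar> < c * r"
        proof (rule flat[of v "v + e"])
          have g0: "v + \<delta> \<le> knot k0 t0 (i + 1)" using gap0[of "i + 1"] i1 2 by auto
          have g: "u + \<delta> \<le> knot k t j" using gap[OF j(1)] 2 by auto
          show "0 \<le> v" using uv by auto
          show "v + e \<le> 1" using g0 bounds0(2)[of "i + 1"] i1 N4 by simp
          show "e \<le> v + e - v" by simp
          fix y assume y: "v \<le> y" "y < v + e"
          have "step_fun (k, a, t) y = a j"
            using y g False N4 uv 2 by (intro seg[OF j(1)]) auto
          moreover have "step_fun (k0, a0, t0) y = a0 (i + 1)"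
            using y g0 N4 i1 2 by (intro seg0) auto
          ultimately show "h y = a j - a0 (i + 1)" by (simp add: h_def)
        qed
        moreover have "J \<le> \<bar>a0 (i + 1) - a0 i\<bar>" using J[OF i1] by auto
        ultimately have big: "J / 2 \<le> \<bar>a j - a0 i\<bar>" using c by linarith
        have "t0 i - w \<le> x"
        proof (rule ccontr)
          assume "\<not> t0 i - w \<le> x"
          then have xw: "x < v - w" using 2 kn by simp
          have "\<bar>a j - a0 i\<bar> < J / 2"
            by (rule small[of "v - w" v]) (use i1 kn 2 uv xw w0 huv in \<open>auto simp: test_intervals_def\<close>)
          with big show False by simp
        qed
        then show ?thesis using uv 2 kn w0 by (intro B[OF i1]) auto
      qed
    qed
  qed
  have "(L2_norm h)\<^sup>2 \<le> (c * r)\<^sup>2 + 4 * K\<^sup>2 * (\<Sum>i\<in>{1..<k0}. (t0 i + w) - (t0 i - w))"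
    by (rule L2_norm_power2_le) (use cover w0 in auto)
  moreover have "(c * r)\<^sup>2 \<le> (r / 2)\<^sup>2"
    using c r mult_right_mono[of c "1 / 2" r] by (intro power_mono) auto
  moreover have "4 * K\<^sup>2 * (\<Sum>i\<in>{1..<k0}. (t0 i + w) - (t0 i - w)) \<le> 4 * K\<^sup>2 * (k0 * (2 * w))"
    using w0 by (intro mult_left_mono) (auto intro!: mult_right_mono)
  \<comment> \<open>The constant 32 in \<open>w\<close> is chosen for this: the neighbourhoods of
    the change-points contribute a quarter of the squared distance, and the rest at most another
    quarter.\<close>
  moreover have "4 * K\<^sup>2 * (k0 * (2 * w)) = r\<^sup>2 / 4" using K t0 by (simp add: w)
  moreover have "(r / 2)\<^sup>2 + r\<^sup>2 / 4 < r\<^sup>2" using r by (simp add: power_divide)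
  ultimately have "(L2_norm h)\<^sup>2 < r\<^sup>2" by linarith
  then have "L2_norm h < r" by (rule power_less_imp_less_base) (use r in auto)
  then show False using r by (simp add: h_def)
qed

section \<open>What a function close to the true one looks like\<close>

text \<open>If the first function had no change-point within \<open>\<rho>\<close> of
  \<open>t0 i\<close>, it would be constant across that neighbourhood and differ by at least
  \<open>J / 2\<close> from the reference on one side, giving a squared norm of at least twice the
  square of \<open>r\<close>. The change-points so found are distinct because \<open>\<rho>\<close>
  is small against the spacing. The segment that ends at knot \<open>\<sigma> i\<close> then shares
  a length of at least \<open>\<delta> / 2\<close> with reference segment \<open>i\<close>, which
  pins its level. Levels and change-points outside the image of \<open>\<sigma>\<close> remain
  free.\<close>

lemma small_L2_ball_structure:
  assumes \<delta>: "0 < \<delta>" and K: "0 < K"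
    and \<theta>: "(k, a, t) \<in> Theta kmax K \<delta>" and \<theta>0: "(k0, a0, t0) \<in> Theta kmax K \<delta>"
    and J: "0 < J" "\<And>i. i \<in> {1..<k0} \<Longrightarrow> J \<le> \<bar>a0 (i + 1) - a0 i\<bar>"
    and r: "0 < r" "L2_norm (\<lambda>x. step_fun (k, a, t) x - step_fun (k0, a0, t0) x) < r"
    and \<rho>_eq: "\<rho> = 8 * r\<^sup>2 / J\<^sup>2" and \<rho>: "\<rho> \<le> \<delta> / 4"
  obtains \<sigma> where "inj_on \<sigma> {1..k0}" "\<sigma> ` {1..k0} \<subseteq> {1..k}"
    "\<And>i. i \<in> {1..<k0} \<Longrightarrow> \<sigma> i \<in> {1..<k} \<and> \<bar>t (\<sigma> i) - t0 i\<bar> \<le> \<rho>"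
    "\<And>i. i \<in> {1..k0} \<Longrightarrow> (a (\<sigma> i) - a0 i)\<^sup>2 * (\<delta> / 2) \<le> r\<^sup>2"
proof -
  define h where "h = (\<lambda>x. step_fun (k, a, t) x - step_fun (k0, a0, t0) x)"
  have t: "t \<in> changepoints \<delta> k" "k \<ge> 1" and t0: "t0 \<in> changepoints \<delta> k0" "k0 \<ge> 1"
    using \<theta> \<theta>0 by (auto simp: Theta_iff)
  have \<rho>0: "0 < \<rho>" using \<rho>_eq r J by simp
  have seg: "step_fun (k, a, t) x = a j" if "j \<in> {1..k}" "knot k t (j - 1) \<le> x" "x < knot k t j" for j x
    using step_fun_segment[OF t(1) \<delta>] that by blast
  have seg0: "step_fun (k0, a0, t0) x = a0 j"
    if "j \<in> {1..k0}" "knot k0 t0 (j - 1) \<le> x" "x < knot k0 t0 j" for j x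
    using step_fun_segment[OF t0(1) \<delta>] that by blast
  have gap: "knot k t i + \<delta> \<le> knot k t j" if "i < j" "j \<le> k" for i j
    using changepoints_knot_gap[OF t(1)] that by blast
  have gap0: "knot k0 t0 i + \<delta> \<le> knot k0 t0 j" if "i < j" "j \<le> k0" for i j
    using changepoints_knot_gap[OF t0(1)] that by blast
  have bounds: "0 \<le> knot k t j" "knot k t j \<le> 1" if "j \<le> k" for j
    using changepoints_knot_bounds[OF t(1) \<delta> that t(2)] by auto
  have bounds0: "0 \<le> knot k0 t0 j" "knot k0 t0 j \<le> 1" if "j \<le> k0" for j
    using changepoints_knot_bounds[OF t0(1) \<delta> that t0(2)] by auto
  have hK: "\<bar>h x\<bar> \<le> 2 * K" if "x \<in> {0..<1}" for x
    using Theta_step_fun_abs_le[OF \<theta> \<delta> that] Theta_step_fun_abs_le[OF \<theta>0 \<delta> that]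
    unfolding h_def by linarith
  have low: "d\<^sup>2 * (u - l) \<le> r\<^sup>2" if "0 \<le> l" "l \<le> u" "u \<le> 1" "\<And>x. l \<le> x \<Longrightarrow> x < u \<Longrightarrow> h x = d" for l u d
  proof -
    have "\<bar>d\<bar>\<^sup>2 * (u - l) \<le> (L2_norm h)\<^sup>2"
      by (rule interval_le_L2_norm_power2[of _ "2 * K"]) (use hK that in \<open>auto simp: h_def\<close>)
    also have "\<dots> \<le> r\<^sup>2" using r by (intro power_mono) (auto simp: h_def)
    finally show ?thesis by simp
  qed
  have near: "\<exists>j\<in>{1..<k}. \<bar>t j - t0 i\<bar> \<le> \<rho>" if i: "i \<in> {1..<k0}" for i
  proof (rule ccontr)
    assume far: "\<not> ?thesis"
    have kn: "knot k0 t0 i = t0 i" using knot_interior[OF i] .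
    have ti: "\<delta> \<le> t0 i" "t0 i + \<delta> \<le> 1" using gap0[of 0 i] gap0[of i k0] i kn t0 by auto
    obtain j where j: "j \<in> {1..k}" "knot k t (j - 1) \<le> t0 i" "t0 i < knot k t j"
      using ex_segment[of k "t0 i" t] ti \<delta> t by auto
    have 1: "t0 i + \<rho> \<le> knot k t j"
    proof (cases "j = k")
      case True then show ?thesis using ti \<rho> \<delta> t by auto
    next
      case False
      then have "j \<in> {1..<k}" using j by auto
      then have "\<not> \<bar>knot k t j - t0 i\<bar> \<le> \<rho>" using far by (simp add: knot_interior)
      then show ?thesis using j(3) by linarith
    qed
    have 2: "knot k t (j - 1) \<le> t0 i - \<rho>"
    proof (cases "j = 1")
      case True then show ?thesis using ti \<rho> \<delta> by auto
    next
      case False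
      then have "j - 1 \<in> {1..<k}" using j by auto
      then have "\<not> \<bar>knot k t (j - 1) - t0 i\<bar> \<le> \<rho>" using far by (simp add: knot_interior)
      then show ?thesis using j(2) by linarith
    qed
    have g1: "knot k0 t0 (i - 1) + \<delta> \<le> t0 i" using gap0[of "i - 1" i] i kn by auto
    have g2: "t0 i + \<delta> \<le> knot k0 t0 (i + 1)" using gap0[of i "i + 1"] i kn by auto
    have e1: "(a j - a0 i)\<^sup>2 * (t0 i - (t0 i - \<rho>)) \<le> r\<^sup>2"
    proof (rule low)
      fix x assume x: "t0 i - \<rho> \<le> x" "x < t0 i"
      have "step_fun (k, a, t) x = a j" using x 1 2 \<rho>0 by (intro seg j) auto
      moreover have "step_fun (k0, a0, t0) x = a0 i" using x g1 kn i \<rho> \<delta> by (intro seg0) auto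
      ultimately show "h x = a j - a0 i" by (simp add: h_def)
    qed (use ti \<rho> \<rho>0 \<delta> in auto)
    have e2: "(a j - a0 (i + 1))\<^sup>2 * (t0 i + \<rho> - t0 i) \<le> r\<^sup>2"
    proof (rule low)
      fix x assume x: "t0 i \<le> x" "x < t0 i + \<rho>"
      have "step_fun (k, a, t) x = a j" using x 1 2 \<rho>0 by (intro seg j) auto
      moreover have "step_fun (k0, a0, t0) x = a0 (i + 1)" using x g2 kn i \<rho> \<delta> by (intro seg0) auto
      ultimately show "h x = a j - a0 (i + 1)" by (simp add: h_def)
    qed (use ti \<rho> \<rho>0 \<delta> in auto)
    have "J / 2 \<le> \<bar>a j - a0 i\<bar> \<or> J / 2 \<le> \<bar>a j - a0 (i + 1)\<bar>" using J(2)[OF i] by linarith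
    then have "(J / 2)\<^sup>2 \<le> (a j - a0 i)\<^sup>2 \<or> (J / 2)\<^sup>2 \<le> (a j - a0 (i + 1))\<^sup>2"
      using J(1) by (auto simp: abs_le_square_iff[symmetric])
    then have "(J / 2)\<^sup>2 * \<rho> \<le> r\<^sup>2"
      using e1 e2 mult_right_mono[OF _ less_imp_le[OF \<rho>0]] by (auto intro: order_trans)
    moreover have "(J / 2)\<^sup>2 * \<rho> = 2 * r\<^sup>2" using J by (simp add: \<rho>_eq power_divide)
    ultimately show False using r by simp
  qed
  obtain s' where s': "\<And>i. i \<in> {1..<k0} \<Longrightarrow> s' i \<in> {1..<k} \<and> \<bar>t (s' i) - t0 i\<bar> \<le> \<rho>"
    using near by metis
  \<comment> \<open>The end knots 0 and 1 are matched too, so that the first and last segments need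
    no separate treatment.\<close>
  define s where "s = (\<lambda>i. if i = 0 then 0 else if i = k0 then k else s' i)"
  have s: "s i \<in> {1..<k}" "\<bar>t (s i) - t0 i\<bar> \<le> \<rho>" if "i \<in> {1..<k0}" for i
    using s'[OF that] that by (auto simp: s_def)
  have sk: "s i \<le> k" "\<bar>knot k t (s i) - knot k0 t0 i\<bar> \<le> \<rho>" if i: "i \<le> k0" for i
  proof -
    consider "i = 0" | "i = k0" | "i \<in> {1..<k0}" using i by fastforce
    then have "s i \<le> k \<and> \<bar>knot k t (s i) - knot k0 t0 i\<bar> \<le> \<rho>"
    proof cases
      case 3 then show ?thesis using s[OF 3] knot_interior by auto
    qed (use t t0 \<rho>0 in \<open>auto simp: s_def\<close>)
    then show "s i \<le> k" "\<bar>knot k t (s i) - knot k0 t0 i\<bar> \<le> \<rho>" by auto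
  qed
  have lt: "s i \<noteq> s i'" if "i < i'" "i' \<le> k0" for i i'
  proof
    assume "s i = s i'"
    then show False using sk(2)[of i] sk(2)[of i'] gap0[OF that] that \<rho> \<delta> by simp
  qed
  have inj: "inj_on s {0..k0}"
    by (rule inj_onI) (metis lt atLeastAtMost_iff linorder_neqE_nat)
  have pos: "s i \<ge> 1" if "i \<in> {1..k0}" for i
    using lt[of 0 i] that by (auto simp: s_def)
  have lev: "(a (s i) - a0 i)\<^sup>2 * (\<delta> / 2) \<le> r\<^sup>2" if i: "i \<in> {1..k0}" for i
  proof -
    let ?y = "knot k0 t0 i"
    have si: "s i \<in> {1..k}" using pos[OF i] sk(1)[of i] i by auto
    have g: "knot k t (s i - 1) + \<delta> \<le> knot k t (s i)" using gap[of "s i - 1" "s i"] si by auto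
    have g0: "knot k0 t0 (i - 1) + \<delta> \<le> ?y" using gap0[of "i - 1" i] i by auto
    have b: "0 \<le> knot k0 t0 (i - 1)" "?y \<le> 1" using bounds0[of "i - 1"] bounds0[of i] i by auto
    have close: "\<bar>knot k t (s i) - ?y\<bar> \<le> \<rho>" using sk(2)[of i] i by auto
    \<comment> \<open>The matched segment ends within \<open>\<rho>\<close> of \<open>?y\<close> and
      has length at least \<open>\<delta>\<close>, so it covers everything from
      \<open>?y - \<delta> + \<rho>\<close> to \<open>?y - \<rho>\<close>; so does reference segment
      \<open>i\<close>.\<close>
    have "(a (s i) - a0 i)\<^sup>2 * (?y - \<rho> - (?y - \<delta> + \<rho>)) \<le> r\<^sup>2"
    proof (rule low)
      fix x assume x: "?y - \<delta> + \<rho> \<le> x" "x < ?y - \<rho>"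
      have "step_fun (k, a, t) x = a (s i)"
        using x g close by (intro seg si) (auto simp: abs_le_iff)
      moreover have "step_fun (k0, a0, t0) x = a0 i" using x g0 \<rho>0 by (intro seg0 i) auto
      ultimately show "h x = a (s i) - a0 i" by (simp add: h_def)
    qed (use b g0 \<rho> \<rho>0 \<delta> in auto)
    moreover have "(a (s i) - a0 i)\<^sup>2 * (\<delta> / 2) \<le> (a (s i) - a0 i)\<^sup>2 * (?y - \<rho> - (?y - \<delta> + \<rho>))"
      using \<rho> by (intro mult_left_mono) auto
    ultimately show ?thesis by linarith
  qed
  show thesis
  proof (rule that[of s])
    show "inj_on s {1..k0}" using inj by (rule inj_on_subset) auto
    show "s ` {1..k0} \<subseteq> {1..k}" using pos sk(1) by fastforce
  qed (use s lev in auto)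
qed

section \<open>Measurability in the parameter\<close>

lemma space_param_space [simp]: "space param_space = UNIV"
  by (simp add: param_space_def space_pair_measure space_PiM)

lemma measurable_param_size [measurable]: "fst \<in> param_space \<rightarrow>\<^sub>M count_space UNIV"
  unfolding param_space_def by measurable

lemma measurable_param_level [measurable]: "(\<lambda>\<theta>. fst (snd \<theta>) j) \<in> borel_measurable param_space"
  unfolding param_space_def by measurable

lemma measurable_param_changepoint [measurable]: "(\<lambda>\<theta>. snd (snd \<theta>) j) \<in> borel_measurable param_space"
  unfolding param_space_def by measurable

lemma measurable_knot [measurable]: "(\<lambda>\<theta>. knot k (snd (snd \<theta>)) j) \<in> borel_measurable param_space"
  unfolding knot_def by (cases "j = 0"; cases "j = k") auto

text \<open>The number of summands is itself a coordinate of the parameter: measurability is shown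
  for each fixed \<open>k\<close> and then glued over the countably many values of that
  coordinate.\<close>

lemma measurable_step_fun_pair:
  "(\<lambda>(\<theta>, x). step_fun \<theta> x) \<in> borel_measurable (param_space \<Otimes>\<^sub>M borel)"
proof -
  have "(\<lambda>\<omega>. \<Sum>j=1..k. fst (snd (fst \<omega>)) j *
      indicator {knot k (snd (snd (fst \<omega>))) (j - 1)..<knot k (snd (snd (fst \<omega>))) j} (snd \<omega>) :: real)
    \<in> borel_measurable (param_space \<Otimes>\<^sub>M borel)" for k
  proof (intro borel_measurable_sum borel_measurable_times)
    fix j
    have [measurable]: "(\<lambda>\<omega>. knot k (snd (snd (fst \<omega>))) i) \<in> borel_measurable (param_space \<Otimes>\<^sub>M borel)" for i
      by (rule measurable_compose[OF measurable_fst measurable_knot])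
    show "(\<lambda>\<omega>. fst (snd (fst \<omega>)) j) \<in> borel_measurable (param_space \<Otimes>\<^sub>M borel)"
      by (rule measurable_compose[OF measurable_fst measurable_param_level])
    have "(\<lambda>\<omega>. if knot k (snd (snd (fst \<omega>))) (j - 1) \<le> snd \<omega> \<and> snd \<omega> < knot k (snd (snd (fst \<omega>))) j then 1 else 0 :: real)
        \<in> borel_measurable (param_space \<Otimes>\<^sub>M borel)"
      by measurable
    then show "(\<lambda>\<omega>. indicat_real {knot k (snd (snd (fst \<omega>))) (j - 1)..<knot k (snd (snd (fst \<omega>))) j} (snd \<omega>))
        \<in> borel_measurable (param_space \<Otimes>\<^sub>M borel)"
      by (simp add: indicator_def)
  qed
  then have "(\<lambda>\<omega>. (\<lambda>k \<omega>. \<Sum>j=1..k. fst (snd (fst \<omega>)) j *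
      indicator {knot k (snd (snd (fst \<omega>))) (j - 1)..<knot k (snd (snd (fst \<omega>))) j} (snd \<omega>) :: real) (fst (fst \<omega>)) \<omega>)
    \<in> borel_measurable (param_space \<Otimes>\<^sub>M borel)"
    by (rule measurable_compose_countable) (rule measurable_compose[OF measurable_fst measurable_param_size])
  also have "?this \<longleftrightarrow> ?thesis"
    by (intro measurable_cong) (auto simp: step_fun_def case_prod_beta)
  finally show ?thesis .
qed

lemma measurable_step_fun_L2_distance [measurable]:
  assumes [measurable]: "f0 \<in> borel_measurable borel"
  shows "(\<lambda>\<theta>. L2_norm (\<lambda>x. step_fun \<theta> x - f0 x)) \<in> borel_measurable param_space"
proof -
  have [measurable]: "(\<lambda>\<omega>. step_fun (fst \<omega>) (snd \<omega>)) \<in> borel_measurable (param_space \<Otimes>\<^sub>M borel)"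
    using measurable_step_fun_pair by (simp add: case_prod_beta)
  have "(\<lambda>\<omega>. indicator {0..<1} (snd \<omega>) *\<^sub>R (step_fun (fst \<omega>) (snd \<omega>) - f0 (snd \<omega>))\<^sup>2)
      \<in> borel_measurable (param_space \<Otimes>\<^sub>M borel)"
    by measurable
  then have "(\<lambda>(\<theta>, x). indicator {0..<1} x *\<^sub>R (step_fun \<theta> x - f0 x)\<^sup>2)
      \<in> borel_measurable (param_space \<Otimes>\<^sub>M lborel)"
    by (simp add: case_prod_beta cong: measurable_cong_sets)
  then have "(\<lambda>\<theta>. LINT x:{0..<1}|lborel. (step_fun \<theta> x - f0 x)\<^sup>2) \<in> borel_measurable param_space"
    unfolding set_lebesgue_integral_def by (rule lborel.borel_measurable_lebesgue_integral)
  then show ?thesis unfolding L2_norm_def by measurable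
qed

text \<open>Extensionality pins all coordinates off the index sets to \<open>undefined\<close>;
  these are countably many conditions, so they can be imposed measurably.\<close>

lemma Theta_sets [measurable]: "Theta kmax K \<delta> \<in> sets param_space"
proof -
  have "Theta kmax K \<delta> = (\<Union>k\<in>{1..kmax}. {\<theta> \<in> space param_space. fst \<theta> = k \<and>
      (\<forall>j. if j \<in> {1..k} then fst (snd \<theta>) j \<in> {-K..K} else fst (snd \<theta>) j = undefined) \<and>
      (\<forall>j. j \<in> {1..<k} \<or> snd (snd \<theta>) j = undefined) \<and>
      (\<forall>j\<in>{1..k}. knot k (snd (snd \<theta>)) (j - 1) < knot k (snd (snd \<theta>)) j \<and>
         \<delta> \<le> \<bar>knot k (snd (snd \<theta>)) j - knot k (snd (snd \<theta>)) (j - 1)\<bar>)})"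
    (is "_ = (\<Union>k\<in>_. ?A k)")
  proof -
    have "{k} \<times> levels K k \<times> changepoints \<delta> k = ?A k" for k
      unfolding levels_def changepoints_def PiE_def extensional_def Pi_def
      by (auto split: if_splits)
    then show ?thesis unfolding Theta_def by simp
  qed
  also have "\<dots> \<in> sets param_space"
  proof (intro sets.finite_UN)
    fix k
    have [measurable]: "Measurable.pred param_space (\<lambda>\<theta>. fst \<theta> = k)"
      by (rule measurable_compose[OF measurable_param_size]) simp
    show "?A k \<in> sets param_space" by measurable
  qed simp
  finally show ?thesis .
qed

section \<open>Prior mass of a ball around the true function: upper bound\<close>

lemma product_sigma_finite_lborel: "product_sigma_finite (\<lambda>_. lborel :: real measure)"
  by (simp add: product_sigma_finite_def sigma_finite_lborel)

lemma sigma_finite_lebesgue_changepoints: "sigma_finite_measure (lebesgue_changepoints k)"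
  unfolding lebesgue_changepoints_def
  by (rule product_sigma_finite.sigma_finite[OF product_sigma_finite_lborel]) simp

lemma emeasure_PiM_lborel_box:
  assumes "finite I" "\<And>j. j \<in> I \<Longrightarrow> l j \<le> u j"
  shows "emeasure (\<Pi>\<^sub>M j\<in>I. lborel) (\<Pi>\<^sub>E j\<in>I. {l j..u j :: real}) = ennreal (\<Prod>j\<in>I. u j - l j)"
proof -
  have "emeasure (\<Pi>\<^sub>M j\<in>I. lborel) (\<Pi>\<^sub>E j\<in>I. {l j..u j}) = (\<Prod>j\<in>I. emeasure lborel {l j..u j})"
    using assms by (intro product_sigma_finite.emeasure_PiM[OF product_sigma_finite_lborel]) auto
  also have "\<dots> = (\<Prod>j\<in>I. ennreal (u j - l j))"
    using assms by (intro prod.cong) auto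
  also have "\<dots> = ennreal (\<Prod>j\<in>I. u j - l j)"
    using assms by (intro prod_ennreal) auto
  finally show ?thesis .
qed

text \<open>Boxes in which the coordinates \<open>\<sigma> i\<close>, \<open>i \<in> A\<close>, are confined to short intervals around \<open>c i\<close>
  and the other coordinates range over \<open>[lo, hi]\<close>.\<close>

definition matched_box ::
  "nat set \<Rightarrow> nat set \<Rightarrow> (nat \<Rightarrow> nat) \<Rightarrow> (nat \<Rightarrow> real) \<Rightarrow> real \<Rightarrow> real \<Rightarrow> real \<Rightarrow> (nat \<Rightarrow> real) set" where
  "matched_box I A \<sigma> c q lo hi = (\<Pi>\<^sub>E j\<in>I.
     {if j \<in> \<sigma> ` A then c (inv_into A \<sigma> j) - q else lo..if j \<in> \<sigma> ` A then c (inv_into A \<sigma> j) + q else hi})"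

lemma matched_box_sets [measurable]: "finite I \<Longrightarrow> matched_box I A \<sigma> c q lo hi \<in> sets (\<Pi>\<^sub>M j\<in>I. lborel)"
  unfolding matched_box_def by (intro sets_PiM_I_finite) auto

lemma matched_boxI:
  assumes "inj_on \<sigma> A" "x \<in> extensional I" "\<And>i. i \<in> A \<Longrightarrow> \<bar>x (\<sigma> i) - c i\<bar> \<le> q"
    "\<And>j. j \<in> I \<Longrightarrow> lo \<le> x j \<and> x j \<le> hi"
  shows "x \<in> matched_box I A \<sigma> c q lo hi"
  unfolding matched_box_def
proof (rule PiE_I)
  fix j assume "j \<in> I"
  then show "x j \<in> {if j \<in> \<sigma> ` A then c (inv_into A \<sigma> j) - q else lo..if j \<in> \<sigma> ` A then c (inv_into A \<sigma> j) + q else hi}"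
    using assms(3,4) by (auto simp: inv_into_f_f[OF assms(1)] abs_le_iff) (smt (verit) assms(3))+
qed (use assms(2) in \<open>auto simp: extensional_def\<close>)

lemma emeasure_matched_box:
  assumes "finite I" "inj_on \<sigma> A" "\<sigma> ` A \<subseteq> I" "0 \<le> q" "lo \<le> hi"
  shows "emeasure (\<Pi>\<^sub>M j\<in>I. lborel) (matched_box I A \<sigma> c q lo hi) =
    ennreal ((2 * q) ^ card A * (hi - lo) ^ (card I - card A))"
proof -
  let ?S = "\<sigma> ` A"
  have "emeasure (\<Pi>\<^sub>M j\<in>I. lborel) (matched_box I A \<sigma> c q lo hi) =
      ennreal (\<Prod>j\<in>I. if j \<in> ?S then 2 * q else hi - lo)"
    unfolding matched_box_def using assms
    by (subst emeasure_PiM_lborel_box) (auto intro!: arg_cong[where f = ennreal] prod.cong)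
  also have "(\<Prod>j\<in>I. if j \<in> ?S then 2 * q else hi - lo) = (2 * q) ^ card (I \<inter> ?S) * (hi - lo) ^ card (I \<inter> - ?S)"
    using assms(1) by (simp add: prod.If_cases)
  also have "I \<inter> ?S = ?S" using assms(3) by auto
  also have "I \<inter> - ?S = I - ?S" by auto
  also have "card (I - ?S) = card I - card A"
    using assms by (subst card_Diff_subset) (auto simp: card_image intro: finite_subset)
  also have "card ?S = card A" by (rule card_image[OF assms(2)])
  finally show ?thesis .
qed

lemma measurable_prior_component_density:
  assumes "prior_densities K \<delta> k \<pi>a \<pi>t"
  shows "(\<lambda>(a, t). ennreal (\<pi>a a t * \<pi>t t) * indicator (levels K k \<times> changepoints \<delta> k) (a, t))
    \<in> borel_measurable (lebesgue_levels k \<Otimes>\<^sub>M lebesgue_changepoints k)"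
proof -
  have [measurable]: "(\<lambda>(a, t). \<pi>a a t) \<in> borel_measurable (lebesgue_levels k \<Otimes>\<^sub>M lebesgue_changepoints k)"
    "\<pi>t \<in> borel_measurable (lebesgue_changepoints k)"
    using assms by (auto simp: prior_densities_def)
  have [measurable]: "levels K k \<in> sets (lebesgue_levels k)"
    unfolding levels_def lebesgue_levels_def by (intro sets_PiM_I_finite) auto
  have kn: "(\<lambda>t. knot k t j) \<in> borel_measurable (lebesgue_changepoints k)" if "j \<le> k" for j
    using that unfolding knot_def lebesgue_changepoints_def
    by (cases "j = 0"; cases "j = k") auto
  have "Measurable.pred (lebesgue_changepoints k)
      (\<lambda>t. knot k t (j - 1) < knot k t j \<and> \<bar>knot k t j - knot k t (j - 1)\<bar> \<ge> \<delta>)" if "j \<in> {1..k}" for j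
  proof -
    have [measurable]: "(\<lambda>t. knot k t j) \<in> borel_measurable (lebesgue_changepoints k)"
      "(\<lambda>t. knot k t (j - 1)) \<in> borel_measurable (lebesgue_changepoints k)"
      using that by (auto intro!: kn)
    show ?thesis by measurable
  qed
  then have "{t \<in> space (lebesgue_changepoints k). \<forall>j\<in>{1..k}. knot k t (j - 1) < knot k t j \<and>
      \<bar>knot k t j - knot k t (j - 1)\<bar> \<ge> \<delta>} \<in> sets (lebesgue_changepoints k)"
    by (intro sets.sets_Collect_finite_All) (auto simp: pred_def)
  then have [measurable]: "changepoints \<delta> k \<in> sets (lebesgue_changepoints k)"
    by (simp add: changepoints_def lebesgue_changepoints_def space_PiM)
  show ?thesis by measurable
qed

lemma emeasure_prior_component_box_le:
  assumes dens: "prior_densities K \<delta> k \<pi>a \<pi>t"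
    and C: "\<And>a t. a \<in> levels K k \<Longrightarrow> t \<in> changepoints \<delta> k \<Longrightarrow> \<pi>a a t * \<pi>t t \<le> C"
    and AT: "A \<in> sets (lebesgue_levels k)" "T \<in> sets (lebesgue_changepoints k)"
  shows "emeasure (prior_component K \<delta> k \<pi>a \<pi>t) (A \<times> T) \<le>
    ennreal C * (emeasure (lebesgue_levels k) A * emeasure (lebesgue_changepoints k) T)"
proof -
  interpret T: sigma_finite_measure "lebesgue_changepoints k" by (rule sigma_finite_lebesgue_changepoints)
  let ?L = "lebesgue_levels k \<Otimes>\<^sub>M lebesgue_changepoints k"
  have "emeasure (prior_component K \<delta> k \<pi>a \<pi>t) (A \<times> T) \<le> (\<integral>\<^sup>+z. ennreal C * indicator (A \<times> T) z \<partial>?L)"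
    unfolding prior_component_def using AT
    by (subst emeasure_density[OF measurable_prior_component_density[OF dens]])
      (auto intro!: nn_integral_mono ennreal_leI C split: split_indicator)
  also have "\<dots> = ennreal C * emeasure ?L (A \<times> T)"
    using AT by (intro nn_integral_cmult_indicator) auto
  also have "emeasure ?L (A \<times> T) = emeasure (lebesgue_levels k) A * emeasure (lebesgue_changepoints k) T"
    using AT by (rule T.emeasure_pair_measure_Times)
  finally show ?thesis .
qed

lemma emeasure_prior_component_box_ge:
  assumes dens: "prior_densities K \<delta> k \<pi>a \<pi>t"
    and c: "\<And>a t. a \<in> levels K k \<Longrightarrow> t \<in> changepoints \<delta> k \<Longrightarrow> c \<le> \<pi>a a t * \<pi>t t"
    and AT: "A \<in> sets (lebesgue_levels k)" "T \<in> sets (lebesgue_changepoints k)"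
      "A \<subseteq> levels K k" "T \<subseteq> changepoints \<delta> k"
  shows "ennreal c * (emeasure (lebesgue_levels k) A * emeasure (lebesgue_changepoints k) T) \<le>
    emeasure (prior_component K \<delta> k \<pi>a \<pi>t) (A \<times> T)"
proof -
  interpret T: sigma_finite_measure "lebesgue_changepoints k" by (rule sigma_finite_lebesgue_changepoints)
  let ?L = "lebesgue_levels k \<Otimes>\<^sub>M lebesgue_changepoints k"
  have "emeasure (lebesgue_levels k) A * emeasure (lebesgue_changepoints k) T = emeasure ?L (A \<times> T)"
    using AT by (intro T.emeasure_pair_measure_Times[symmetric])
  also have "ennreal c * \<dots> = (\<integral>\<^sup>+z. ennreal c * indicator (A \<times> T) z \<partial>?L)"
    using AT by (intro nn_integral_cmult_indicator[symmetric]) auto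
  also have "\<dots> \<le> emeasure (prior_component K \<delta> k \<pi>a \<pi>t) (A \<times> T)"
    unfolding prior_component_def using AT
    by (subst emeasure_density[OF measurable_prior_component_density[OF dens]])
      (auto intro!: nn_integral_mono ennreal_leI c split: split_indicator)
  finally show ?thesis .
qed

lemma prior_bounds_product:
  assumes "prior_bounds K \<delta> k \<pi>a \<pi>t"
  obtains c C where "0 < c" "0 \<le> C"
    "\<And>a t. a \<in> levels K k \<Longrightarrow> t \<in> changepoints \<delta> k \<Longrightarrow> c \<le> \<pi>a a t * \<pi>t t"
    "\<And>a t. a \<in> levels K k \<Longrightarrow> t \<in> changepoints \<delta> k \<Longrightarrow> \<pi>a a t * \<pi>t t \<le> C"
proof -
  obtain c C where c: "c > 0" and b: "\<And>t. t \<in> changepoints \<delta> k \<Longrightarrow> c \<le> \<pi>t t \<and> \<pi>t t \<le> C"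
    "\<And>a t. t \<in> changepoints \<delta> k \<Longrightarrow> a \<in> levels K k \<Longrightarrow> c \<le> \<pi>a a t \<and> \<pi>a a t \<le> C"
    using assms unfolding prior_bounds_def by blast
  show thesis
  proof (rule that[of "c * c" "\<bar>C\<bar> * \<bar>C\<bar>"])
    fix a t assume at: "a \<in> levels K k" "t \<in> changepoints \<delta> k"
    have "c \<le> \<pi>t t" "\<pi>t t \<le> \<bar>C\<bar>" "c \<le> \<pi>a a t" "\<pi>a a t \<le> \<bar>C\<bar>"
      using b(1)[OF at(2)] b(2)[OF at(2,1)] by auto
    then show "c * c \<le> \<pi>a a t * \<pi>t t" "\<pi>a a t * \<pi>t t \<le> \<bar>C\<bar> * \<bar>C\<bar>"
      using c by (intro mult_mono; simp)+
  qed (use c in auto)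
qed

lemma emeasure_prior_eq:
  assumes "A \<in> sets param_space"
  shows "emeasure (prior kmax K \<delta> p \<pi>a \<pi>t) A = (\<Sum>k=1..kmax. ennreal (p k) *
    emeasure (prior_component K \<delta> k (\<pi>a k) (\<pi>t k))
      (Pair k -` A \<inter> space (prior_component K \<delta> k (\<pi>a k) (\<pi>t k))))"
  unfolding emeasure_prior[OF assms]
  by (simp add: emeasure_distr[OF measurable_Pair_param_space assms])

text \<open>A small ball is covered by finitely many products of matched boxes, one for each
  possible matching \<open>\<sigma>\<close>. Each has \<open>k0\<close> level sides of order
  \<open>r\<close> and \<open>k0 - 1\<close> change-point sides of order \<open>r\<^sup>2\<close>,
  all other sides being bounded, so the exponent does not depend on \<open>k\<close>. For
  \<open>k < k0\<close> there is no matching and a small ball has mass 0.\<close>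

lemma prior_component_ball_le:
  assumes \<delta>: "0 < \<delta>" and K: "0 < K"
    and \<theta>0: "(k0, a0, t0) \<in> Theta kmax K \<delta>"
    and J: "0 < J" "\<And>i. i \<in> {1..<k0} \<Longrightarrow> J \<le> \<bar>a0 (i + 1) - a0 i\<bar>"
    and dens: "prior_densities K \<delta> k \<pi>a \<pi>t" and bnd: "prior_bounds K \<delta> k \<pi>a \<pi>t"
  obtains C where "0 \<le> C" "\<And>r. 0 < r \<Longrightarrow>
    emeasure (prior_component K \<delta> k \<pi>a \<pi>t)
      (Pair k -` {\<theta> \<in> Theta kmax K \<delta>. L2_norm (\<lambda>x. step_fun \<theta> x - step_fun (k0, a0, t0) x) < r} \<inter>
        space (prior_component K \<delta> k \<pi>a \<pi>t)) \<le> ennreal (C * r ^ (k0 + 2 * (k0 - 1)))"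
proof -
  let ?\<mu> = "prior_component K \<delta> k \<pi>a \<pi>t"
  let ?B = "\<lambda>r. Pair k -` {\<theta> \<in> Theta kmax K \<delta>. L2_norm (\<lambda>x. step_fun \<theta> x - step_fun (k0, a0, t0) x) < r} \<inter> space ?\<mu>"
  let ?D = "k0 + 2 * (k0 - 1)"
  interpret \<mu>: prob_space ?\<mu> by (rule prob_space_prior_component[OF dens])
  obtain c C where C: "0 \<le> C"
    "\<And>a t. a \<in> levels K k \<Longrightarrow> t \<in> changepoints \<delta> k \<Longrightarrow> \<pi>a a t * \<pi>t t \<le> C"
    using prior_bounds_product[OF bnd] by metis
  define S where "S = {\<sigma> \<in> {1..k0} \<rightarrow>\<^sub>E {1..k}. inj_on \<sigma> {1..k0} \<and> \<sigma> ` {1..<k0} \<subseteq> {1..<k}}"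
  have fS: "finite S" unfolding S_def by (rule finite_subset[of _ "{1..k0} \<rightarrow>\<^sub>E {1..k}"]) (auto intro: finite_PiE)
  \<comment> \<open>The radius at which the tolerance \<open>\<rho>\<close> for the change-points
    reaches \<open>\<delta> / 4\<close>, the limit of the structure lemma.\<close>
  define r1 where "r1 = sqrt (\<delta> * J\<^sup>2 / 32)"
  have r1: "0 < r1" "r1\<^sup>2 = \<delta> * J\<^sup>2 / 32" using \<delta> J by (auto simp: r1_def)
  \<comment> \<open>The structure lemma bounds the squared level error times
    \<open>\<delta> / 2\<close> by the square of \<open>r\<close>; so the levels are known up to
    \<open>r * q\<close>.\<close>
  define q where "q = sqrt (2 / \<delta>)"
  have q: "0 < q" "q\<^sup>2 = 2 / \<delta>" using \<delta> by (auto simp: q_def)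
  define m where "m = C * (((2 * q) ^ k0 * (2 * K) ^ (k - k0)) * ((2 * (8 / J\<^sup>2)) ^ (k0 - 1)))"
  have m0: "0 \<le> m" using C q K J by (auto simp: m_def)
  \<comment> \<open>The first summand counts the matchings for small \<open>r\<close>; the second
    makes the claim trivial for \<open>r > r1\<close>, where the mass is at most 1.\<close>
  define C' where "C' = real (card S) * m + 1 / r1 ^ ?D"
  have C'0: "0 \<le> C'" using m0 r1 by (auto simp: C'_def)
  show thesis
  proof (rule that[OF C'0])
    fix r :: real assume r: "0 < r"
    show "emeasure ?\<mu> (?B r) \<le> ennreal (C' * r ^ ?D)"
    proof (cases "r \<le> r1")
      case False
      have "emeasure ?\<mu> (?B r) \<le> 1" by (rule \<mu>.emeasure_le_1)
      also have "1 \<le> ennreal (C' * r ^ ?D)"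
      proof -
        have "1 = 1 / r1 ^ ?D * r1 ^ ?D" using r1 by simp
        also have "\<dots> \<le> 1 / r1 ^ ?D * r ^ ?D" using False r1 by (intro mult_left_mono power_mono) auto
        also have "\<dots> \<le> C' * r ^ ?D" using r m0 by (intro mult_right_mono) (auto simp: C'_def)
        finally show ?thesis by (subst ennreal_1[symmetric]) (rule ennreal_leI)
      qed
      finally show ?thesis .
    next
      case True
      define \<rho> where "\<rho> = 8 * r\<^sup>2 / J\<^sup>2"
      have "r\<^sup>2 \<le> r1\<^sup>2" using True r by (intro power_mono) auto
      then have \<rho>: "\<rho> \<le> \<delta> / 4" "0 \<le> \<rho>" using J r1 by (auto simp: \<rho>_def field_simps)
      define E where "E = (\<lambda>\<sigma>. matched_box {1..k} {1..k0} \<sigma> a0 (r * q) (- K) K \<times>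
        matched_box {1..<k} {1..<k0} \<sigma> t0 \<rho> 0 1)"
      have Es: "matched_box {1..k} {1..k0} \<sigma> a0 (r * q) (- K) K \<in> sets (lebesgue_levels k)"
        "matched_box {1..<k} {1..<k0} \<sigma> t0 \<rho> 0 1 \<in> sets (lebesgue_changepoints k)" for \<sigma>
        by (auto simp: lebesgue_levels_def lebesgue_changepoints_def)
      have Esets: "E \<sigma> \<in> sets ?\<mu>" for \<sigma>
        using Es[of \<sigma>] by (auto simp: E_def prior_component_def)
      have sub: "?B r \<subseteq> (\<Union>\<sigma>\<in>S. E \<sigma>)"
      proof
        fix z assume z: "z \<in> ?B r"
        obtain a t where at: "z = (a, t)" by (cases z)
        have \<theta>: "(k, a, t) \<in> Theta kmax K \<delta>"
          and d: "L2_norm (\<lambda>x. step_fun (k, a, t) x - step_fun (k0, a0, t0) x) < r"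
          using z at by auto
        obtain \<sigma>' where \<sigma>': "inj_on \<sigma>' {1..k0}" "\<sigma>' ` {1..k0} \<subseteq> {1..k}"
          "\<And>i. i \<in> {1..<k0} \<Longrightarrow> \<sigma>' i \<in> {1..<k} \<and> \<bar>t (\<sigma>' i) - t0 i\<bar> \<le> \<rho>"
          "\<And>i. i \<in> {1..k0} \<Longrightarrow> (a (\<sigma>' i) - a0 i)\<^sup>2 * (\<delta> / 2) \<le> r\<^sup>2"
          using small_L2_ball_structure[OF \<delta> K \<theta> \<theta>0 J r d \<rho>_def \<rho>(1)] by metis
        \<comment> \<open>Restriction makes the matching extensional, hence a member of the finite
          set \<open>S\<close>.\<close>
        define \<sigma> where "\<sigma> = restrict \<sigma>' {1..k0}"
        have eq: "\<sigma> i = \<sigma>' i" if "i \<in> {1..k0}" for i using that by (simp add: \<sigma>_def)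
        have inj: "inj_on \<sigma> {1..k0}" using \<sigma>'(1) by (simp add: \<sigma>_def inj_on_restrict_eq)
        have "\<sigma> \<in> S" using \<sigma>' inj unfolding S_def by (auto simp: \<sigma>_def)
        moreover have "z \<in> E \<sigma>"
          unfolding at E_def
        proof (intro SigmaI matched_boxI inj inj_on_subset[OF inj])
          show "a \<in> extensional {1..k}" "t \<in> extensional {1..<k}"
            using \<theta> by (auto simp: Theta_iff levels_def changepoints_def PiE_def)
          show "- K \<le> a j \<and> a j \<le> K" if "j \<in> {1..k}" for j
            using levels_abs_le[of a K k j] \<theta> that by (auto simp: Theta_iff abs_le_iff)
          show "0 \<le> t j \<and> t j \<le> 1" if "j \<in> {1..<k}" for j
            using changepoints_knot_bounds[of t \<delta> k j] \<theta> that \<delta> knot_interior[OF that, of t]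
            by (auto simp: Theta_iff)
          show "\<bar>t (\<sigma> i) - t0 i\<bar> \<le> \<rho>" if "i \<in> {1..<k0}" for i
            using \<sigma>'(3)[OF that] eq[of i] that by auto
          show "\<bar>a (\<sigma> i) - a0 i\<bar> \<le> r * q" if "i \<in> {1..k0}" for i
          proof -
            have "(a (\<sigma> i) - a0 i)\<^sup>2 \<le> r\<^sup>2 * (2 / \<delta>)"
              using \<sigma>'(4)[OF that] eq[OF that] \<delta> by (simp add: field_simps)
            also have "\<dots> = (r * q)\<^sup>2" by (simp add: power_mult_distrib q)
            finally show ?thesis using r q by (simp add: abs_le_square_iff[symmetric] abs_le_iff)
          qed
        qed auto
        ultimately show "z \<in> (\<Union>\<sigma>\<in>S. E \<sigma>)" by blast
      qed
      have one: "emeasure ?\<mu> (E \<sigma>) \<le> ennreal (m * r ^ ?D)" if \<sigma>: "\<sigma> \<in> S" for \<sigma>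
      proof -
        have inj: "inj_on \<sigma> {1..k0}" "inj_on \<sigma> {1..<k0}"
          using \<sigma> by (auto simp: S_def intro: inj_on_subset)
        have "emeasure ?\<mu> (E \<sigma>) \<le> ennreal C *
            (emeasure (lebesgue_levels k) (matched_box {1..k} {1..k0} \<sigma> a0 (r * q) (- K) K) *
             emeasure (lebesgue_changepoints k) (matched_box {1..<k} {1..<k0} \<sigma> t0 \<rho> 0 1))"
          unfolding E_def by (rule emeasure_prior_component_box_le[OF dens C(2) Es])
        also have "emeasure (lebesgue_levels k) (matched_box {1..k} {1..k0} \<sigma> a0 (r * q) (- K) K) =
            ennreal ((2 * (r * q)) ^ k0 * (2 * K) ^ (k - k0))"
          unfolding lebesgue_levels_def using \<sigma> inj r q K
          by (subst emeasure_matched_box) (auto simp: S_def)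
        also have "emeasure (lebesgue_changepoints k) (matched_box {1..<k} {1..<k0} \<sigma> t0 \<rho> 0 1) =
            ennreal ((2 * \<rho>) ^ (k0 - 1))"
          unfolding lebesgue_changepoints_def using \<sigma> inj \<rho>
          by (subst emeasure_matched_box) (auto simp: S_def)
        also have "ennreal C * (ennreal ((2 * (r * q)) ^ k0 * (2 * K) ^ (k - k0)) * ennreal ((2 * \<rho>) ^ (k0 - 1))) =
            ennreal (C * (((2 * (r * q)) ^ k0 * (2 * K) ^ (k - k0)) * (2 * \<rho>) ^ (k0 - 1)))"
          using C r q K \<rho> by (simp add: ennreal_mult)
        also have "C * (((2 * (r * q)) ^ k0 * (2 * K) ^ (k - k0)) * (2 * \<rho>) ^ (k0 - 1)) = m * r ^ ?D"
        proof -
          have "(2 * (r * q)) ^ k0 = (2 * q) ^ k0 * r ^ k0" by (simp add: power_mult_distrib)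
          moreover have "(2 * \<rho>) ^ (k0 - 1) = (2 * (8 / J\<^sup>2)) ^ (k0 - 1) * r ^ (2 * (k0 - 1))"
          proof -
            have "2 * \<rho> = (2 * (8 / J\<^sup>2)) * r\<^sup>2" by (simp add: \<rho>_def)
            then show ?thesis by (simp only: power_mult_distrib[of "2 * (8 / J\<^sup>2)"] power_mult)
          qed
          ultimately show ?thesis by (simp only: m_def power_add) (simp only: mult_ac)
        qed
        finally show ?thesis .
      qed
      have "emeasure ?\<mu> (?B r) \<le> emeasure ?\<mu> (\<Union>\<sigma>\<in>S. E \<sigma>)"
        by (rule emeasure_mono[OF sub]) (use fS Esets in auto)
      also have "\<dots> \<le> (\<Sum>\<sigma>\<in>S. emeasure ?\<mu> (E \<sigma>))"
        by (rule emeasure_subadditive_finite[OF fS]) (use Esets in auto)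
      also have "\<dots> \<le> (\<Sum>\<sigma>\<in>S. ennreal (m * r ^ ?D))" by (rule sum_mono[OF one])
      also have "\<dots> = ennreal (card S * (m * r ^ ?D))"
        by (simp add: ennreal_mult' ennreal_of_nat_eq_real_of_nat)
      also have "\<dots> \<le> ennreal (C' * r ^ ?D)"
        using r1 r by (intro ennreal_leI) (simp add: C'_def algebra_simps)
      finally show ?thesis .
    qed
  qed
qed

text \<open>The exponent is the same for every \<open>k\<close>, so the mixture inherits it with the
  weighted sum of the constants.\<close>

lemma prior_ball_le:
  assumes \<delta>: "0 < \<delta>" and K: "0 < K"
    and \<theta>0: "(k0, a0, t0) \<in> Theta kmax K \<delta>"
    and J: "0 < J" "\<And>i. i \<in> {1..<k0} \<Longrightarrow> J \<le> \<bar>a0 (i + 1) - a0 i\<bar>"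
    and p: "\<And>k. k \<in> {1..kmax} \<Longrightarrow> p k > 0"
    and dens: "\<And>k. k \<in> {1..kmax} \<Longrightarrow> prior_densities K \<delta> k (\<pi>a k) (\<pi>t k)"
    and bnd: "\<And>k. k \<in> {1..kmax} \<Longrightarrow> prior_bounds K \<delta> k (\<pi>a k) (\<pi>t k)"
  obtains C where "0 \<le> C" "\<And>r. 0 < r \<Longrightarrow>
    emeasure (prior kmax K \<delta> p \<pi>a \<pi>t)
      {\<theta> \<in> Theta kmax K \<delta>. L2_norm (\<lambda>x. step_fun \<theta> x - step_fun (k0, a0, t0) x) < r}
    \<le> ennreal (C * r ^ (k0 + 2 * (k0 - 1)))"
proof -
  let ?U = "\<lambda>r. {\<theta> \<in> Theta kmax K \<delta>. L2_norm (\<lambda>x. step_fun \<theta> x - step_fun (k0, a0, t0) x) < r}"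
  let ?D = "k0 + 2 * (k0 - 1)"
  define \<beta> where "\<beta> k r = emeasure (prior_component K \<delta> k (\<pi>a k) (\<pi>t k))
      (Pair k -` ?U r \<inter> space (prior_component K \<delta> k (\<pi>a k) (\<pi>t k)))" for k r
  have "\<exists>C\<ge>0. \<forall>r>0. \<beta> k r \<le> ennreal (C * r ^ ?D)" if k: "k \<in> {1..kmax}" for k
  proof (rule prior_component_ball_le[OF \<delta> K \<theta>0 J dens[OF k] bnd[OF k], folded \<beta>_def])
    fix C assume "0 \<le> C" "\<And>r. 0 < r \<Longrightarrow> \<beta> k r \<le> ennreal (C * r ^ ?D)"
    then show ?thesis by (intro exI[of _ C]) simp
  qed
  then obtain C where C: "\<And>k. k \<in> {1..kmax} \<Longrightarrow> 0 \<le> C k"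
    "\<And>k r. k \<in> {1..kmax} \<Longrightarrow> 0 < r \<Longrightarrow> \<beta> k r \<le> ennreal (C k * r ^ ?D)"
    by metis
  show thesis
  proof (rule that[of "\<Sum>k=1..kmax. p k * C k"])
    show "0 \<le> (\<Sum>k=1..kmax. p k * C k)" using p C(1) by (intro sum_nonneg mult_nonneg_nonneg) (auto intro: less_imp_le)
    fix r :: real assume r: "0 < r"
    have [measurable]: "step_fun (k0, a0, t0) \<in> borel_measurable borel" by simp
    have "{\<theta> \<in> space param_space. \<theta> \<in> Theta kmax K \<delta> \<and> L2_norm (\<lambda>x. step_fun \<theta> x - step_fun (k0, a0, t0) x) < r}
        \<in> sets param_space" by measurable
    then have U: "?U r \<in> sets param_space" by simp
    have "emeasure (prior kmax K \<delta> p \<pi>a \<pi>t) (?U r) \<le> (\<Sum>k=1..kmax. ennreal (p k) * ennreal (C k * r ^ ?D))"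
      unfolding emeasure_prior_eq[OF U] \<beta>_def[symmetric] by (intro sum_mono mult_left_mono C(2) r) auto
    also have "\<dots> = (\<Sum>k=1..kmax. ennreal (p k * (C k * r ^ ?D)))"
      using p C(1) r by (intro sum.cong ennreal_mult[symmetric]) (auto intro: less_imp_le)
    also have "\<dots> = ennreal (\<Sum>k=1..kmax. p k * (C k * r ^ ?D))"
      using p C(1) r by (intro sum_ennreal mult_nonneg_nonneg) (auto intro: less_imp_le)
    also have "(\<Sum>k=1..kmax. p k * (C k * r ^ ?D)) = (\<Sum>k=1..kmax. p k * C k) * r ^ ?D"
      by (simp add: sum_distrib_right mult.assoc)
    finally show "emeasure (prior kmax K \<delta> p \<pi>a \<pi>t) (?U r) \<le> ennreal ((\<Sum>k=1..kmax. p k * C k) * r ^ ?D)" .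
  qed
qed

section \<open>Exponential moments of residuals under the true law\<close>

text \<open>Completing the square: tilting the standard normal density by \<open>exp (c * e)\<close>
  gives a multiple of the normal density with mean \<open>c\<close>.\<close>

lemma nn_integral_exp_std_normal:
  "(\<integral>\<^sup>+e. ennreal (exp (c * e + d)) \<partial>density lborel std_normal_density) = ennreal (exp (c\<^sup>2 / 2 + d))"
proof -
  interpret N: prob_space "density lborel (normal_density c 1)"
    by (rule prob_space_normal_density) simp
  have "(\<integral>\<^sup>+e. ennreal (exp (c * e + d)) \<partial>density lborel std_normal_density) =
      (\<integral>\<^sup>+e. ennreal (std_normal_density e) * ennreal (exp (c * e + d)) \<partial>lborel)"
    by (subst nn_integral_density) auto
  also have "\<dots> = (\<integral>\<^sup>+e. ennreal (exp (c\<^sup>2 / 2 + d)) * ennreal (normal_density c 1 e) \<partial>lborel)"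
  proof (intro nn_integral_cong)
    fix e :: real
    have "std_normal_density e * exp (c * e + d) = exp (c\<^sup>2 / 2 + d) * normal_density c 1 e"
      unfolding normal_density_def by (simp add: exp_add[symmetric] field_simps power2_eq_square)
    then show "ennreal (std_normal_density e) * ennreal (exp (c * e + d)) =
        ennreal (exp (c\<^sup>2 / 2 + d)) * ennreal (normal_density c 1 e)"
      by (simp add: ennreal_mult'[symmetric] del: std_normal_density_def)
  qed
  also have "\<dots> = ennreal (exp (c\<^sup>2 / 2 + d)) * (\<integral>\<^sup>+e. ennreal (normal_density c 1 e) \<partial>lborel)"
    by (rule nn_integral_cmult) auto
  also have "(\<integral>\<^sup>+e. ennreal (normal_density c 1 e) \<partial>lborel) = 1"
    using N.emeasure_space_1 by (simp add: emeasure_density)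
  finally show ?thesis by simp
qed

lemma measurable_add_noise:
  assumes [measurable]: "f \<in> borel_measurable borel"
  shows "(\<lambda>(x, e). (x, f x + e)) \<in>
    uniform_measure lborel {0..<1} \<Otimes>\<^sub>M density lborel std_normal_density \<rightarrow>\<^sub>M borel"
proof -
  have "(\<lambda>(x, e). (x, f x + e)) \<in> borel \<Otimes>\<^sub>M borel \<rightarrow>\<^sub>M borel \<Otimes>\<^sub>M (borel :: real measure)"
    by measurable
  then show ?thesis
    unfolding borel_prod[symmetric] by (simp cong: measurable_cong_sets)
qed

lemma prob_space_obs_law:
  assumes "f \<in> borel_measurable borel"
  shows "prob_space (obs_law f)"
proof -
  interpret U: prob_space "uniform_measure lborel {0..<1::real}"
    by (rule prob_space_uniform_measure) auto
  interpret N: prob_space "density lborel std_normal_density"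
    by (rule prob_space_normal_density) simp
  interpret UN: pair_prob_space "uniform_measure lborel {0..<1::real}" "density lborel std_normal_density" ..
  show ?thesis unfolding obs_law_def
    by (rule UN.prob_space_distr[OF measurable_add_noise[OF assms]])
qed

lemma sets_obs_law [simp, measurable_cong]: "sets (obs_law f) = sets borel"
  by (simp add: obs_law_def)

lemma space_obs_law [simp]: "space (obs_law f) = UNIV"
  by (simp add: obs_law_def)

text \<open>Every expectation computed below has this form, an exponential affine in the residual
  with coefficients depending on the design point: the two error probabilities of a test and the
  inverse likelihood ratio.\<close>

lemma nn_integral_exp_obs_law:
  assumes [measurable]: "f0 \<in> borel_measurable borel" "u \<in> borel_measurable borel" "v \<in> borel_measurable borel"
  shows "(\<integral>\<^sup>+z. ennreal (exp (u (fst z) * (snd z - f0 (fst z)) + v (fst z))) \<partial>obs_law f0) =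
    (\<integral>\<^sup>+x\<in>{0..<1}. ennreal (exp ((u x)\<^sup>2 / 2 + v x)) \<partial>lborel)"
proof -
  interpret N: prob_space "density lborel std_normal_density"
    by (rule prob_space_normal_density) simp
  have "(\<lambda>z. ennreal (exp (u (fst z) * (snd z - f0 (fst z)) + v (fst z)))) \<in> borel_measurable (borel \<Otimes>\<^sub>M borel)"
    by measurable
  then have "(\<lambda>z. ennreal (exp (u (fst z) * (snd z - f0 (fst z)) + v (fst z)))) \<in> borel_measurable borel"
    unfolding borel_prod .
  then have "(\<integral>\<^sup>+z. ennreal (exp (u (fst z) * (snd z - f0 (fst z)) + v (fst z))) \<partial>obs_law f0) =
    (\<integral>\<^sup>+z. ennreal (exp (u (fst z) * snd z + v (fst z)))
      \<partial>(uniform_measure lborel {0..<1} \<Otimes>\<^sub>M density lborel std_normal_density))"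
    unfolding obs_law_def
    by (subst nn_integral_distr[OF measurable_add_noise]) (auto simp: case_prod_beta)
  also have "\<dots> = (\<integral>\<^sup>+x. \<integral>\<^sup>+e. ennreal (exp (u x * e + v x)) \<partial>density lborel std_normal_density
      \<partial>uniform_measure lborel {0..<1})"
    by (subst N.nn_integral_fst[symmetric]) (simp_all cong: measurable_cong_sets)
  also have "\<dots> = (\<integral>\<^sup>+x\<in>{0..<1}. ennreal (exp ((u x)\<^sup>2 / 2 + v x)) \<partial>lborel)"
    unfolding nn_integral_exp_std_normal
    by (subst nn_integral_uniform_measure) (auto simp: divide_ennreal_def)
  finally show ?thesis .
qed

lemma prob_space_sample_law:
  assumes "f \<in> borel_measurable borel"
  shows "prob_space (sample_law n f)"
  unfolding sample_law_def by (intro prob_space_PiM prob_space_obs_law assms)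

lemma measurable_sample_sum [measurable]:
  fixes g :: "real \<times> real \<Rightarrow> real"
  assumes [measurable]: "g \<in> borel_measurable borel"
  shows "(\<lambda>z. \<Sum>i=1..n. g (z i)) \<in> borel_measurable (sample_law n f0)"
  unfolding sample_law_def
  by (intro borel_measurable_sum measurable_compose[OF measurable_component_singleton]) auto

lemma measurable_residual [measurable]:
  fixes f0 :: "real \<Rightarrow> real"
  assumes [measurable]: "f0 \<in> borel_measurable borel" "u \<in> borel_measurable borel" "v \<in> borel_measurable borel"
  shows "(\<lambda>z. u (fst z) * (snd z - f0 (fst z)) + v (fst z) :: real) \<in> borel_measurable borel"
  unfolding borel_prod[symmetric] by measurable

lemma nn_integral_exp_sample_law:
  assumes [measurable]: "f0 \<in> borel_measurable borel" "u \<in> borel_measurable borel" "v \<in> borel_measurable borel"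
  shows "(\<integral>\<^sup>+z. ennreal (exp (\<Sum>i=1..n. u (fst (z i)) * (snd (z i) - f0 (fst (z i))) + v (fst (z i))))
      \<partial>sample_law n f0) =
    (\<integral>\<^sup>+x\<in>{0..<1}. ennreal (exp ((u x)\<^sup>2 / 2 + v x)) \<partial>lborel) ^ n"
proof -
  let ?g = "\<lambda>z. u (fst z) * (snd z - f0 (fst z)) + v (fst z)"
  interpret O: prob_space "obs_law f0" by (rule prob_space_obs_law) simp
  interpret product_sigma_finite "\<lambda>i. obs_law f0" ..
  have "(\<integral>\<^sup>+z. ennreal (exp (\<Sum>i=1..n. ?g (z i))) \<partial>sample_law n f0) =
      (\<integral>\<^sup>+z. (\<Prod>i\<in>{1..n}. ennreal (exp (?g (z i)))) \<partial>sample_law n f0)"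
    by (intro nn_integral_cong) (simp add: exp_sum prod_ennreal)
  also have "\<dots> = (\<Prod>i\<in>{1..n}. \<integral>\<^sup>+z. ennreal (exp (?g z)) \<partial>obs_law f0)"
    unfolding sample_law_def
    by (intro product_nn_integral_prod) auto
  also have "\<dots> = (\<integral>\<^sup>+x\<in>{0..<1}. ennreal (exp ((u x)\<^sup>2 / 2 + v x)) \<partial>lborel) ^ n"
    by (simp add: nn_integral_exp_obs_law)
  finally show ?thesis .
qed

section \<open>Likelihood ratios and the test on one interval\<close>

text \<open>The likelihood ratio of \<open>f\<close> against \<open>f0\<close>, written through the
  residuals. In this form it is positive everywhere, even where both densities vanish, and can be
  inverted freely.\<close>

definition lik_ratio :: "nat \<Rightarrow> (real \<Rightarrow> real) \<Rightarrow> (real \<Rightarrow> real) \<Rightarrow> (nat \<Rightarrow> real \<times> real) \<Rightarrow> real" where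
  "lik_ratio n f0 f z =
     exp (\<Sum>i=1..n. (f (fst (z i)) - f0 (fst (z i))) * (snd (z i) - f0 (fst (z i)))
       - (f (fst (z i)) - f0 (fst (z i)))\<^sup>2 / 2)"

lemma lik_ratio_pos: "0 < lik_ratio n f0 f z"
  by (simp add: lik_ratio_def)

text \<open>The factor in front of the ratio does not depend on the parameter and therefore cancels
  from the posterior.\<close>

lemma likelihood_eq_lik_ratio:
  "likelihood n z \<theta> = (\<Prod>i=1..n. obs_density f0 (z i)) * lik_ratio n f0 (step_fun \<theta>) z"
proof -
  have "obs_density (step_fun \<theta>) (x, y) =
      obs_density f0 (x, y) * exp ((step_fun \<theta> x - f0 x) * (y - f0 x) - (step_fun \<theta> x - f0 x)\<^sup>2 / 2)" for x y
    unfolding obs_density_def normal_density_def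
    by (simp add: exp_add[symmetric] field_simps power2_eq_square)
  then show ?thesis
    unfolding likelihood_def lik_ratio_def
    by (simp add: exp_sum prod.distrib[symmetric] case_prod_beta) (metis (no_types, lifting) prod.collapse)
qed

text \<open>Off the interval the integrand is at most 1, so the integral is at most
  \<open>1 + (u - l) * (exp y - 1)\<close>; the exponential form is kept because an n-th power
  follows.\<close>

lemma nn_integral_exp_interval_le:
  assumes lu: "0 \<le> l" "l \<le> u" "u \<le> 1"
    and w: "\<And>x. x \<in> {l..<u} \<Longrightarrow> w x \<le> y" "\<And>x. x \<in> {0..<1} - {l..<u} \<Longrightarrow> w x \<le> 0"
  shows "(\<integral>\<^sup>+x\<in>{0..<1}. ennreal (exp (w x)) \<partial>lborel) \<le> ennreal (exp ((u - l) * (exp y - 1)))"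
proof -
  have "(\<integral>\<^sup>+x\<in>{0..<1}. ennreal (exp (w x)) \<partial>lborel) \<le>
      (\<integral>\<^sup>+x. (indicator {0..<l} x + indicator {u..<1} x) + ennreal (exp y) * indicator {l..<u} x \<partial>lborel)"
    using lu w by (intro nn_integral_mono) (auto split: split_indicator simp: ennreal_leI)
  also have "\<dots> = (ennreal l + ennreal (1 - u)) + ennreal (exp y) * ennreal (u - l)"
    using lu by (simp add: nn_integral_add nn_integral_cmult)
  also have "\<dots> = ennreal (1 + (u - l) * (exp y - 1))"
    using lu by (simp add: ennreal_plus[symmetric] ennreal_mult'[symmetric] algebra_simps del: ennreal_plus)
  also have "\<dots> \<le> ennreal (exp ((u - l) * (exp y - 1)))"
    by (intro ennreal_leI exp_ge_add_one_self)
  finally show ?thesis .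
qed

text \<open>Per unit of \<open>n * (u - l)\<close>, the left-hand sides are the exponents of the two
  error probabilities when the tilt is \<open>\<kappa> * b\<close> and the threshold lies halfway.
  To first order in \<open>\<kappa>\<close> both equal \<open>- (\<kappa> * b\<^sup>2 / 2)\<close>;
  the smallness of \<open>\<kappa>\<close> and \<open>\<kappa> * b\<^sup>2\<close> leaves room for
  the higher terms.\<close>

lemma test_exponent_bounds:
  fixes \<kappa> b :: real
  assumes "0 < \<kappa>" "\<kappa> \<le> 1 / 4" "\<kappa> * b\<^sup>2 \<le> 1 / 4"
  shows "exp (\<kappa>\<^sup>2 * b\<^sup>2 / 2) - 1 - \<kappa> * b\<^sup>2 / 2 \<le> - (\<kappa> * b\<^sup>2 / 8)"
    and "exp (\<kappa>\<^sup>2 * b\<^sup>2 / 2 - \<kappa> * b\<^sup>2) - 1 + \<kappa> * b\<^sup>2 / 2 \<le> - (\<kappa> * b\<^sup>2 / 8)"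
proof -
  define q where "q = \<kappa> * b\<^sup>2"
  have q: "0 \<le> q" "q \<le> 1 / 4" using assms by (auto simp: q_def)
  have kq: "\<kappa>\<^sup>2 * b\<^sup>2 = \<kappa> * q" by (simp add: q_def power2_eq_square)
  have kq1: "0 \<le> \<kappa> * q" "\<kappa> * q \<le> q / 4" using assms q mult_right_mono[of \<kappa> "1/4" q] by auto
  have "exp (\<kappa> * q / 2) \<le> 1 + \<kappa> * q / 2 + (\<kappa> * q / 2)\<^sup>2"
    using kq1 q by (intro exp_bound) auto
  moreover have "(\<kappa> * q / 2)\<^sup>2 \<le> \<kappa> * q / 2 * 1"
    unfolding power2_eq_square using kq1 q by (intro mult_left_mono) auto
  ultimately have "exp (\<kappa> * q / 2) \<le> 1 + q / 4" using kq1 by simp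
  then show "exp (\<kappa>\<^sup>2 * b\<^sup>2 / 2) - 1 - \<kappa> * b\<^sup>2 / 2 \<le> - (\<kappa> * b\<^sup>2 / 8)"
    unfolding kq q_def[symmetric] using q by simp
  define y where "y = q - \<kappa> * q / 2"
  have y: "7 / 8 * q \<le> y" "y \<le> q" using kq1 by (auto simp: y_def)
  then have y0: "0 \<le> y" "y \<le> 1 / 4" using q by auto
  have "exp (- y) \<le> 1 / (1 + y)"
    using exp_ge_add_one_self[of y] y0 by (simp add: exp_minus inverse_eq_divide frac_le)
  also have "\<dots> \<le> 1 - y + y * y"
    using y0 by (simp add: field_simps)
  also have "y * y \<le> 1 / 4 * y" using y0 by (intro mult_right_mono) auto
  finally have "exp (- y) \<le> 1 - 3 / 4 * y" by simp
  then show "exp (\<kappa>\<^sup>2 * b\<^sup>2 / 2 - \<kappa> * b\<^sup>2) - 1 + \<kappa> * b\<^sup>2 / 2 \<le> - (\<kappa> * b\<^sup>2 / 8)"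
  proof -
    have "exp (- y) - 1 + q / 2 \<le> - (q / 8)"
      using y q \<open>exp (- y) \<le> 1 - 3 / 4 * y\<close> by linarith
    then show ?thesis unfolding kq q_def[symmetric] by (simp add: y_def)
  qed
qed

lemma half_square_diff: "(a - m * c)\<^sup>2 / 2 + - (a\<^sup>2 / 2) = m\<^sup>2 * c\<^sup>2 / 2 - m * (c * a)" for a c m :: real
  by (simp add: power2_eq_square field_simps)

text \<open>The test rejects when the residuals summed over the observations in \<open>[l, u)\<close> are large;
  both error probabilities are bounded by Chernoff's method with parameter \<open>\<kappa> b\<close>.\<close>

lemma interval_test:
  fixes l u b s \<kappa> :: real and n :: nat
  assumes [measurable]: "f0 \<in> borel_measurable borel"
    and lu: "0 \<le> l" "l \<le> u" "u \<le> 1" and b: "0 < b" and s: "s \<in> {1, -1}"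
    and \<kappa>: "0 < \<kappa>" "\<kappa> \<le> 1 / 4" "\<kappa> * b\<^sup>2 \<le> 1 / 4"
  defines "e \<equiv> ennreal (exp (- (\<kappa> * n * (u - l) * b\<^sup>2 / 8)))"
  obtains \<phi> where "\<phi> \<in> sets (sample_law n f0)" "emeasure (sample_law n f0) \<phi> \<le> e"
    "\<And>f. f \<in> borel_measurable borel \<Longrightarrow> (\<And>x. l \<le> x \<Longrightarrow> x < u \<Longrightarrow> b \<le> s * (f x - f0 x)) \<Longrightarrow>
      (\<integral>\<^sup>+z\<in>space (sample_law n f0) - \<phi>. ennreal (lik_ratio n f0 f z) \<partial>sample_law n f0) \<le> e"
proof -
  define g where "g = (\<lambda>x. s * indicator {l..<u} x :: real)"
  have [measurable]: "g \<in> borel_measurable borel" unfolding g_def by measurable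
  have g2: "(g x)\<^sup>2 = indicator {l..<u} x" for x
    using s by (auto simp: g_def power_mult_distrib split: split_indicator)
  define T where "T = (\<lambda>z. \<Sum>i=1..n. g (fst (z i)) * (snd (z i) - f0 (fst (z i))) + 0)"
  have T[measurable]: "T \<in> borel_measurable (sample_law n f0)"
    unfolding T_def by (rule measurable_sample_sum, rule measurable_residual) auto
  \<comment> \<open>Half of \<open>n * (u - l) * b\<close>, which bounds the mean of
    \<open>T\<close> from below under an alternative; under \<open>f0\<close> the mean is 0.\<close>
  define \<tau> where "\<tau> = n * (u - l) * b / 2"
  define \<mu> where "\<mu> = \<kappa> * b"
  have \<mu>0: "0 \<le> \<mu>" using \<kappa> b by (simp add: \<mu>_def)
  have \<mu>\<tau>: "\<mu> * \<tau> = n * (u - l) * (\<kappa> * b\<^sup>2 / 2)" by (simp add: \<mu>_def \<tau>_def power2_eq_square)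
  have \<mu>2: "\<mu>\<^sup>2 = \<kappa>\<^sup>2 * b\<^sup>2" by (simp add: \<mu>_def power_mult_distrib)
  have combine: "ennreal (exp x) * ennreal (exp ((u - l) * (exp y - 1))) ^ n \<le> e"
    if "x + n * (u - l) * (exp y - 1) \<le> - (\<kappa> * n * (u - l) * b\<^sup>2 / 8)" for x y
  proof -
    have "ennreal (exp x) * ennreal (exp ((u - l) * (exp y - 1))) ^ n = ennreal (exp (x + n * ((u - l) * (exp y - 1))))"
      by (simp add: ennreal_power ennreal_mult'[symmetric] exp_add exp_of_nat_mult)
    then show ?thesis using that unfolding e_def by (simp add: mult.assoc ennreal_leI)
  qed
  define \<phi> where "\<phi> = {z \<in> space (sample_law n f0). \<tau> \<le> T z}"
  have \<phi>: "\<phi> \<in> sets (sample_law n f0)" unfolding \<phi>_def by measurable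
  have mono: "n * (u - l) * y \<le> n * (u - l) * y'" if "y \<le> y'" for y y'
    using lu that by (intro mult_left_mono) auto
  have rate: "- (\<kappa> * n * (u - l) * b\<^sup>2 / 8) = n * (u - l) * - (\<kappa> * b\<^sup>2 / 8)" by simp
  show thesis
  proof (rule that[OF \<phi>])
    have "emeasure (sample_law n f0) \<phi> = (\<integral>\<^sup>+z. indicator \<phi> z \<partial>sample_law n f0)"
      using \<phi> by simp
    also have "\<dots> \<le> (\<integral>\<^sup>+z. ennreal (exp (- \<mu> * \<tau>)) * ennreal (exp (\<mu> * T z)) \<partial>sample_law n f0)"
    proof (rule nn_integral_mono)
      fix z
      have "1 \<le> exp (- \<mu> * \<tau> + \<mu> * T z)" if "z \<in> \<phi>"
        using that \<mu>0 by (auto simp: \<phi>_def intro!: mult_left_mono)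
      then show "indicator \<phi> z \<le> ennreal (exp (- \<mu> * \<tau>)) * ennreal (exp (\<mu> * T z))"
        by (auto simp: ennreal_mult'[symmetric] exp_add[symmetric] split: split_indicator)
    qed
    also have "\<dots> = ennreal (exp (- \<mu> * \<tau>)) * (\<integral>\<^sup>+z. ennreal (exp (\<mu> * T z)) \<partial>sample_law n f0)"
      by (rule nn_integral_cmult) measurable
    also have "(\<integral>\<^sup>+z. ennreal (exp (\<mu> * T z)) \<partial>sample_law n f0) =
        (\<integral>\<^sup>+x\<in>{0..<1}. ennreal (exp ((\<mu> * g x)\<^sup>2 / 2 + 0)) \<partial>lborel) ^ n"
      by (subst nn_integral_exp_sample_law[symmetric]) (auto simp: T_def sum_distrib_left mult.assoc)
    also have "\<dots> \<le> ennreal (exp ((u - l) * (exp (\<mu>\<^sup>2 / 2) - 1))) ^ n"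
      by (intro power_mono nn_integral_exp_interval_le lu) (auto simp: power_mult_distrib g2)
    also have "ennreal (exp (- \<mu> * \<tau>)) * \<dots> \<le> e"
    proof (rule combine)
      show "- \<mu> * \<tau> + n * (u - l) * (exp (\<mu>\<^sup>2 / 2) - 1) \<le> - (\<kappa> * n * (u - l) * b\<^sup>2 / 8)"
        using mono[OF test_exponent_bounds(1)[OF \<kappa>]] \<mu>\<tau> unfolding \<mu>2 rate
        by (simp only: right_diff_distrib)
    qed
    finally show "emeasure (sample_law n f0) \<phi> \<le> e" by (simp add: mult_left_mono)
  next
    fix f assume [measurable]: "f \<in> borel_measurable borel"
      and f: "\<And>x. l \<le> x \<Longrightarrow> x < u \<Longrightarrow> b \<le> s * (f x - f0 x)"
    let ?h = "\<lambda>x. f x - f0 x"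
    \<comment> \<open>The exponent of \<open>lik_ratio\<close> multiplied by
      \<open>exp (- \<mu> * T z)\<close>. Since \<open>T z < \<tau>\<close> off the rejection
      region, the factor \<open>exp (\<mu> * \<tau>)\<close> makes up for the tilt there.\<close>
    let ?W = "\<lambda>z. \<Sum>i=1..n. (?h (fst (z i)) - \<mu> * g (fst (z i))) * (snd (z i) - f0 (fst (z i))) + - ((?h (fst (z i)))\<^sup>2 / 2)"
    have "(\<integral>\<^sup>+z\<in>space (sample_law n f0) - \<phi>. ennreal (lik_ratio n f0 f z) \<partial>sample_law n f0) \<le>
        (\<integral>\<^sup>+z. ennreal (exp (\<mu> * \<tau>)) * ennreal (exp (?W z)) \<partial>sample_law n f0)"
    proof (rule nn_integral_mono)
      fix z assume "z \<in> space (sample_law n f0)"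
      have "(\<Sum>i=1..n. ?h (fst (z i)) * (snd (z i) - f0 (fst (z i))) - (?h (fst (z i)))\<^sup>2 / 2) - \<mu> * T z = ?W z"
        unfolding T_def sum_distrib_left sum_subtractf[symmetric]
        by (rule sum.cong[OF refl]) (simp add: left_diff_distrib mult.assoc)
      then have W: "exp (\<mu> * \<tau>) * exp (?W z) = exp (\<mu> * (\<tau> - T z)) * lik_ratio n f0 f z"
        unfolding lik_ratio_def exp_add[symmetric] right_diff_distrib by (intro arg_cong[where f = exp]) linarith
      have "lik_ratio n f0 f z \<le> exp (\<mu> * \<tau>) * exp (?W z)" if "z \<in> space (sample_law n f0) - \<phi>"
      proof -
        have "1 \<le> exp (\<mu> * (\<tau> - T z))" using that \<mu>0 by (auto simp: \<phi>_def)
        then have "1 * lik_ratio n f0 f z \<le> exp (\<mu> * (\<tau> - T z)) * lik_ratio n f0 f z"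
          by (intro mult_right_mono) (auto intro: less_imp_le lik_ratio_pos)
        then show ?thesis unfolding W by simp
      qed
      then show "ennreal (lik_ratio n f0 f z) * indicator (space (sample_law n f0) - \<phi>) z \<le>
          ennreal (exp (\<mu> * \<tau>)) * ennreal (exp (?W z))"
        by (auto simp: ennreal_mult'[symmetric] ennreal_leI split: split_indicator)
    qed
    also have "\<dots> = ennreal (exp (\<mu> * \<tau>)) * (\<integral>\<^sup>+z. ennreal (exp (?W z)) \<partial>sample_law n f0)"
      by (intro nn_integral_cmult measurable_compose[OF _ measurable_ennreal] borel_measurable_exp
          measurable_sample_sum measurable_compose[OF _ borel_measurable_exp] measurable_residual) measurable
    also have "(\<integral>\<^sup>+z. ennreal (exp (?W z)) \<partial>sample_law n f0) =
        (\<integral>\<^sup>+x\<in>{0..<1}. ennreal (exp ((?h x - \<mu> * g x)\<^sup>2 / 2 + - ((?h x)\<^sup>2 / 2))) \<partial>lborel) ^ n"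
      by (rule nn_integral_exp_sample_law) measurable
    also have "\<dots> \<le> ennreal (exp ((u - l) * (exp (\<mu>\<^sup>2 / 2 - \<mu> * b) - 1))) ^ n"
    proof (intro power_mono nn_integral_exp_interval_le lu)
      fix x
      \<comment> \<open>The squares of \<open>?h\<close> cancel, so the alternative enters only
        through \<open>g x * ?h x\<close>, which is at least \<open>b\<close> on the interval; the
        size of \<open>?h\<close> elsewhere is irrelevant.\<close>
      have sq: "(?h x - \<mu> * g x)\<^sup>2 / 2 + - ((?h x)\<^sup>2 / 2) = \<mu>\<^sup>2 * (g x)\<^sup>2 / 2 - \<mu> * (g x * ?h x)"
        by (rule half_square_diff)
      show "(?h x - \<mu> * g x)\<^sup>2 / 2 + - ((?h x)\<^sup>2 / 2) \<le> \<mu>\<^sup>2 / 2 - \<mu> * b" if "x \<in> {l..<u}"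
        using f[of x] that \<mu>0 unfolding sq g2 by (auto simp: g_def intro!: mult_left_mono)
      show "(?h x - \<mu> * g x)\<^sup>2 / 2 + - ((?h x)\<^sup>2 / 2) \<le> 0" if "x \<in> {0..<1} - {l..<u}"
        using that unfolding sq g2 by (auto simp: g_def)
    qed simp
    also have "ennreal (exp (\<mu> * \<tau>)) * \<dots> \<le> e"
    proof (rule combine)
      have "\<mu> * b = \<kappa> * b\<^sup>2" by (simp add: \<mu>_def power2_eq_square)
      then show "\<mu> * \<tau> + n * (u - l) * (exp (\<mu>\<^sup>2 / 2 - \<mu> * b) - 1) \<le> - (\<kappa> * n * (u - l) * b\<^sup>2 / 8)"
        using mono[OF test_exponent_bounds(2)[OF \<kappa>]] \<mu>\<tau> unfolding \<mu>2 rate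
        by (simp only: distrib_left right_diff_distrib)
    qed
    finally show "(\<integral>\<^sup>+z\<in>space (sample_law n f0) - \<phi>. ennreal (lik_ratio n f0 f z) \<partial>sample_law n f0) \<le> e"
      by (simp add: mult_left_mono)
  qed
qed

section \<open>Expected inverse likelihood ratio\<close>

lemma exp_le_one_plus: "exp y \<le> 1 + exp y * y" for y :: real
proof -
  have "1 - y \<le> exp (- y)" using exp_ge_add_one_self[of "- y"] by simp
  then have "exp y * (1 - y) \<le> exp y * exp (- y)" by (intro mult_left_mono) auto
  then show ?thesis by (simp add: exp_minus algebra_simps)
qed

text \<open>With h the difference \<open>f x - f0 x\<close>, half the square of h comes from the
  Gaussian moment and another half from inverting the ratio; they add instead of cancelling. The
  bound \<open>B\<close> then linearises the exponential of the square of h.\<close>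

lemma nn_integral_inverse_lik_ratio_le:
  assumes [measurable]: "f0 \<in> borel_measurable borel" "f \<in> borel_measurable borel"
    and B: "\<And>x. x \<in> {0..<1} \<Longrightarrow> \<bar>f x - f0 x\<bar> \<le> B"
  shows "(\<integral>\<^sup>+z. ennreal (1 / lik_ratio n f0 f z) \<partial>sample_law n f0) \<le>
    ennreal (exp (n * (exp (B\<^sup>2) * (L2_norm (\<lambda>x. f x - f0 x))\<^sup>2)))"
proof -
  let ?h = "\<lambda>x. f x - f0 x"
  let ?q = "exp (B\<^sup>2) * (L2_norm (\<lambda>x. f x - f0 x))\<^sup>2"
  have hB: "(?h x)\<^sup>2 \<le> B\<^sup>2" if "x \<in> {0..<1}" for x
    using power_mono[OF B[OF that], of 2] by simp
  have int: "integrable lborel (\<lambda>x. indicator {0..<1} x * (?h x)\<^sup>2)"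
    by (rule Bochner_Integration.integrable_bound[of _ "\<lambda>x. B\<^sup>2 * indicator {0..<1} x"])
      (auto intro!: AE_I2 integrable_mult_right integrable_real_indicator split: split_indicator simp: hB
        simp del: integrable_indicator_iff)
  have "(\<integral>\<^sup>+x\<in>{0..<1}. ennreal (exp ((- ?h x)\<^sup>2 / 2 + (?h x)\<^sup>2 / 2)) \<partial>lborel) \<le>
      (\<integral>\<^sup>+x. indicator {0..<1} x + ennreal (exp (B\<^sup>2)) * ennreal (indicator {0..<1} x * (?h x)\<^sup>2) \<partial>lborel)"
  proof (rule nn_integral_mono)
    fix x
    show "ennreal (exp ((- ?h x)\<^sup>2 / 2 + (?h x)\<^sup>2 / 2)) * indicator {0..<1} x \<le>
        indicator {0..<1} x + ennreal (exp (B\<^sup>2)) * ennreal (indicator {0..<1} x * (?h x)\<^sup>2)"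
    proof (cases "x \<in> {0..<1}")
      case True
      have "exp ((?h x)\<^sup>2) \<le> 1 + exp ((?h x)\<^sup>2) * (?h x)\<^sup>2" by (rule exp_le_one_plus)
      also have "exp ((?h x)\<^sup>2) * (?h x)\<^sup>2 \<le> exp (B\<^sup>2) * (?h x)\<^sup>2"
        using hB[OF True] by (intro mult_right_mono) auto
      finally have "ennreal (exp ((?h x)\<^sup>2)) \<le> ennreal (1 + exp (B\<^sup>2) * (?h x)\<^sup>2)"
        by (intro ennreal_leI) simp
      also have "\<dots> = 1 + ennreal (exp (B\<^sup>2)) * ennreal ((?h x)\<^sup>2)"
        by (simp add: ennreal_mult)
      moreover have "(- ?h x)\<^sup>2 / 2 + (?h x)\<^sup>2 / 2 = (?h x)\<^sup>2" by (simp only: power2_minus field_sum_of_halves)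
      ultimately show ?thesis using True by (simp only: indicator_simps mult_1 mult_1_right)
    qed simp
  qed
  also have "\<dots> = 1 + ennreal (exp (B\<^sup>2)) * ennreal (LINT x|lborel. indicator {0..<1} x * (?h x)\<^sup>2)"
  proof -
    have "(\<integral>\<^sup>+x. ennreal (exp (B\<^sup>2)) * ennreal (indicator {0..<1} x * (?h x)\<^sup>2) \<partial>lborel) =
        ennreal (exp (B\<^sup>2)) * (\<integral>\<^sup>+x. ennreal (indicator {0..<1} x * (?h x)\<^sup>2) \<partial>lborel)"
      by (rule nn_integral_cmult) measurable
    also have "(\<integral>\<^sup>+x. ennreal (indicator {0..<1} x * (?h x)\<^sup>2) \<partial>lborel) =
        ennreal (LINT x|lborel. indicator {0..<1} x * (?h x)\<^sup>2)"
      by (rule nn_integral_eq_integral[OF int]) simp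
    finally show ?thesis by (subst nn_integral_add) simp_all
  qed
  also have "(LINT x|lborel. indicator {0..<1} x * (?h x)\<^sup>2) = (L2_norm ?h)\<^sup>2"
    by (simp add: L2_norm_power2 set_lebesgue_integral_def)
  also have "1 + ennreal (exp (B\<^sup>2)) * ennreal ((L2_norm ?h)\<^sup>2) = ennreal (1 + ?q)"
    by (simp add: ennreal_mult)
  also have "\<dots> \<le> ennreal (exp ?q)" by (intro ennreal_leI exp_ge_add_one_self)
  finally have single: "(\<integral>\<^sup>+x\<in>{0..<1}. ennreal (exp ((- ?h x)\<^sup>2 / 2 + (?h x)\<^sup>2 / 2)) \<partial>lborel) \<le> ennreal (exp ?q)" .
  have neg: "- (a * b - c) = - a * b + c" for a b c :: real by simp
  have "(\<integral>\<^sup>+z. ennreal (1 / lik_ratio n f0 f z) \<partial>sample_law n f0) =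
      (\<integral>\<^sup>+z. ennreal (exp (\<Sum>i=1..n. (- ?h (fst (z i))) * (snd (z i) - f0 (fst (z i))) + (?h (fst (z i)))\<^sup>2 / 2))
        \<partial>sample_law n f0)"
    unfolding lik_ratio_def inverse_eq_divide[symmetric] exp_minus[symmetric] sum_negf[symmetric]
    by (intro nn_integral_cong arg_cong[where f = "\<lambda>x. ennreal (exp x)"] sum.cong refl neg)
  also have "\<dots> = (\<integral>\<^sup>+x\<in>{0..<1}. ennreal (exp ((- ?h x)\<^sup>2 / 2 + (?h x)\<^sup>2 / 2)) \<partial>lborel) ^ n"
    by (rule nn_integral_exp_sample_law) measurable
  also have "\<dots> \<le> ennreal (exp ?q) ^ n" by (rule power_mono[OF single]) simp
  also have "\<dots> = ennreal (exp (n * ?q))"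
    unfolding exp_of_nat_mult by (rule ennreal_power) simp
  finally show ?thesis .
qed

section \<open>Prior mass near the true function: lower bound\<close>

lemma changepoints_knot_gaps:
  assumes t: "t \<in> changepoints \<delta> k" and "i \<le> j" "j \<le> k"
  shows "knot k t i + real (j - i) * \<delta> \<le> knot k t j"
  using assms(2,3)
proof (induction j rule: dec_induct)
  case (step j)
  have "knot k t j + \<delta> \<le> knot k t (Suc j)"
    using changepoints_knot_gap[OF t, of j "Suc j"] step by auto
  then show ?case using step by (simp add: Suc_diff_le algebra_simps)
qed simp

lemma changepoints_length_le:
  assumes "t \<in> changepoints \<delta> k" "k \<ge> 1"
  shows "real k * \<delta> \<le> 1"
  using changepoints_knot_gaps[OF assms(1), of 0 k] assms(2) by simp

text \<open>A density on the change-points excludes the extremal case \<open>k \<delta> = 1\<close>, in which equal spacing is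
  forced.\<close>

lemma prior_densities_length_less:
  assumes \<delta>: "0 < \<delta>" and dens: "prior_densities K \<delta> k \<pi>a \<pi>t" and k: "k \<ge> 2"
  shows "real k * \<delta> < 1"
proof (rule ccontr)
  assume "\<not> ?thesis"
  then have ge: "1 \<le> real k * \<delta>" by simp
  \<comment> \<open>If \<open>1 \<le> real k * \<delta>\<close>, every gap has to equal
    \<open>\<delta>\<close>; already the first change-point is then fixed, which confines
    \<open>changepoints \<delta> k\<close> to a null hyperplane that carries no probability
    density.\<close>
  let ?N = "\<Pi>\<^sub>E j\<in>{1..<k}. if j = 1 then {\<delta>} else UNIV :: real set"
  have "emeasure (lebesgue_changepoints k) ?N = (\<Prod>j\<in>{1..<k}. emeasure lborel (if j = 1 then {\<delta>} else UNIV :: real set))"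
    unfolding lebesgue_changepoints_def
    by (intro product_sigma_finite.emeasure_PiM[OF product_sigma_finite_lborel]) auto
  also have "\<dots> = 0" using k by (intro prod_zero) (auto intro!: bexI[of _ 1])
  finally have N: "?N \<in> null_sets (lebesgue_changepoints k)"
    unfolding lebesgue_changepoints_def by (auto simp: null_sets_def intro!: sets_PiM_I_finite)
  have sub: "changepoints \<delta> k \<subseteq> ?N"
  proof
    fix t assume t: "t \<in> changepoints \<delta> k"
    have "knot k t 0 + real (1 - 0) * \<delta> \<le> knot k t 1" "knot k t 1 + real (k - 1) * \<delta> \<le> knot k t k"
      by (rule changepoints_knot_gaps[OF t]; use k in simp)+
    moreover have "real (k - 1) * \<delta> = real k * \<delta> - \<delta>" using k by (simp add: of_nat_diff algebra_simps)
    ultimately have "t 1 = \<delta>" using k ge knot_interior[of 1 k t] by simp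
    then show "t \<in> ?N" using t by (auto simp: changepoints_def PiE_def extensional_def)
  qed
  have "(\<integral>\<^sup>+t\<in>changepoints \<delta> k. ennreal (\<pi>t t) \<partial>lebesgue_changepoints k) \<le>
      (\<integral>\<^sup>+t\<in>?N. ennreal (\<pi>t t) \<partial>lebesgue_changepoints k)"
    using sub by (intro nn_integral_mono) (auto split: split_indicator)
  also have "\<dots> = 0" by (rule nn_integral_null_set[OF N])
  finally show False using dens by (simp add: prior_densities_def)
qed

text \<open>Moving \<open>t0\<close> towards the equally spaced points \<open>j / k\<close> produces room for a box, even when \<open>t0\<close>
  lies on the boundary of the set of admissible change-points.\<close>

lemma changepoints_box_subset:
  assumes \<delta>: "0 < \<delta>" and t0: "t0 \<in> changepoints \<delta> k" and k: "k \<ge> 1"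
    and \<tau>: "0 \<le> \<tau>" "\<tau> \<le> 1" and g: "2 * g \<le> \<tau> * (1 / k - \<delta>)" "0 \<le> g"
  shows "(\<Pi>\<^sub>E j\<in>{1..<k}. {(1 - \<tau>) * t0 j + \<tau> * (j / k) - g..(1 - \<tau>) * t0 j + \<tau> * (j / k) + g})
    \<subseteq> {t \<in> changepoints \<delta> k. \<forall>j\<in>{1..<k}. \<bar>t j - t0 j\<bar> \<le> 2 * \<tau>}"
proof
  fix t assume t: "t \<in> (\<Pi>\<^sub>E j\<in>{1..<k}. {(1 - \<tau>) * t0 j + \<tau> * (j / k) - g..(1 - \<tau>) * t0 j + \<tau> * (j / k) + g})"
  have near: "\<bar>knot k t j - ((1 - \<tau>) * knot k t0 j + \<tau> * (j / k))\<bar> \<le> g" if jk: "j \<le> k" for j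
  proof -
    consider "j = 0" | "j = k" "j \<noteq> 0" | "j \<in> {1..<k}" using jk by force
    then show ?thesis
    proof cases
      case 3
      then have "t j \<in> {(1 - \<tau>) * t0 j + \<tau> * (j / k) - g..(1 - \<tau>) * t0 j + \<tau> * (j / k) + g}"
        using t by (rule PiE_mem[rotated])
      then show ?thesis using knot_interior[OF 3] by (simp add: abs_le_iff)
    qed (use g k in auto)
  qed
  have "knot k t (j - 1) < knot k t j \<and> \<delta> \<le> \<bar>knot k t j - knot k t (j - 1)\<bar>" if j: "j \<in> {1..k}" for j
  proof -
    have j1: "real (j - 1) = real j - 1" using j by (simp add: of_nat_diff)
    \<comment> \<open>The centre of the box is a convex combination of knots with gaps at least
      \<open>\<delta>\<close> and knots with gaps \<open>1 / k\<close>. Its gaps exceed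
      \<open>\<delta>\<close> by at least \<open>2 * g\<close>, which pays for moving both end
      points by up to \<open>g\<close>.\<close>
    have "(1 - \<tau>) * (knot k t0 (j - 1) + \<delta>) \<le> (1 - \<tau>) * knot k t0 j"
      using changepoints_knot_gap[OF t0, of "j - 1" j] j \<tau> by (intro mult_left_mono) auto
    moreover have "\<tau> * (j / k) - \<tau> * (real (j - 1) / k) = \<tau> * (1 / k)"
      by (simp only: j1 right_diff_distrib[symmetric] diff_divide_distrib[symmetric]) simp
    moreover have "\<tau> * (1 / k) \<ge> \<tau> * \<delta> + 2 * g" using g by (simp add: right_diff_distrib)
    ultimately have "\<delta> \<le> knot k t j - knot k t (j - 1)"
      using near[of j] near[OF le_trans[OF diff_le_self, of j k 1]] j
      by (simp only: abs_le_iff distrib_left left_diff_distrib) simp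
    then show ?thesis using \<delta> by auto
  qed
  then have mem: "t \<in> changepoints \<delta> k" using t by (auto simp: changepoints_def PiE_def)
  moreover have "\<bar>t j - t0 j\<bar> \<le> 2 * \<tau>" if j: "j \<in> {1..<k}" for j
  proof -
    have b: "0 \<le> t0 j" "t0 j \<le> 1"
      using changepoints_knot_bounds[OF t0 \<delta>, of j] knot_interior[OF j, of t0] j k by auto
    have "0 \<le> real j / k" "real j / k \<le> 1" using j by auto
    then have "\<bar>real j / k - t0 j\<bar> \<le> 1" using b by linarith
    then have "\<tau> * \<bar>real j / k - t0 j\<bar> \<le> \<tau> * 1" using \<tau> by (intro mult_left_mono) auto
    then have 1: "\<bar>\<tau> * (real j / k - t0 j)\<bar> \<le> \<tau>" using \<tau> by (simp add: abs_mult)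
    have "1 / real k \<le> 1" using k by simp
    then have "\<tau> * (1 / k - \<delta>) \<le> \<tau> * 1" using \<tau> \<delta> by (intro mult_left_mono) linarith+
    then have "g \<le> \<tau>" using g by simp
    moreover have "t j - t0 j = (knot k t j - ((1 - \<tau>) * knot k t0 j + \<tau> * (j / k))) + \<tau> * (real j / k - t0 j)"
      using knot_interior[OF j] by (simp add: algebra_simps)
    ultimately show ?thesis using near[of j] j 1 by (auto simp: abs_le_iff)
  qed
  ultimately show "t \<in> {t \<in> changepoints \<delta> k. \<forall>j\<in>{1..<k}. \<bar>t j - t0 j\<bar> \<le> 2 * \<tau>}" by blast
qed

text \<open>Off the neighbourhoods of radius \<open>\<epsilon>\<^sup>2\<close> around the points
  \<open>t0 i\<close> both functions are on the segment of the same index and differ by at most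
  \<open>\<epsilon>\<close>; the neighbourhoods have total length at most
  \<open>2 * k * \<epsilon>\<^sup>2\<close> and the difference there is at most
  \<open>2 * K\<close>.\<close>

lemma L2_distance_perturbation_le:
  assumes \<delta>: "0 < \<delta>" and K: "0 < K"
    and \<theta>: "(k, a, t) \<in> Theta kmax K \<delta>" and \<theta>0: "(k, a0, t0) \<in> Theta kmax K \<delta>"
    and a: "\<And>j. j \<in> {1..k} \<Longrightarrow> \<bar>a j - a0 j\<bar> \<le> \<epsilon>" and t: "\<And>j. j \<in> {1..<k} \<Longrightarrow> \<bar>t j - t0 j\<bar> \<le> \<epsilon>\<^sup>2"
  shows "(L2_norm (\<lambda>x. step_fun (k, a, t) x - step_fun (k, a0, t0) x))\<^sup>2 \<le> (1 + 8 * K\<^sup>2 * k) * \<epsilon>\<^sup>2"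
proof -
  define h where "h = (\<lambda>x. step_fun (k, a, t) x - step_fun (k, a0, t0) x)"
  have tc: "t \<in> changepoints \<delta> k" "t0 \<in> changepoints \<delta> k" "k \<ge> 1"
    using \<theta> \<theta>0 by (auto simp: Theta_iff)
  have kn: "\<bar>knot k t j - knot k t0 j\<bar> \<le> \<epsilon>\<^sup>2" if "j \<le> k" for j
    using t[of j] that by (auto simp: knot_def)
  have cover: "(h x)\<^sup>2 \<le> \<epsilon>\<^sup>2 + 4 * K\<^sup>2 * (\<Sum>i\<in>{1..<k}. indicator {t0 i - \<epsilon>\<^sup>2..<t0 i + \<epsilon>\<^sup>2} x)"
    if x: "x \<in> {0..<1}" for x
  proof (cases "\<exists>i\<in>{1..<k}. t0 i - \<epsilon>\<^sup>2 \<le> x \<and> x < t0 i + \<epsilon>\<^sup>2")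
    case True
    then obtain i where i: "i \<in> {1..<k}" "t0 i - \<epsilon>\<^sup>2 \<le> x" "x < t0 i + \<epsilon>\<^sup>2" by blast
    have "(1::real) = (\<Sum>i\<in>{i}. indicator {t0 i - \<epsilon>\<^sup>2..<t0 i + \<epsilon>\<^sup>2} x)" using i by simp
    also have "\<dots> \<le> (\<Sum>i\<in>{1..<k}. indicator {t0 i - \<epsilon>\<^sup>2..<t0 i + \<epsilon>\<^sup>2} x)"
      using i by (intro sum_mono2) auto
    finally have 1: "4 * K\<^sup>2 * 1 \<le> 4 * K\<^sup>2 * (\<Sum>i\<in>{1..<k}. indicator {t0 i - \<epsilon>\<^sup>2..<t0 i + \<epsilon>\<^sup>2} x)"
      by (intro mult_left_mono) auto
    have "\<bar>h x\<bar> \<le> 2 * K"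
      using Theta_step_fun_abs_le[OF \<theta> \<delta> x] Theta_step_fun_abs_le[OF \<theta>0 \<delta> x] unfolding h_def by linarith
    then have "\<bar>h x\<bar>\<^sup>2 \<le> (2 * K)\<^sup>2" by (intro power_mono) auto
    then have "(h x)\<^sup>2 \<le> 4 * K\<^sup>2 * 1" by (simp add: power_mult_distrib)
    also note 1
    finally show ?thesis by (simp add: add_increasing)
  next
    case False
    obtain j where j: "j \<in> {1..k}" "knot k t0 (j - 1) \<le> x" "x < knot k t0 j"
      using ex_segment[of k x t0] x tc by auto
    have "knot k t (j - 1) \<le> x"
    proof (cases "j = 1")
      case False
      then have "j - 1 \<in> {1..<k}" using j by auto
      then show ?thesis
        using \<open>\<not> (\<exists>i\<in>_. _)\<close> j kn[of "j - 1"] knot_interior[of "j - 1" k t0] by (force simp: abs_le_iff)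
    qed (use x in auto)
    moreover have "x < knot k t j"
    proof (cases "j = k")
      case False
      then have "j \<in> {1..<k}" using j by auto
      then show ?thesis
        using \<open>\<not> (\<exists>i\<in>_. _)\<close> j kn[of j] knot_interior[of j k t0] by (force simp: abs_le_iff)
    qed (use x tc in auto)
    ultimately have "h x = a j - a0 j"
      using step_fun_segment[OF tc(1) \<delta> j(1)] step_fun_segment[OF tc(2) \<delta> j(1)] j by (simp add: h_def)
    then have "(h x)\<^sup>2 \<le> \<epsilon>\<^sup>2" using power_mono[OF a[OF j(1)], of 2] by simp
    moreover have "0 \<le> 4 * K\<^sup>2 * (\<Sum>i\<in>{1..<k}. indicator {t0 i - \<epsilon>\<^sup>2..<t0 i + \<epsilon>\<^sup>2} x :: real)"
      by (intro mult_nonneg_nonneg sum_nonneg) auto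
    ultimately show ?thesis by simp
  qed
  have "(L2_norm h)\<^sup>2 \<le> \<epsilon>\<^sup>2 + 4 * K\<^sup>2 * (\<Sum>i\<in>{1..<k}. (t0 i + \<epsilon>\<^sup>2) - (t0 i - \<epsilon>\<^sup>2))"
    by (rule L2_norm_power2_le) (use cover in \<open>auto intro: order_trans[of _ 0]\<close>)
  also have "\<dots> \<le> \<epsilon>\<^sup>2 + 4 * K\<^sup>2 * (k * (2 * \<epsilon>\<^sup>2))"
    by (intro add_left_mono mult_left_mono) (auto intro!: mult_right_mono)
  also have "\<dots> = (1 + 8 * K\<^sup>2 * k) * \<epsilon>\<^sup>2" by (simp add: algebra_simps)
  finally show ?thesis by (simp add: h_def)
qed

text \<open>The neighbourhood \<open>B\<close> contains a box on which the densities are bounded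
  below. To stay admissible when the true parameter lies on the boundary, the box is off centre: its
  level intervals extend from \<open>a0 j\<close> towards 0, and its change-points are centred
  slightly closer to equal spacing.\<close>

lemma prior_neighbourhood_ge:
  assumes \<delta>: "0 < \<delta>" and K: "0 < K"
    and \<theta>0: "(k0, a0, t0) \<in> Theta kmax K \<delta>"
    and p: "p k0 > 0"
    and dens: "prior_densities K \<delta> k0 (\<pi>a k0) (\<pi>t k0)"
    and bnd: "prior_bounds K \<delta> k0 (\<pi>a k0) (\<pi>t k0)"
  obtains c where "0 < c" "\<And>\<epsilon>. 0 < \<epsilon> \<Longrightarrow> \<epsilon> \<le> 1 \<Longrightarrow> \<exists>B\<in>sets param_space. B \<subseteq> Theta kmax K \<delta> \<and>
    ennreal (c * \<epsilon> ^ (k0 + 2 * (k0 - 1))) \<le> emeasure (prior kmax K \<delta> p \<pi>a \<pi>t) B \<and>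
    (\<forall>\<theta>\<in>B. (L2_norm (\<lambda>x. step_fun \<theta> x - step_fun (k0, a0, t0) x))\<^sup>2 \<le> (1 + 8 * K\<^sup>2 * k0) * \<epsilon>\<^sup>2)"
proof -
  let ?\<mu> = "prior_component K \<delta> k0 (\<pi>a k0) (\<pi>t k0)"
  let ?D = "k0 + 2 * (k0 - 1)"
  have k0: "k0 \<in> {1..kmax}" and a0: "a0 \<in> levels K k0" and t0: "t0 \<in> changepoints \<delta> k0"
    using \<theta>0 by (auto simp: Theta_iff)
  obtain c1 where c1: "0 < c1"
    "\<And>a t. a \<in> levels K k0 \<Longrightarrow> t \<in> changepoints \<delta> k0 \<Longrightarrow> c1 \<le> \<pi>a k0 a t * \<pi>t k0 t"
    using prior_bounds_product[OF bnd] by metis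
  define gap where "gap = 1 / k0 - \<delta>"
  have gap0: "0 \<le> gap" using changepoints_length_le[OF t0] k0 by (auto simp: gap_def field_simps)
  have gap1: "0 < gap" if "k0 \<ge> 2"
    using prior_densities_length_less[OF \<delta> dens that] that by (simp add: gap_def field_simps)
  \<comment> \<open>For \<open>k0 = 1\<close> the gap vanishes if \<open>\<delta> = 1\<close>, but
    then the exponent is 0.\<close>
  have gap_pos: "0 < (gap / 2) ^ (k0 - 1)"
    using gap1 k0 by (cases "k0 = 1") auto
  \<comment> \<open>Makes the level sides \<open>\<epsilon> * K1\<close> at most
    \<open>\<epsilon>\<close> and at most \<open>K\<close>, so that an interval pointing from
    \<open>a0 j\<close> towards 0 cannot leave the range on the other side.\<close>
  define K1 where "K1 = min 1 K"
  have K1: "0 < K1" "K1 \<le> 1" "K1 \<le> K" using K by (auto simp: K1_def)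
  define c where "c = p k0 * (c1 * (K1 ^ k0 * (gap / 2) ^ (k0 - 1)))"
  show thesis
  proof (rule that[of c])
    show "0 < c" using p c1 K1 gap_pos by (simp add: c_def)
    fix \<epsilon> :: real assume \<epsilon>: "0 < \<epsilon>" "\<epsilon> \<le> 1"
    define B where "B = {\<theta> \<in> space param_space. \<theta> \<in> Theta kmax K \<delta> \<and> fst \<theta> = k0 \<and>
      (\<forall>j\<in>{1..k0}. \<bar>fst (snd \<theta>) j - a0 j\<bar> \<le> \<epsilon>) \<and> (\<forall>j\<in>{1..<k0}. \<bar>snd (snd \<theta>) j - t0 j\<bar> \<le> \<epsilon>\<^sup>2)}"
    have [measurable]: "Measurable.pred param_space (\<lambda>\<theta>. fst \<theta> = k0)"
      by (rule measurable_compose[OF measurable_param_size]) simp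
    have B: "B \<in> sets param_space" unfolding B_def by measurable
    define \<mu> where "\<mu> = \<epsilon> * K1"
    have "\<epsilon> * K1 \<le> \<epsilon> * 1" "\<epsilon> * K1 \<le> 1 * K" using \<epsilon> K1
      by (intro mult_mono; simp)+
    then have \<mu>: "0 \<le> \<mu>" "\<mu> \<le> \<epsilon>" "\<mu> \<le> K" using \<epsilon> K1 by (auto simp: \<mu>_def)
    \<comment> \<open>The box moves change-points by at most \<open>2 * \<tau>\<close>, which is to
      be \<open>\<epsilon>\<^sup>2\<close>.\<close>
    define \<tau> where "\<tau> = \<epsilon>\<^sup>2 / 2"
    have e2: "\<epsilon>\<^sup>2 \<le> 1" using \<epsilon> by (simp add: power_le_one)
    have \<tau>: "0 \<le> \<tau>" "\<tau> \<le> 1" using e2 by (auto simp: \<tau>_def)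
    define g where "g = \<tau> * gap / 2"
    have g: "2 * g \<le> \<tau> * (1 / k0 - \<delta>)" "0 \<le> g" using \<tau> gap0 by (auto simp: g_def gap_def)
    define l where "l j = (if a0 j \<ge> 0 then a0 j - \<mu> else a0 j)" for j
    define A where "A = (\<Pi>\<^sub>E j\<in>{1..k0}. {l j..l j + \<mu>})"
    define s where "s j = (1 - \<tau>) * t0 j + \<tau> * (real j / k0)" for j
    define T where "T = (\<Pi>\<^sub>E j\<in>{1..<k0}. {s j - g..s j + g})"
    have A: "A \<in> sets (lebesgue_levels k0)" "T \<in> sets (lebesgue_changepoints k0)"
      unfolding A_def T_def lebesgue_levels_def lebesgue_changepoints_def by (auto intro!: sets_PiM_I_finite)
    have lj: "- K \<le> y \<and> y \<le> K \<and> \<bar>y - a0 j\<bar> \<le> \<epsilon>" if "j \<in> {1..k0}" "y \<in> {l j..l j + \<mu>}" for j y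
      using levels_abs_le[OF a0 that(1)] that(2) \<mu> by (auto simp: l_def abs_le_iff split: if_splits)
    have Alev: "A \<subseteq> levels K k0" unfolding A_def levels_def
      by (rule PiE_mono) (use lj in auto)
    have Anear: "\<bar>a j - a0 j\<bar> \<le> \<epsilon>" if "a \<in> A" "j \<in> {1..k0}" for a j
      using lj[OF that(2), of "a j"] PiE_mem[OF that(1)[unfolded A_def] that(2)] by blast
    have Tsub: "T \<subseteq> {t \<in> changepoints \<delta> k0. \<forall>j\<in>{1..<k0}. \<bar>t j - t0 j\<bar> \<le> 2 * \<tau>}"
      unfolding T_def s_def by (rule changepoints_box_subset[OF \<delta> t0 _ \<tau> g]) (use k0 in auto)
    have sub: "A \<times> T \<subseteq> Pair k0 -` B \<inter> space ?\<mu>"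
    proof
      fix z assume z: "z \<in> A \<times> T"
      have "z \<in> space ?\<mu>"
        using z A[THEN sets.sets_into_space] by (auto simp: prior_component_def space_pair_measure)
      moreover have "(k0, z) \<in> B"
        using z Alev Anear Tsub k0 unfolding B_def by (auto simp: Theta_iff \<tau>_def)
      ultimately show "z \<in> Pair k0 -` B \<inter> space ?\<mu>" by simp
    qed
    have eA: "emeasure (lebesgue_levels k0) A = ennreal (\<mu> ^ k0)"
      unfolding A_def lebesgue_levels_def using \<mu> by (subst emeasure_PiM_lborel_box) auto
    have eT: "emeasure (lebesgue_changepoints k0) T = ennreal ((2 * g) ^ (k0 - 1))"
      unfolding T_def lebesgue_changepoints_def using g by (subst emeasure_PiM_lborel_box) auto
    have "ennreal (c * \<epsilon> ^ ?D) = ennreal (p k0) * (ennreal c1 * (ennreal (\<mu> ^ k0) * ennreal ((2 * g) ^ (k0 - 1))))"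
    proof -
      have "2 * g = (gap / 2) * \<epsilon>\<^sup>2" by (simp add: g_def \<tau>_def)
      then have "(2 * g) ^ (k0 - 1) = (gap / 2) ^ (k0 - 1) * \<epsilon> ^ (2 * (k0 - 1))"
        by (simp only: power_mult_distrib power_mult)
      then have "c * \<epsilon> ^ ?D = p k0 * (c1 * (\<mu> ^ k0 * (2 * g) ^ (k0 - 1)))"
        by (simp add: c_def \<mu>_def power_add power_mult_distrib)
      then show ?thesis using p c1 \<mu> g by (simp add: ennreal_mult)
    qed
    also have "\<dots> \<le> ennreal (p k0) * emeasure ?\<mu> (A \<times> T)"
      unfolding eA[symmetric] eT[symmetric] using Tsub
      by (intro mult_left_mono emeasure_prior_component_box_ge[OF dens c1(2)] A Alev) auto
    also have "\<dots> \<le> ennreal (p k0) * emeasure ?\<mu> (Pair k0 -` B \<inter> space ?\<mu>)"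
      by (intro mult_left_mono emeasure_mono[OF sub] measurable_sets[OF measurable_Pair_param_space B]) auto
    also have "\<dots> \<le> emeasure (prior kmax K \<delta> p \<pi>a \<pi>t) B"
      unfolding emeasure_prior_eq[OF B] using k0
      by (intro member_le_sum[of k0 "{1..kmax}"
          "\<lambda>k. ennreal (p k) * emeasure (prior_component K \<delta> k (\<pi>a k) (\<pi>t k)) (Pair k -` B \<inter> space (prior_component K \<delta> k (\<pi>a k) (\<pi>t k)))"]) auto
    finally have "ennreal (c * \<epsilon> ^ ?D) \<le> emeasure (prior kmax K \<delta> p \<pi>a \<pi>t) B" .
    moreover have "(L2_norm (\<lambda>x. step_fun \<theta> x - step_fun (k0, a0, t0) x))\<^sup>2 \<le> (1 + 8 * K\<^sup>2 * k0) * \<epsilon>\<^sup>2" if \<theta>B: "\<theta> \<in> B" for \<theta>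
    proof -
      obtain a t where \<theta>: "\<theta> = (k0, a, t)" using \<theta>B by (cases \<theta>) (auto simp: B_def)
      show ?thesis
        unfolding \<theta> by (rule L2_distance_perturbation_le[OF \<delta> K _ \<theta>0]) (use \<theta>B in \<open>auto simp: \<theta> B_def\<close>)
    qed
    ultimately show "\<exists>B\<in>sets param_space. B \<subseteq> Theta kmax K \<delta> \<and>
      ennreal (c * \<epsilon> ^ ?D) \<le> emeasure (prior kmax K \<delta> p \<pi>a \<pi>t) B \<and>
      (\<forall>\<theta>\<in>B. (L2_norm (\<lambda>x. step_fun \<theta> x - step_fun (k0, a0, t0) x))\<^sup>2 \<le> (1 + 8 * K\<^sup>2 * k0) * \<epsilon>\<^sup>2)"
      using B by (intro bexI[of _ B]) (auto simp: B_def)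
  qed
qed

section \<open>From the posterior to likelihood ratio integrals\<close>

lemma measurable_lik_ratio_pair:
  assumes [measurable]: "f0 \<in> borel_measurable borel"
  shows "(\<lambda>(\<theta>, z). lik_ratio n f0 (step_fun \<theta>) z) \<in> borel_measurable (param_space \<Otimes>\<^sub>M sample_law n f0)"
proof -
  let ?M = "param_space \<Otimes>\<^sub>M sample_law n f0"
  have sf: "(\<lambda>\<omega>. step_fun (fst \<omega>) (snd \<omega>)) \<in> borel_measurable (param_space \<Otimes>\<^sub>M borel)"
    using measurable_step_fun_pair by (simp add: case_prod_beta)
  have fs: "fst \<in> borel_measurable (borel :: (real \<times> real) measure)"
    "snd \<in> borel_measurable (borel :: (real \<times> real) measure)"
    unfolding borel_prod[symmetric] by measurable
  have zi: "(\<lambda>\<omega>. snd \<omega> i) \<in> ?M \<rightarrow>\<^sub>M borel" if "i \<in> {1..n}" for i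
  proof (rule measurable_compose[OF measurable_snd])
    have "(\<lambda>z. z i) \<in> sample_law n f0 \<rightarrow>\<^sub>M obs_law f0"
      unfolding sample_law_def using that by (rule measurable_component_singleton)
    then show "(\<lambda>z. z i) \<in> sample_law n f0 \<rightarrow>\<^sub>M borel" by (simp cong: measurable_cong_sets)
  qed
  have "(\<lambda>\<omega>. \<Sum>i=1..n. (step_fun (fst \<omega>) (fst (snd \<omega> i)) - f0 (fst (snd \<omega> i))) * (snd (snd \<omega> i) - f0 (fst (snd \<omega> i)))
       - (step_fun (fst \<omega>) (fst (snd \<omega> i)) - f0 (fst (snd \<omega> i)))\<^sup>2 / 2) \<in> borel_measurable ?M"
  proof (rule borel_measurable_sum)
    fix i assume i: "i \<in> {1..n}"
    have [measurable]: "(\<lambda>\<omega>. fst (snd \<omega> i)) \<in> borel_measurable ?M" "(\<lambda>\<omega>. snd (snd \<omega> i)) \<in> borel_measurable ?M"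
      using measurable_compose[OF zi[OF i] fs(1)] measurable_compose[OF zi[OF i] fs(2)] .
    have "(\<lambda>\<omega>. (fst \<omega>, fst (snd \<omega> i))) \<in> ?M \<rightarrow>\<^sub>M param_space \<Otimes>\<^sub>M borel" by measurable
    from measurable_compose[OF this sf]
    have [measurable]: "(\<lambda>\<omega>. step_fun (fst \<omega>) (fst (snd \<omega> i))) \<in> borel_measurable ?M" by simp
    show "(\<lambda>\<omega>. (step_fun (fst \<omega>) (fst (snd \<omega> i)) - f0 (fst (snd \<omega> i))) * (snd (snd \<omega> i) - f0 (fst (snd \<omega> i)))
       - (step_fun (fst \<omega>) (fst (snd \<omega> i)) - f0 (fst (snd \<omega> i)))\<^sup>2 / 2) \<in> borel_measurable ?M"
      by measurable
  qed
  then have "(\<lambda>\<omega>. lik_ratio n f0 (step_fun (fst \<omega>)) (snd \<omega>)) \<in> borel_measurable ?M"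
    unfolding lik_ratio_def by (rule measurable_compose[OF _ borel_measurable_exp])
  then show ?thesis by (simp add: case_prod_beta)
qed

text \<open>The posterior is a quotient of Bochner integrals and equals 0 by default if the
  denominator vanishes or is not integrable. A value above \<open>\<eta>\<close> rules this out, and
  the event can then be expressed by nonnegative integrals, where Fubini and Markov apply.\<close>

lemma posterior_gt_imp:
  assumes A: "A \<in> sets \<nu>" and \<eta>: "0 < \<eta>" and post: "posterior \<nu> n z A > \<eta>"
  shows "ennreal \<eta> * (\<integral>\<^sup>+\<theta>. ennreal (lik_ratio n f0 (step_fun \<theta>) z) \<partial>\<nu>) \<le>
    (\<integral>\<^sup>+\<theta>\<in>A. ennreal (lik_ratio n f0 (step_fun \<theta>) z) \<partial>\<nu>)"
proof -
  define R where "R = (\<lambda>\<theta>. lik_ratio n f0 (step_fun \<theta>) z)"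
  define L where "L = (\<Prod>i=1..n. obs_density f0 (z i))"
  have R0: "0 \<le> R \<theta>" for \<theta> unfolding R_def by (rule less_imp_le[OF lik_ratio_pos])
  have "posterior \<nu> n z A = (L * (LINT \<theta>:A|\<nu>. R \<theta>)) / (L * (LINT \<theta>|\<nu>. R \<theta>))"
    unfolding posterior_def likelihood_eq_lik_ratio[of n z _ f0] R_def L_def by simp
  then have gt: "\<eta> < (L * (LINT \<theta>:A|\<nu>. R \<theta>)) / (L * (LINT \<theta>|\<nu>. R \<theta>))" using post by simp
  then have "L \<noteq> 0" using \<eta> by auto
  then have gt: "\<eta> < (LINT \<theta>:A|\<nu>. R \<theta>) / (LINT \<theta>|\<nu>. R \<theta>)" using gt by simp
  then have b0: "(LINT \<theta>|\<nu>. R \<theta>) \<noteq> 0" using \<eta> by auto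
  then have int: "integrable \<nu> R" using not_integrable_integral_eq by blast
  have bpos: "0 < (LINT \<theta>|\<nu>. R \<theta>)" using b0 R0 by (simp add: order_less_le)
  have intA: "integrable \<nu> (\<lambda>\<theta>. indicator A \<theta> * R \<theta>)"
    using integrable_mult_indicator[OF A int] by simp
  have "ennreal \<eta> * (\<integral>\<^sup>+\<theta>. ennreal (R \<theta>) \<partial>\<nu>) = ennreal (\<eta> * (LINT \<theta>|\<nu>. R \<theta>))"
    using \<eta> bpos by (subst nn_integral_eq_integral[OF int]) (auto simp: R0 ennreal_mult)
  also have "\<dots> \<le> ennreal (LINT \<theta>|\<nu>. indicator A \<theta> * R \<theta>)"
    using gt bpos by (intro ennreal_leI) (simp add: set_lebesgue_integral_def field_simps)
  also have "\<dots> = (\<integral>\<^sup>+\<theta>. ennreal (indicator A \<theta> * R \<theta>) \<partial>\<nu>)"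
    by (rule nn_integral_eq_integral[OF intA, symmetric]) (simp add: R0)
  also have "\<dots> = (\<integral>\<^sup>+\<theta>\<in>A. ennreal (R \<theta>) \<partial>\<nu>)"
    by (intro nn_integral_cong) (simp split: split_indicator)
  finally show ?thesis by (simp add: R_def)
qed

text \<open>The term \<open>s * D'\<close> uses up less than \<open>m\<close> of the total
  \<open>2 * m\<close>, and \<open>D / s\<close> must supply the rest. The subtraction is carried
  out on reals; an infinite \<open>D\<close> is trivial.\<close>

lemma ennreal_evidence_lower:
  fixes D D' :: ennreal and m s :: real
  assumes s: "0 < s" and m: "0 < m" and D': "D' < ennreal (m / s)"
    and sum: "ennreal (2 * m) \<le> ennreal (1 / s) * D + ennreal s * D'"
  shows "ennreal (s * m) \<le> D"
proof (cases D)
  case (real d)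
  obtain d' where d': "D' = ennreal d'" "0 \<le> d'" using D' by (cases D') auto
  have d'm: "s * d' < m" using D' d' s by (simp add: ennreal_less_iff pos_less_divide_eq mult.commute)
  have "ennreal (1 / s) * D + ennreal s * D' = ennreal (1 / s * d + s * d')"
    using s real(1) d' ennreal_mult[of "1 / s" d] ennreal_mult[of s d'] ennreal_plus[of "1 / s * d" "s * d'"]
      real(2) by (simp only: less_imp_le divide_nonneg_nonneg mult_nonneg_nonneg zero_le_one)
  then have "ennreal (2 * m) \<le> ennreal (1 / s * d + s * d')" using sum by simp
  then have "2 * m \<le> 1 / s * d + s * d'" using s real d' by (subst (asm) ennreal_le_iff) auto
  then have "m \<le> d / s" using d'm by simp
  then show ?thesis using s real by (simp add: field_simps ennreal_leI)
qed simp

text \<open>On \<open>B\<close> the arithmetic--geometric mean inequality \<open>2 \<le> R / s + s / R\<close> turns an upper bound on the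
  expectation of \<open>1 / R\<close> into a lower bound on the normalising integral.\<close>

lemma posterior_ratio_bound:
  fixes R :: "'a \<Rightarrow> 'b \<Rightarrow> real" and \<nu> :: "'a measure" and P :: "'b measure"
  assumes "prob_space P" "prob_space \<nu>"
    and Rpos: "\<And>\<theta> z. 0 < R \<theta> z"
    and [measurable]: "(\<lambda>(\<theta>, z). R \<theta> z) \<in> borel_measurable (\<nu> \<Otimes>\<^sub>M P)"
    and [measurable]: "A \<in> sets \<nu>" "B \<in> sets \<nu>" "\<And>j. S j \<in> sets \<nu>" "\<And>j. \<phi> j \<in> sets P"
    and cover: "A \<subseteq> (\<Union>j::nat. S j)"
    and \<alpha>: "\<And>j. emeasure P (\<phi> j) \<le> \<alpha> j"
    and \<beta>: "\<And>j \<theta>. \<theta> \<in> S j \<Longrightarrow> (\<integral>\<^sup>+z\<in>space P - \<phi> j. ennreal (R \<theta> z) \<partial>P) \<le> \<beta> j"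
    and \<gamma>: "\<And>j. emeasure \<nu> (S j) \<le> \<gamma> j"
    and inv: "\<And>\<theta>. \<theta> \<in> B \<Longrightarrow> (\<integral>\<^sup>+z. ennreal (1 / R \<theta> z) \<partial>P) \<le> ennreal C"
    and m: "0 < m" "ennreal m = emeasure \<nu> B" and s: "0 < s" and \<eta>: "0 < \<eta>" and C: "0 \<le> C"
  obtains E where "E \<in> sets P"
    "{z \<in> space P. ennreal \<eta> * (\<integral>\<^sup>+\<theta>. ennreal (R \<theta> z) \<partial>\<nu>) \<le> (\<integral>\<^sup>+\<theta>\<in>A. ennreal (R \<theta> z) \<partial>\<nu>)} \<subseteq> E"
    "emeasure P E \<le> (\<Sum>j. \<alpha> j) + ennreal (s * C) + ennreal (1 / (\<eta> * (s * m))) * (\<Sum>j. \<beta> j * \<gamma> j)"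
proof -
  interpret P: prob_space P by fact
  interpret \<nu>: prob_space \<nu> by fact
  interpret \<nu>P: pair_sigma_finite \<nu> P ..
  have R2[measurable]: "(\<lambda>\<omega>. R (fst \<omega>) (snd \<omega>)) \<in> borel_measurable (\<nu> \<Otimes>\<^sub>M P)"
    using assms(4) by (simp add: case_prod_beta)
  define \<Phi> where "\<Phi> = (\<Union>j. \<phi> j)"
  have [measurable]: "\<Phi> \<in> sets P" unfolding \<Phi>_def by measurable
  define D' where "D' z = (\<integral>\<^sup>+\<theta>. ennreal (1 / R \<theta> z) * indicator B \<theta> \<partial>\<nu>)" for z
  define N where "N z = (\<integral>\<^sup>+\<theta>. ennreal (R \<theta> z) * indicator A \<theta> * indicator (space P - \<Phi>) z \<partial>\<nu>)" for z
  have mD: "(\<lambda>(\<theta>, z). ennreal (1 / R \<theta> z) * indicator B \<theta>) \<in> borel_measurable (\<nu> \<Otimes>\<^sub>M P)" by measurable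
  have mN: "(\<lambda>(\<theta>, z). ennreal (R \<theta> z) * indicator A \<theta> * indicator (space P - \<Phi>) z) \<in> borel_measurable (\<nu> \<Otimes>\<^sub>M P)"
    by measurable
  have [measurable]: "D' \<in> borel_measurable P" unfolding D'_def
    by (rule \<nu>.borel_measurable_nn_integral) (use mD in \<open>simp add: measurable_split_conv measurable_pair_swap_iff[of _ P \<nu>] case_prod_beta\<close>)
  have [measurable]: "N \<in> borel_measurable P" unfolding N_def
    by (rule \<nu>.borel_measurable_nn_integral) (use mN in \<open>simp add: measurable_split_conv measurable_pair_swap_iff[of _ P \<nu>] case_prod_beta\<close>)
  \<comment> \<open>Two Markov events: on \<open>E1\<close> the integrated inverse ratio is at least
    \<open>m / s\<close>, on \<open>E2\<close> the numerator off the tests is at least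
    \<open>\<eta> * (s * m)\<close>. Off \<open>\<Phi>\<close> and \<open>E1\<close> the normalising
    integral is at least \<open>s * m\<close>, and then the posterior event forces
    \<open>E2\<close>.\<close>
  define E1 where "E1 = {z \<in> space P. 1 \<le> ennreal (s / m) * D' z}"
  define E2 where "E2 = {z \<in> space P. 1 \<le> ennreal (1 / (\<eta> * (s * m))) * N z}"
  have [measurable]: "E1 \<in> sets P" "E2 \<in> sets P" unfolding E1_def E2_def by measurable
  have Rz: "(\<lambda>\<theta>. R \<theta> z) \<in> borel_measurable \<nu>" if "z \<in> space P" for z
    using measurable_compose[OF measurable_Pair2'[OF that] R2] by simp
  show thesis
  proof (rule that[of "\<Phi> \<union> E1 \<union> E2"])
    show "\<Phi> \<union> E1 \<union> E2 \<in> sets P" by measurable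
    show "{z \<in> space P. ennreal \<eta> * (\<integral>\<^sup>+\<theta>. ennreal (R \<theta> z) \<partial>\<nu>) \<le> (\<integral>\<^sup>+\<theta>\<in>A. ennreal (R \<theta> z) \<partial>\<nu>)} \<subseteq> \<Phi> \<union> E1 \<union> E2"
    proof
      fix z assume "z \<in> {z \<in> space P. ennreal \<eta> * (\<integral>\<^sup>+\<theta>. ennreal (R \<theta> z) \<partial>\<nu>) \<le> (\<integral>\<^sup>+\<theta>\<in>A. ennreal (R \<theta> z) \<partial>\<nu>)}"
      then have z: "z \<in> space P"
        and le: "ennreal \<eta> * (\<integral>\<^sup>+\<theta>. ennreal (R \<theta> z) \<partial>\<nu>) \<le> (\<integral>\<^sup>+\<theta>\<in>A. ennreal (R \<theta> z) \<partial>\<nu>)" by auto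
      note [measurable] = Rz[OF z]
      show "z \<in> \<Phi> \<union> E1 \<union> E2"
      proof (rule ccontr)
        assume no: "z \<notin> \<Phi> \<union> E1 \<union> E2"
        have "ennreal (s / m) * D' z < 1" using no z by (auto simp: E1_def not_le)
        have D'lt: "D' z < ennreal (m / s)"
        proof (cases "D' z")
          case (real d)
          then show ?thesis using \<open>ennreal (s / m) * D' z < 1\<close> s m
            by (simp add: ennreal_mult[symmetric] ennreal_less_iff field_simps
                ennreal_1[symmetric] del: ennreal_1)
        next
          case top
          then show ?thesis using \<open>ennreal (s / m) * D' z < 1\<close> s m by (simp add: ennreal_mult_top)
        qed
        let ?D = "\<integral>\<^sup>+\<theta>. ennreal (R \<theta> z) * indicator B \<theta> \<partial>\<nu>"
        have "ennreal (2 * m) = ennreal 2 * emeasure \<nu> B" using m by (simp add: ennreal_mult)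
        also have "\<dots> = (\<integral>\<^sup>+\<theta>. ennreal 2 * indicator B \<theta> \<partial>\<nu>)"
          by (rule nn_integral_cmult_indicator[symmetric]) measurable
        also have "\<dots> \<le> (\<integral>\<^sup>+\<theta>. ennreal (1 / s) * (ennreal (R \<theta> z) * indicator B \<theta>) +
            ennreal s * (ennreal (1 / R \<theta> z) * indicator B \<theta>) \<partial>\<nu>)"
        proof (rule nn_integral_mono)
          fix \<theta>
          have "0 \<le> (R \<theta> z - s)\<^sup>2 / (s * R \<theta> z)" using s Rpos[of \<theta> z] by simp
          then have "2 \<le> 1 / s * R \<theta> z + s * (1 / R \<theta> z)"
            using s Rpos[of \<theta> z] by (simp add: field_simps power2_eq_square)
          then have "ennreal 2 \<le> ennreal (1 / s * R \<theta> z + s * (1 / R \<theta> z))" by (rule ennreal_leI)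
          also have "\<dots> = ennreal (1 / s) * ennreal (R \<theta> z) + ennreal s * ennreal (1 / R \<theta> z)"
            using s Rpos[of \<theta> z] by (simp add: ennreal_mult[symmetric] ennreal_plus[symmetric] del: ennreal_plus)
          finally show "ennreal 2 * indicator B \<theta> \<le> ennreal (1 / s) * (ennreal (R \<theta> z) * indicator B \<theta>) +
            ennreal s * (ennreal (1 / R \<theta> z) * indicator B \<theta>)"
            by (cases "\<theta> \<in> B") auto
        qed
        also have "\<dots> = ennreal (1 / s) * ?D + ennreal s * D' z"
          unfolding D'_def by (subst nn_integral_add) (auto simp: nn_integral_cmult)
        finally have "ennreal (s * m) \<le> ?D" by (rule ennreal_evidence_lower[OF s m(1) D'lt])
        also have "?D \<le> (\<integral>\<^sup>+\<theta>. ennreal (R \<theta> z) \<partial>\<nu>)"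
          by (intro nn_integral_mono) (auto split: split_indicator)
        finally have "ennreal \<eta> * ennreal (s * m) \<le> ennreal \<eta> * (\<integral>\<^sup>+\<theta>. ennreal (R \<theta> z) \<partial>\<nu>)"
          by (rule mult_left_mono) simp
        also note le
        also have "(\<integral>\<^sup>+\<theta>\<in>A. ennreal (R \<theta> z) \<partial>\<nu>) = N z"
          unfolding N_def using no z by (intro nn_integral_cong) auto
        finally have "ennreal (1 / (\<eta> * (s * m))) * (ennreal \<eta> * ennreal (s * m)) \<le> ennreal (1 / (\<eta> * (s * m))) * N z"
          by (rule mult_left_mono) simp
        moreover have "ennreal (1 / (\<eta> * (s * m))) * (ennreal \<eta> * ennreal (s * m)) = 1"
        proof -
          have "ennreal (1 / (\<eta> * (s * m))) * (ennreal \<eta> * ennreal (s * m)) = ennreal (1 / (\<eta> * (s * m)) * (\<eta> * (s * m)))"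
            using \<eta> s m by (simp only: ennreal_mult[symmetric] less_imp_le mult_nonneg_nonneg divide_nonneg_nonneg zero_le_one)
          then show ?thesis using \<eta> s m by simp
        qed
        ultimately show False using no z by (auto simp: E2_def)
      qed
    qed
    have "emeasure P \<Phi> \<le> (\<Sum>j. emeasure P (\<phi> j))"
      unfolding \<Phi>_def by (rule emeasure_subadditive_countably) auto
    also have "\<dots> \<le> (\<Sum>j. \<alpha> j)" by (intro suminf_le \<alpha>) auto
    finally have 1: "emeasure P \<Phi> \<le> (\<Sum>j. \<alpha> j)" .
    have "emeasure P E1 \<le> ennreal (s / m) * (\<integral>\<^sup>+z\<in>space P. D' z \<partial>P)"
      unfolding E1_def by (rule nn_integral_Markov_inequality) auto
    also have "(\<integral>\<^sup>+z\<in>space P. D' z \<partial>P) = (\<integral>\<^sup>+z. D' z \<partial>P)"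
      by (intro nn_integral_cong) simp
    also have "\<dots> = (\<integral>\<^sup>+\<theta>. \<integral>\<^sup>+z. ennreal (1 / R \<theta> z) * indicator B \<theta> \<partial>P \<partial>\<nu>)"
      unfolding D'_def by (rule \<nu>P.Fubini'[OF mD])
    also have "\<dots> \<le> (\<integral>\<^sup>+\<theta>. ennreal C * indicator B \<theta> \<partial>\<nu>)"
      by (intro nn_integral_mono) (auto simp: inv split: split_indicator)
    also have "\<dots> = ennreal C * ennreal m" by (simp add: nn_integral_cmult_indicator m)
    also have "ennreal (s / m) * (ennreal C * ennreal m) = ennreal (s * C)"
      using s m(1) C by (simp add: ennreal_mult[symmetric])
    finally have 2: "emeasure P E1 \<le> ennreal (s * C)" by (simp add: mult_left_mono)
    have "emeasure P E2 \<le> ennreal (1 / (\<eta> * (s * m))) * (\<integral>\<^sup>+z\<in>space P. N z \<partial>P)"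
      unfolding E2_def by (rule nn_integral_Markov_inequality) auto
    also have "(\<integral>\<^sup>+z\<in>space P. N z \<partial>P) = (\<integral>\<^sup>+z. N z \<partial>P)"
      by (intro nn_integral_cong) simp
    also have "\<dots> = (\<integral>\<^sup>+\<theta>. \<integral>\<^sup>+z. ennreal (R \<theta> z) * indicator A \<theta> * indicator (space P - \<Phi>) z \<partial>P \<partial>\<nu>)"
      unfolding N_def by (rule \<nu>P.Fubini'[OF mN])
    also have "\<dots> \<le> (\<integral>\<^sup>+\<theta>. (\<Sum>j. \<beta> j * indicator (S j) \<theta>) \<partial>\<nu>)"
    proof (rule nn_integral_mono)
      fix \<theta>
      show "(\<integral>\<^sup>+z. ennreal (R \<theta> z) * indicator A \<theta> * indicator (space P - \<Phi>) z \<partial>P) \<le> (\<Sum>j. \<beta> j * indicator (S j) \<theta>)"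
      proof (cases "\<theta> \<in> A")
        case True
        \<comment> \<open>Only the test of one set \<open>S i\<close> containing the parameter is
          used; removing the other rejection regions as well can only lower the integral.\<close>
        then obtain i where i: "\<theta> \<in> S i" using cover by auto
        have "(\<integral>\<^sup>+z. ennreal (R \<theta> z) * indicator A \<theta> * indicator (space P - \<Phi>) z \<partial>P) \<le>
            (\<integral>\<^sup>+z\<in>space P - \<phi> i. ennreal (R \<theta> z) \<partial>P)"
          using True by (intro nn_integral_mono) (auto simp: \<Phi>_def split: split_indicator)
        also have "\<dots> \<le> \<beta> i" by (rule \<beta>[OF i])
        also have "\<dots> = (\<Sum>j\<in>{i}. \<beta> j * indicator (S j) \<theta>)" using i by simp
        also have "\<dots> \<le> (\<Sum>j. \<beta> j * indicator (S j) \<theta>)" by (rule sum_le_suminf) auto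
        finally show ?thesis .
      qed simp
    qed
    also have "\<dots> = (\<Sum>j. \<beta> j * emeasure \<nu> (S j))"
      by (subst nn_integral_suminf) (auto simp: nn_integral_cmult_indicator)
    also have "\<dots> \<le> (\<Sum>j. \<beta> j * \<gamma> j)" by (intro suminf_le mult_left_mono \<gamma>) auto
    finally have 3: "emeasure P E2 \<le> ennreal (1 / (\<eta> * (s * m))) * (\<Sum>j. \<beta> j * \<gamma> j)" by (simp add: mult_left_mono)
    have "emeasure P (\<Phi> \<union> E1 \<union> E2) \<le> emeasure P \<Phi> + emeasure P E1 + emeasure P E2"
      by (rule order_trans[OF emeasure_subadditive add_right_mono[OF emeasure_subadditive]]) auto
    also have "\<dots> \<le> (\<Sum>j. \<alpha> j) + ennreal (s * C) + ennreal (1 / (\<eta> * (s * m))) * (\<Sum>j. \<beta> j * \<gamma> j)"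
      by (intro add_mono 1 2 3)
    finally show "emeasure P (\<Phi> \<union> E1 \<union> E2) \<le>
      (\<Sum>j. \<alpha> j) + ennreal (s * C) + ennreal (1 / (\<eta> * (s * m))) * (\<Sum>j. \<beta> j * \<gamma> j)" .
  qed
qed

section \<open>Summation over shells, combined tests and the rate\<close>

text \<open>One term of the exponential series absorbs the power into
  \<open>exp (c / 2 * (j + 1))\<close>, and \<open>j\<close> is at most its square; the remaining
  decay is geometric with ratio \<open>exp (- (c / 2))\<close>.\<close>

lemma summable_power_times_exp_neg_square:
  fixes c :: real
  assumes c: "0 < c"
  shows "summable (\<lambda>j. (real j + 1) ^ D * exp (- (c * (real j)\<^sup>2)))"
proof (rule summable_comparison_test')
  let ?K = "fact D * (2 / c) ^ D * exp (c / 2)"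
  show "summable (\<lambda>j. ?K * exp (- (c / 2)) ^ j)"
    using c by (intro summable_mult summable_geometric) simp
  fix j :: nat assume "0 \<le> j"
  define x where "x = c / 2 * (real j + 1)"
  have x: "0 \<le> x" using c by (simp add: x_def)
  have "x ^ D / fact D \<le> exp x"
  proof -
    have "(\<lambda>n. x ^ n / fact n) sums exp x" using exp_converges[of x] by (simp add: field_simps)
    then show ?thesis
      using sum_le_suminf[of "\<lambda>n. x ^ n / fact n" "{D}"] x by (simp add: sums_iff)
  qed
  then have xD: "x ^ D \<le> fact D * exp x" by (simp add: field_simps)
  have "real j + 1 = 2 / c * x" using c by (simp add: x_def)
  then have "(real j + 1) ^ D = (2 / c) ^ D * x ^ D" by (simp only: power_mult_distrib)
  also have "\<dots> \<le> (2 / c) ^ D * (fact D * exp x)" using xD c by (intro mult_left_mono) auto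
  finally have 1: "(real j + 1) ^ D \<le> (2 / c) ^ D * (fact D * exp x)" .
  have "real j \<le> (real j)\<^sup>2" by (cases j) (auto simp: power2_eq_square)
  then have 2: "exp (- (c * (real j)\<^sup>2)) \<le> exp (- (c * real j))" using c by simp
  have "(real j + 1) ^ D * exp (- (c * (real j)\<^sup>2)) \<le> ((2 / c) ^ D * (fact D * exp x)) * exp (- (c * real j))"
    using 1 2 c by (intro mult_mono) auto
  also have "\<dots> = ?K * exp (- (c / 2)) ^ j"
  proof -
    have "exp x * exp (- (c * real j)) = exp (c / 2) * exp (- (c / 2)) ^ j"
      by (simp add: x_def exp_add[symmetric] exp_of_nat_mult[symmetric] field_simps)
    then show ?thesis by (simp add: mult_ac)
  qed
  finally show "norm ((real j + 1) ^ D * exp (- (c * (real j)\<^sup>2))) \<le> ?K * exp (- (c / 2)) ^ j"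
    using c by simp
qed

text \<open>Rejecting when any interval test rejects adds up the first error probabilities, while a
  missed alternative is charged to the one interval that detects it. Both kinds of interval have
  \<open>(u - l) * b\<^sup>2\<close> of order \<open>r\<^sup>2\<close>: cells have fixed length and
  \<open>b\<close> of order \<open>r\<close>, intervals at change-points have length of order
  \<open>r\<^sup>2\<close> and fixed \<open>b\<close>.\<close>

lemma step_fun_tests:
  assumes \<delta>: "0 < \<delta>" and K: "0 < K"
    and \<theta>0: "(k0, a0, t0) \<in> Theta kmax K \<delta>"
    and J: "0 < J" "\<And>i. i \<in> {1..<k0} \<Longrightarrow> J \<le> \<bar>a0 (i + 1) - a0 i\<bar>"
  defines "f0 \<equiv> step_fun (k0, a0, t0)"
  obtains c G where "0 < c" "0 \<le> G" "\<And>n r. 0 < r \<Longrightarrow> \<exists>\<phi>\<in>sets (sample_law n f0).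
    emeasure (sample_law n f0) \<phi> \<le> ennreal (G * exp (- (c * (n * r\<^sup>2)))) \<and>
    (\<forall>\<theta>\<in>Theta kmax K \<delta>. r \<le> L2_norm (\<lambda>x. step_fun \<theta> x - f0 x) \<longrightarrow>
      (\<integral>\<^sup>+z\<in>space (sample_law n f0) - \<phi>. ennreal (lik_ratio n f0 (step_fun \<theta>) z) \<partial>sample_law n f0)
        \<le> ennreal (exp (- (c * (n * r\<^sup>2)))))"
proof -
  have f0: "f0 \<in> borel_measurable borel" by (simp add: f0_def)
  have k0: "k0 \<ge> 1" using \<theta>0 by (simp add: Theta_iff)
  obtain N :: nat where N: "4 / \<delta> < real N" using reals_Archimedean2 by blast
  have "0 < 4 / \<delta>" using \<delta> by simp
  then have "0 < real N" using N by linarith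
  then have N0: "N > 0" "4 / real N \<le> \<delta>" using N \<delta> by (simp_all add: divide_less_eq divide_le_eq mult.commute)
  \<comment> \<open>For \<open>r \<le> 2 * K\<close> the second bound gives
    \<open>c1 * r \<le> J / 2\<close>, as the detection lemma requires; the first gives
    \<open>c1 * r \<le> K\<close>.\<close>
  define c1 where "c1 = min (1 / 2) (J / (4 * K))"
  have c1: "0 < c1" "c1 \<le> 1 / 2" "c1 \<le> J / (4 * K)" using J K by (auto simp: c1_def)
  \<comment> \<open>Every \<open>b\<close> that occurs is at most \<open>K\<close> or equal to
    \<open>J / 2\<close>, so this achieves \<open>\<kappa> * b\<^sup>2 \<le> 1 / 4\<close> for all
    intervals at once.\<close>
  define \<kappa> where "\<kappa> = min (1 / 4) (1 / (4 * (K\<^sup>2 + J\<^sup>2)))"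
  have KJ: "0 < K\<^sup>2 + J\<^sup>2" using K by (simp add: add_pos_nonneg)
  have \<kappa>: "0 < \<kappa>" "\<kappa> \<le> 1 / 4" "\<kappa> * (K\<^sup>2 + J\<^sup>2) \<le> 1 / 4"
  proof -
    show "0 < \<kappa>" "\<kappa> \<le> 1 / 4" using KJ by (auto simp: \<kappa>_def)
    have "\<kappa> * (K\<^sup>2 + J\<^sup>2) \<le> 1 / (4 * (K\<^sup>2 + J\<^sup>2)) * (K\<^sup>2 + J\<^sup>2)"
      using KJ by (intro mult_right_mono) (auto simp: \<kappa>_def)
    also have "\<dots> = 1 / 4"
      using nonzero_mult_divide_mult_cancel_right[of "K\<^sup>2 + J\<^sup>2" 1 4] KJ by simp
    finally show "\<kappa> * (K\<^sup>2 + J\<^sup>2) \<le> 1 / 4" .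
  qed
  \<comment> \<open>The smaller of the two values of \<open>(u - l) * b\<^sup>2 / r\<^sup>2\<close>,
    for cells and for intervals at change-points; 128 is the 32 of \<open>w\<close> times the 4 from
    squaring \<open>J / 2\<close>.\<close>
  define q where "q = min (c1\<^sup>2 / N) (J\<^sup>2 / (128 * k0 * K\<^sup>2))"
  have q: "0 < q" using c1 N0 J K k0 by (simp add: q_def)
  define c where "c = \<kappa> / 8 * q"
  have c0: "0 < c" using \<kappa> q by (simp add: c_def)
  \<comment> \<open>The factor 2 counts the two signs per interval.\<close>
  define G where "G = 2 * (real N + k0 + k0)"
  show thesis
  proof (rule that[OF c0])
    show "0 \<le> G" by (simp add: G_def)
    fix n :: nat and r :: real assume r: "0 < r"
    let ?P = "sample_law n f0"
    define e where "e = ennreal (exp (- (c * (n * r\<^sup>2))))"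
    show "\<exists>\<phi>\<in>sets ?P. emeasure ?P \<phi> \<le> ennreal (G * exp (- (c * (n * r\<^sup>2)))) \<and>
      (\<forall>\<theta>\<in>Theta kmax K \<delta>. r \<le> L2_norm (\<lambda>x. step_fun \<theta> x - f0 x) \<longrightarrow>
        (\<integral>\<^sup>+z\<in>space ?P - \<phi>. ennreal (lik_ratio n f0 (step_fun \<theta>) z) \<partial>?P) \<le> ennreal (exp (- (c * (n * r\<^sup>2)))))"
    proof (cases "r \<le> 2 * K")
      \<comment> \<open>Two functions bounded by \<open>K\<close> are at distance at most
        \<open>2 * K\<close>, so there is no alternative to detect and the empty rejection region
        will do.\<close>
      case False
      have "\<not> r \<le> L2_norm (\<lambda>x. step_fun \<theta> x - f0 x)" if "\<theta> \<in> Theta kmax K \<delta>" for \<theta>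
      proof -
        obtain k a t where \<theta>: "\<theta> = (k, a, t)" by (cases \<theta>)
        have "(L2_norm (\<lambda>x. step_fun \<theta> x - f0 x))\<^sup>2 \<le> (2 * K)\<^sup>2 + 0 * (\<Sum>i\<in>{}. 0 - 0)"
        proof (rule L2_norm_power2_le)
          fix x :: real assume x: "x \<in> {0..<1}"
          have "\<bar>step_fun \<theta> x - f0 x\<bar> \<le> 2 * K"
            using Theta_step_fun_abs_le[OF that[unfolded \<theta>] \<delta> x] Theta_step_fun_abs_le[OF \<theta>0 \<delta> x]
            unfolding f0_def \<theta> by linarith
          then have "\<bar>step_fun \<theta> x - f0 x\<bar>\<^sup>2 \<le> (2 * K)\<^sup>2" by (intro power_mono) auto
          then show "(step_fun \<theta> x - f0 x)\<^sup>2 \<le> (2 * K)\<^sup>2 + 0 * (\<Sum>i\<in>{}. indicator {0..<0} x)" by simp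
        qed auto
        then have "L2_norm (\<lambda>x. step_fun \<theta> x - f0 x) \<le> 2 * K" 
          using power2_le_imp_le[of "L2_norm (\<lambda>x. step_fun \<theta> x - f0 x)" "2 * K"] K by simp
        then show ?thesis using False by simp
      qed
      then show ?thesis by (intro bexI[of _ "{}"]) auto
    next
      case True
      define w where "w = r\<^sup>2 / (32 * k0 * K\<^sup>2)"
      define F where "F = test_intervals N c1 J k0 t0 w r"
      have c1r: "c1 * r \<le> J / 2"
      proof -
        have "c1 * r \<le> J / (4 * K) * (2 * K)" using c1 True r J K by (intro mult_mono) auto
        then show ?thesis using K by simp
      qed
      have Fprop: "0 < b \<and> \<kappa> * b\<^sup>2 \<le> 1 / 4 \<and> q * r\<^sup>2 \<le> (u - l) * b\<^sup>2" if "(l, u, b) \<in> F" for l u b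
      proof -
        have "b = c1 * r \<and> u - l = 1 / N \<or> b = J / 2 \<and> u - l = w"
          using that N0 unfolding F_def test_intervals_def by (auto simp: field_simps)
        then show ?thesis
        proof (elim disjE conjE)
          assume b: "b = c1 * r" and ul: "u - l = 1 / N"
          have "c1 * r \<le> 1 / 2 * (2 * K)" using c1 True r by (intro mult_mono) auto
          then have "b\<^sup>2 \<le> K\<^sup>2" using b c1 r by (intro power_mono) auto
          then have "\<kappa> * b\<^sup>2 \<le> \<kappa> * (K\<^sup>2 + J\<^sup>2)" using \<kappa> by (intro mult_left_mono) (auto intro: add_increasing2)
          then have "\<kappa> * b\<^sup>2 \<le> 1 / 4" using \<kappa>(3) by linarith
          moreover have "q * r\<^sup>2 \<le> c1\<^sup>2 / N * r\<^sup>2" by (intro mult_right_mono) (auto simp: q_def)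
          ultimately show ?thesis using \<kappa> b ul c1 r by (simp add: power_mult_distrib)
        next
          assume b: "b = J / 2" and ul: "u - l = w"
          have "b\<^sup>2 \<le> J\<^sup>2" using b J by (intro power_mono) auto
          then have "\<kappa> * b\<^sup>2 \<le> \<kappa> * (K\<^sup>2 + J\<^sup>2)" using \<kappa> by (intro mult_left_mono) (auto intro: add_increasing)
          then have "\<kappa> * b\<^sup>2 \<le> 1 / 4" using \<kappa>(3) by linarith
          moreover have "q * r\<^sup>2 \<le> J\<^sup>2 / (128 * k0 * K\<^sup>2) * r\<^sup>2" by (intro mult_right_mono) (auto simp: q_def)
          moreover have "(u - l) * b\<^sup>2 = J\<^sup>2 / (128 * k0 * K\<^sup>2) * r\<^sup>2"
            unfolding ul b w_def power_divide by (simp add: mult_ac)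
          moreover have "0 < b" using b J by simp
          ultimately show ?thesis by simp
        qed
      qed
      \<comment> \<open>Intervals next to a change-point may leave [0, 1]; the detection lemma
        returns only those inside.\<close>
      define V where "V = {((l, u, b), s) \<in> F \<times> {1, -1 :: real}. 0 \<le> l \<and> l \<le> u \<and> u \<le> 1}"
      have "V \<subseteq> F \<times> {1, -1}" by (auto simp: V_def)
      then have V: "finite V" "card V \<le> card (F \<times> {1, -1 :: real})"
        using card_mono[of "F \<times> {1, -1 :: real}" V] by (auto simp: F_def simp del: card_cartesian_product intro: finite_subset)
      have "card (F \<times> {1, -1 :: real}) = card F * 2" by (simp add: card_cartesian_product)
      then have cardV: "real (card V) \<le> G"
        using V card_test_intervals_le[of N c1 J k0 t0 w r] by (simp add: G_def F_def)
      have "\<exists>\<phi>. \<phi> \<in> sets ?P \<and> emeasure ?P \<phi> \<le> e \<and> (\<forall>f. f \<in> borel_measurable borel \<longrightarrow>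
          (\<forall>x. l \<le> x \<longrightarrow> x < u \<longrightarrow> b \<le> s * (f x - f0 x)) \<longrightarrow>
          (\<integral>\<^sup>+z\<in>space ?P - \<phi>. ennreal (lik_ratio n f0 f z) \<partial>?P) \<le> e)" if v: "((l, u, b), s) \<in> V" for l u b s
      proof -
        have lu: "0 \<le> l" "l \<le> u" "u \<le> 1" "s \<in> {1, -1}" and F: "(l, u, b) \<in> F" using v by (auto simp: V_def)
        have b: "0 < b" "\<kappa> * b\<^sup>2 \<le> 1 / 4" "q * r\<^sup>2 \<le> (u - l) * b\<^sup>2" using Fprop[OF F] by auto
        have "\<kappa> * n / 8 * (q * r\<^sup>2) \<le> \<kappa> * n / 8 * ((u - l) * b\<^sup>2)"
          using b \<kappa> by (intro mult_left_mono) auto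
        then have le: "ennreal (exp (- (\<kappa> * n * (u - l) * b\<^sup>2 / 8))) \<le> e"
          unfolding e_def c_def by (intro ennreal_leI) (simp add: mult_ac)
        show ?thesis
        proof (rule interval_test[OF f0 lu(1-3) b(1) lu(4) \<kappa>(1,2) b(2), of n])
          fix \<phi> assume \<phi>: "\<phi> \<in> sets ?P" "emeasure ?P \<phi> \<le> ennreal (exp (- (\<kappa> * n * (u - l) * b\<^sup>2 / 8)))"
            and miss: "\<And>f. f \<in> borel_measurable borel \<Longrightarrow> (\<And>x. l \<le> x \<Longrightarrow> x < u \<Longrightarrow> b \<le> s * (f x - f0 x)) \<Longrightarrow>
            (\<integral>\<^sup>+z\<in>space ?P - \<phi>. ennreal (lik_ratio n f0 f z) \<partial>?P) \<le> ennreal (exp (- (\<kappa> * n * (u - l) * b\<^sup>2 / 8)))"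
          show ?thesis
          proof (intro exI[of _ \<phi>] conjI allI impI)
            show "emeasure ?P \<phi> \<le> e" using \<phi>(2) le by (rule order_trans)
            fix f :: "real \<Rightarrow> real"
            assume "f \<in> borel_measurable borel" "\<forall>x. l \<le> x \<longrightarrow> x < u \<longrightarrow> b \<le> s * (f x - f0 x)"
            then show "(\<integral>\<^sup>+z\<in>space ?P - \<phi>. ennreal (lik_ratio n f0 f z) \<partial>?P) \<le> e"
              by (intro order_trans[OF miss le]) auto
          qed (rule \<phi>(1))
        qed
      qed
      then have "\<forall>v\<in>V. \<exists>\<phi>. \<phi> \<in> sets ?P \<and> emeasure ?P \<phi> \<le> e \<and> (\<forall>f. f \<in> borel_measurable borel \<longrightarrow>
          (\<forall>x. fst (fst v) \<le> x \<longrightarrow> x < fst (snd (fst v)) \<longrightarrow> snd (snd (fst v)) \<le> snd v * (f x - f0 x)) \<longrightarrow>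
          (\<integral>\<^sup>+z\<in>space ?P - \<phi>. ennreal (lik_ratio n f0 f z) \<partial>?P) \<le> e)"
        by (simp only: Ball_def split_paired_All fst_conv snd_conv) simp
      from bchoice[OF this] obtain \<phi> where \<phi>: "\<forall>v\<in>V. \<phi> v \<in> sets ?P \<and> emeasure ?P (\<phi> v) \<le> e \<and>
          (\<forall>f. f \<in> borel_measurable borel \<longrightarrow>
          (\<forall>x. fst (fst v) \<le> x \<longrightarrow> x < fst (snd (fst v)) \<longrightarrow> snd (snd (fst v)) \<le> snd v * (f x - f0 x)) \<longrightarrow>
          (\<integral>\<^sup>+z\<in>space ?P - \<phi> v. ennreal (lik_ratio n f0 f z) \<partial>?P) \<le> e)" by (elim exE) (rule that)
      show ?thesis
      proof (intro bexI[of _ "\<Union>v\<in>V. \<phi> v"] conjI ballI impI)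
        show "(\<Union>v\<in>V. \<phi> v) \<in> sets ?P" using \<phi> V by (intro sets.finite_UN) auto
        have "emeasure ?P (\<Union>v\<in>V. \<phi> v) \<le> (\<Sum>v\<in>V. emeasure ?P (\<phi> v))"
          using \<phi> V by (intro emeasure_subadditive_finite) auto
        also have "\<dots> \<le> (\<Sum>v\<in>V. e)" using \<phi> by (intro sum_mono) auto
        also have "\<dots> = ennreal (card V * exp (- (c * (n * r\<^sup>2))))"
          by (simp add: e_def ennreal_mult' ennreal_of_nat_eq_real_of_nat)
        also have "\<dots> \<le> ennreal (G * exp (- (c * (n * r\<^sup>2))))"
          using cardV by (intro ennreal_leI mult_right_mono) auto
        finally show "emeasure ?P (\<Union>v\<in>V. \<phi> v) \<le> ennreal (G * exp (- (c * (n * r\<^sup>2))))" .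
        fix \<theta> assume \<theta>: "\<theta> \<in> Theta kmax K \<delta>" and far: "r \<le> L2_norm (\<lambda>x. step_fun \<theta> x - f0 x)"
        obtain k a t where kat: "\<theta> = (k, a, t)" by (cases \<theta>)
        let ?W = "\<Union>v\<in>V. \<phi> v"
        show "(\<integral>\<^sup>+z\<in>space ?P - ?W. ennreal (lik_ratio n f0 (step_fun \<theta>) z) \<partial>?P)
          \<le> ennreal (exp (- (c * (n * r\<^sup>2))))"
        proof (rule step_difference_detection[OF \<delta> K \<theta>[unfolded kat] \<theta>0 J(2) less_imp_le[OF c1(1)] c1(2) c1r
              N0 r far[unfolded kat f0_def] w_def])
          fix l u b s
          assume lub: "(l, u, b) \<in> test_intervals N c1 J k0 t0 w r" "0 \<le> l" "l \<le> u" "u \<le> 1" "s \<in> {1, -1}"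
            and h: "\<And>x. l \<le> x \<Longrightarrow> x < u \<Longrightarrow> b \<le> s * (step_fun (k, a, t) x - step_fun (k0, a0, t0) x)"
          have v: "((l, u, b), s) \<in> V" using lub by (auto simp: V_def F_def)
          have "(\<integral>\<^sup>+z\<in>space ?P - ?W. ennreal (lik_ratio n f0 (step_fun \<theta>) z) \<partial>?P) \<le>
              (\<integral>\<^sup>+z\<in>space ?P - \<phi> ((l, u, b), s). ennreal (lik_ratio n f0 (step_fun \<theta>) z) \<partial>?P)"
            using v by (intro nn_integral_mono) (auto split: split_indicator)
          also have "\<dots> \<le> e" using bspec[OF \<phi> v] h by (simp add: kat f0_def)
          finally show ?thesis by (simp add: e_def)
        qed
      qed
    qed
  qed
qed

theorem theorem3:
  fixes kmax k0 :: nat and K \<delta> :: real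
    and p :: "nat \<Rightarrow> real"
    and \<pi>a :: "nat \<Rightarrow> (nat \<Rightarrow> real) \<Rightarrow> (nat \<Rightarrow> real) \<Rightarrow> real"
    and \<pi>t :: "nat \<Rightarrow> (nat \<Rightarrow> real) \<Rightarrow> real"
    and a0 t0 :: "nat \<Rightarrow> real"
    and M :: "nat \<Rightarrow> real"
  assumes "kmax \<ge> 1" and "K > 0" and "\<delta> > 0"
    and "(k0, a0, t0) \<in> Theta kmax K \<delta>"
    and "\<And>j. j \<in> {2..k0} \<Longrightarrow> a0 j \<noteq> a0 (j - 1)"
    and "\<And>k. k \<in> {1..kmax} \<Longrightarrow> p k > 0"
    and "(\<Sum>k=1..kmax. p k) = 1"
    and "\<And>k. k \<in> {1..kmax} \<Longrightarrow> prior_densities K \<delta> k (\<pi>a k) (\<pi>t k)"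
    and "\<And>k. k \<in> {1..kmax} \<Longrightarrow> prior_bounds K \<delta> k (\<pi>a k) (\<pi>t k)"
    and "filterlim M at_top sequentially"
  defines "f0 \<equiv> step_fun (k0, a0, t0)"
    and "\<nu> \<equiv> prior kmax K \<delta> p \<pi>a \<pi>t"
  shows "\<forall>\<eta>>0. (\<lambda>n. measure (sample_law n f0)
      {z \<in> space (sample_law n f0).
        posterior \<nu> n z
          {\<theta> \<in> Theta kmax K \<delta>. L2_norm (\<lambda>x. step_fun \<theta> x - f0 x) > M n * (1 / sqrt (real n))} > \<eta>})
    \<longlonglongrightarrow> 0"
proof (intro allI impI LIMSEQ_I)
  fix \<eta> e :: real assume \<eta>: "0 < \<eta>" and e: "0 < e"
  let ?D = "k0 + 2 * (k0 - 1)"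
  let ?d = "\<lambda>\<theta>. L2_norm (\<lambda>x. step_fun \<theta> x - f0 x)"
  note K = \<open>K > 0\<close> and \<delta> = \<open>\<delta> > 0\<close> and \<theta>0 = \<open>(k0, a0, t0) \<in> Theta kmax K \<delta>\<close>
  have k0: "k0 \<in> {1..kmax}" using \<theta>0 by (simp add: Theta_iff)
  have f0[measurable]: "f0 \<in> borel_measurable borel" by (simp add: f0_def)
  interpret \<nu>: prob_space \<nu> unfolding \<nu>_def by (rule prob_space_prior[OF assms(6,7,8)])
  have sets_\<nu>[measurable_cong]: "sets \<nu> = sets param_space" by (simp add: \<nu>_def)
  \<comment> \<open>Inserting 1 keeps the minimum meaningful when \<open>k0 = 1\<close> and there is
    no jump.\<close>
  define J where "J = Min (insert 1 ((\<lambda>i. \<bar>a0 (i + 1) - a0 i\<bar>) ` {1..<k0}))"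
  have J: "0 < J"
  proof -
    have "\<bar>a0 (i + 1) - a0 i\<bar> > 0" if "i \<in> {1..<k0}" for i
      using assms(5)[of "i + 1"] that by auto
    then show ?thesis by (auto simp: J_def)
  qed
  have J_le: "J \<le> \<bar>a0 (i + 1) - a0 i\<bar>" if "i \<in> {1..<k0}" for i
    unfolding J_def using that by (intro Min_le) auto
  obtain c G where c: "0 < c" and G: "0 \<le> G" and tests: "\<And>n r. 0 < r \<Longrightarrow> \<exists>\<phi>\<in>sets (sample_law n f0).
      emeasure (sample_law n f0) \<phi> \<le> ennreal (G * exp (- (c * (n * r\<^sup>2)))) \<and>
      (\<forall>\<theta>\<in>Theta kmax K \<delta>. r \<le> ?d \<theta> \<longrightarrow>
        (\<integral>\<^sup>+z\<in>space (sample_law n f0) - \<phi>. ennreal (lik_ratio n f0 (step_fun \<theta>) z) \<partial>sample_law n f0)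
          \<le> ennreal (exp (- (c * (n * r\<^sup>2)))))"
  proof (rule step_fun_tests[OF \<delta> K \<theta>0 J J_le, folded f0_def], goal_cases)
    case 2
    show ?case by (rule 2(1)[OF 2(2-)])
  qed
  obtain C1 where C1: "0 \<le> C1" and ball: "\<And>r. 0 < r \<Longrightarrow>
      emeasure \<nu> {\<theta> \<in> Theta kmax K \<delta>. ?d \<theta> < r} \<le> ennreal (C1 * r ^ ?D)"
  proof (rule prior_ball_le[where p = p and \<pi>a = \<pi>a and \<pi>t = \<pi>t, OF \<delta> K \<theta>0 J J_le assms(6,8,9), folded f0_def], goal_cases)
    case 5
    show ?case by (rule 5(1)[OF 5(2-)[folded \<nu>_def]])
  qed
  obtain c0 where c0: "0 < c0" and nbhd: "\<And>\<epsilon>. 0 < \<epsilon> \<Longrightarrow> \<epsilon> \<le> 1 \<Longrightarrow> \<exists>B\<in>sets param_space. B \<subseteq> Theta kmax K \<delta> \<and>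
      ennreal (c0 * \<epsilon> ^ ?D) \<le> emeasure \<nu> B \<and> (\<forall>\<theta>\<in>B. (?d \<theta>)\<^sup>2 \<le> (1 + 8 * K\<^sup>2 * k0) * \<epsilon>\<^sup>2)"
  proof (rule prior_neighbourhood_ge[where p = p and \<pi>a = \<pi>a and \<pi>t = \<pi>t, OF \<delta> K \<theta>0 assms(6)[OF k0] assms(8)[OF k0] assms(9)[OF k0], folded f0_def],
      goal_cases)
    case 1
    show ?case by (rule 1(1)[OF 1(2-)[folded \<nu>_def]])
  qed
  \<comment> \<open>The bound on the expected inverse ratio with \<open>B = 2 * K\<close>, on a
    neighbourhood where n times the squared distance is at most
    \<open>1 + 8 * K\<^sup>2 * k0\<close>.\<close>
  define C2 where "C2 = exp (exp ((2 * K)\<^sup>2) * (1 + 8 * K\<^sup>2 * k0))"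
  have C2: "0 < C2" by (simp add: C2_def)
  \<comment> \<open>The normalising integral is then too small with probability at most
    \<open>e / 3\<close>, strictly less than \<open>e / 2\<close>.\<close>
  define s where "s = e / (3 * C2)"
  have s: "0 < s" "s * C2 < e / 2" using e C2 by (auto simp: s_def)
  \<comment> \<open>Both the summed first errors and the weighted second errors are multiples of the
    same tail of the series of \<open>a\<close>; \<open>Q\<close> adds the two factors.\<close>
  define Q where "Q = G + C1 / (\<eta> * (s * c0))"
  have Q: "0 \<le> Q" using G C1 \<eta> s c0 by (simp add: Q_def)
  \<comment> \<open>The power carries the outer radius of shell \<open>j\<close>, hence the
    \<open>+ 1\<close>; the exponential carries the inner radius.\<close>
  define a where "a = (\<lambda>j. (real j + 1) ^ ?D * exp (- (c * (real j)\<^sup>2)))"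
  have a0: "0 \<le> a j" for j by (simp add: a_def)
  have a_sum: "summable a" unfolding a_def by (rule summable_power_times_exp_neg_square[OF c])
  \<comment> \<open>With a tail below this value, \<open>Q\<close> times the tail stays below
    \<open>e / 2\<close>; the \<open>+ 1\<close> avoids division by 0.\<close>
  have "0 < e / (2 * (Q + 1))" using e Q by simp
  from suminf_exist_split[OF this a_sum] obtain J0 where
    tail: "\<And>m. J0 \<le> m \<Longrightarrow> norm (\<Sum>j. a (j + m)) < e / (2 * (Q + 1))" by blast
  \<comment> \<open>Shells start at index \<open>m\<close>, the integer part of \<open>M n\<close>;
    \<open>max 1\<close> keeps all their inner radii positive.\<close>
  have "eventually (\<lambda>n. real (max 1 J0) \<le> M n) sequentially"
    using assms(10) by (simp add: filterlim_at_top)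
  then obtain N0 where N0: "\<And>n. N0 \<le> n \<Longrightarrow> real (max 1 J0) \<le> M n"
    by (auto simp: eventually_sequentially)
  let ?E = "\<lambda>n. {z \<in> space (sample_law n f0). \<eta> < posterior \<nu> n z
      {\<theta> \<in> Theta kmax K \<delta>. M n * (1 / sqrt (real n)) < ?d \<theta>}}"
  have main: "measure (sample_law n f0) (?E n) < e" if n: "max 1 N0 \<le> n" for n
  proof -
    interpret P: prob_space "sample_law n f0" by (rule prob_space_sample_law[OF f0])
    define m where "m = nat \<lfloor>M n\<rfloor>"
    have Mn: "real (max 1 J0) \<le> M n" using N0 n by simp
    then have m: "max 1 J0 \<le> m" "real m \<le> M n"
      unfolding m_def by (simp_all add: le_nat_floor of_nat_floor del: of_nat_max)
    define \<epsilon> where "\<epsilon> = 1 / sqrt n"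
    have n0: "0 < real n" using n by simp
    have \<epsilon>: "0 < \<epsilon>" "\<epsilon> \<le> 1" "n * \<epsilon>\<^sup>2 = 1" "\<epsilon> * sqrt n = 1" using n by (auto simp: \<epsilon>_def power_divide)
    define r where "r j = real (j + m) * \<epsilon>" for j
    have r: "0 < r j" "n * (r j)\<^sup>2 = (real (j + m))\<^sup>2" for j
      using m \<epsilon> by (auto simp: r_def power_mult_distrib mult.left_commute)
    have "\<forall>j. \<exists>\<phi>. \<phi> \<in> sets (sample_law n f0) \<and>
      emeasure (sample_law n f0) \<phi> \<le> ennreal (G * exp (- (c * (real (j + m))\<^sup>2))) \<and>
      (\<forall>\<theta>\<in>Theta kmax K \<delta>. r j \<le> ?d \<theta> \<longrightarrow>
        (\<integral>\<^sup>+z\<in>space (sample_law n f0) - \<phi>. ennreal (lik_ratio n f0 (step_fun \<theta>) z) \<partial>sample_law n f0)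
          \<le> ennreal (exp (- (c * (real (j + m))\<^sup>2))))"
      using tests[OF r(1), of n] unfolding r(2) by blast
    from choice[OF this] obtain \<phi> where \<phi>: "\<And>j. \<phi> j \<in> sets (sample_law n f0)"
      "\<And>j. emeasure (sample_law n f0) (\<phi> j) \<le> ennreal (G * exp (- (c * (real (j + m))\<^sup>2)))"
      "\<And>j \<theta>. \<theta> \<in> Theta kmax K \<delta> \<Longrightarrow> r j \<le> ?d \<theta> \<Longrightarrow>
        (\<integral>\<^sup>+z\<in>space (sample_law n f0) - \<phi> j. ennreal (lik_ratio n f0 (step_fun \<theta>) z) \<partial>sample_law n f0)
          \<le> ennreal (exp (- (c * (real (j + m))\<^sup>2)))" by blast
    obtain B where B: "B \<in> sets param_space" "B \<subseteq> Theta kmax K \<delta>"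
      "ennreal (c0 * \<epsilon> ^ ?D) \<le> emeasure \<nu> B" "\<And>\<theta>. \<theta> \<in> B \<Longrightarrow> (?d \<theta>)\<^sup>2 \<le> (1 + 8 * K\<^sup>2 * k0) * \<epsilon>\<^sup>2"
      using nbhd[OF \<epsilon>(1,2)] by blast
    define b where "b = measure \<nu> B"
    have b: "ennreal b = emeasure \<nu> B" by (simp add: b_def \<nu>.emeasure_eq_measure)
    have b_ge: "c0 * \<epsilon> ^ ?D \<le> b" using B(3) c0 \<epsilon> unfolding b[symmetric] by (subst (asm) ennreal_le_iff) (auto simp: b_def)
    have b0: "0 < b" using b_ge c0 \<epsilon> by (intro less_le_trans[OF _ b_ge]) simp
    define A where "A = {\<theta> \<in> Theta kmax K \<delta>. M n * (1 / sqrt (real n)) < ?d \<theta>}"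
    define S where "S j = {\<theta> \<in> Theta kmax K \<delta>. r j \<le> ?d \<theta> \<and> ?d \<theta> < r (Suc j)}" for j
    have "{\<theta> \<in> space param_space. \<theta> \<in> Theta kmax K \<delta> \<and> M n * (1 / sqrt (real n)) < ?d \<theta>} \<in> sets param_space"
      by measurable
    then have As: "A \<in> sets \<nu>" by (simp add: A_def sets_\<nu>)
    have "{\<theta> \<in> space param_space. \<theta> \<in> Theta kmax K \<delta> \<and> r j \<le> ?d \<theta> \<and> ?d \<theta> < r (Suc j)} \<in> sets param_space" for j
      by measurable
    then have Ss: "S j \<in> sets \<nu>" for j by (simp add: S_def sets_\<nu>)
    have "{\<theta> \<in> space param_space. \<theta> \<in> Theta kmax K \<delta> \<and> ?d \<theta> < r (Suc j)} \<in> sets param_space" for j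
      by measurable
    then have Bs: "{\<theta> \<in> Theta kmax K \<delta>. ?d \<theta> < r (Suc j)} \<in> sets \<nu>" for j by (simp add: sets_\<nu>)
    have cover: "A \<subseteq> (\<Union>j. S j)"
    proof
      fix \<theta> assume \<theta>: "\<theta> \<in> A"
      define y where "y = ?d \<theta> * sqrt n"
      have y: "M n < y" using \<theta> n0 by (auto simp: A_def y_def divide_less_eq)
      define i where "i = nat \<lfloor>y\<rfloor>"
      have y0: "0 \<le> y" using y Mn by (simp add: y_def)
      have i: "real i \<le> y" "y < real i + 1" using y0 by (auto simp: i_def)
      have "real m < real i + 1" using m y i by linarith
      then have mi: "m \<le> i" by linarith
      have dy: "?d \<theta> = y * \<epsilon>" using \<epsilon>(4) by (simp add: y_def mult.assoc mult.commute[of \<epsilon>])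
      have "r (i - m) \<le> ?d \<theta>" "?d \<theta> < r (Suc (i - m))"
        unfolding dy r_def using i mi \<epsilon> by (auto simp: of_nat_diff intro!: mult_right_mono mult_strict_right_mono)
      then have "\<theta> \<in> S (i - m)" using \<theta> by (auto simp: S_def A_def)
      then show "\<theta> \<in> (\<Union>j. S j)" by blast
    qed
    have ballS: "emeasure \<nu> (S j) \<le> ennreal (C1 * r (Suc j) ^ ?D)" for j
      by (rule order_trans[OF emeasure_mono[OF _ Bs] ball[OF r(1)]]) (auto simp: S_def)
    have inv: "(\<integral>\<^sup>+z. ennreal (1 / lik_ratio n f0 (step_fun \<theta>) z) \<partial>sample_law n f0) \<le> ennreal C2" if \<theta>: "\<theta> \<in> B" for \<theta>
    proof -
      obtain k a t where kat: "\<theta> = (k, a, t)" by (cases \<theta>)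
      have bd: "\<bar>step_fun \<theta> x - f0 x\<bar> \<le> 2 * K" if x: "x \<in> {0..<1}" for x
        using Theta_step_fun_abs_le[of k a t kmax K \<delta> x] Theta_step_fun_abs_le[OF \<theta>0 \<delta> x] B(2) \<theta> \<delta> x
        unfolding kat f0_def by (auto simp: subset_iff)
      have "(\<integral>\<^sup>+z. ennreal (1 / lik_ratio n f0 (step_fun \<theta>) z) \<partial>sample_law n f0) \<le>
          ennreal (exp (n * (exp ((2 * K)\<^sup>2) * (?d \<theta>)\<^sup>2)))"
        by (rule nn_integral_inverse_lik_ratio_le[OF f0 step_fun_measurable bd])
      also have "n * (exp ((2 * K)\<^sup>2) * (?d \<theta>)\<^sup>2) \<le> n * (exp ((2 * K)\<^sup>2) * ((1 + 8 * K\<^sup>2 * k0) * \<epsilon>\<^sup>2))"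
        by (intro mult_left_mono B(4)[OF \<theta>]) auto
      also have "\<dots> = exp ((2 * K)\<^sup>2) * (1 + 8 * K\<^sup>2 * k0) * (n * \<epsilon>\<^sup>2)" by (simp only: mult_ac)
      finally show ?thesis unfolding \<epsilon>(3) by (simp add: C2_def ennreal_leI order_trans)
    qed
    let ?R = "\<lambda>\<theta> z. lik_ratio n f0 (step_fun \<theta>) z"
    have R: "(\<lambda>(\<theta>, z). ?R \<theta> z) \<in> borel_measurable (\<nu> \<Otimes>\<^sub>M sample_law n f0)"
      using measurable_lik_ratio_pair[OF f0] by (simp cong: measurable_cong_sets add: sets_\<nu>)
    let ?\<alpha> = "\<lambda>j. ennreal (G * exp (- (c * (real (j + m))\<^sup>2)))"
    let ?\<beta> = "\<lambda>j. ennreal (exp (- (c * (real (j + m))\<^sup>2)))"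
    let ?\<gamma> = "\<lambda>j. ennreal (C1 * r (Suc j) ^ ?D)"
    obtain E where E: "E \<in> sets (sample_law n f0)"
      "{z \<in> space (sample_law n f0). ennreal \<eta> * (\<integral>\<^sup>+\<theta>. ennreal (?R \<theta> z) \<partial>\<nu>) \<le> (\<integral>\<^sup>+\<theta>\<in>A. ennreal (?R \<theta> z) \<partial>\<nu>)} \<subseteq> E"
      "emeasure (sample_law n f0) E \<le> (\<Sum>j. ?\<alpha> j) + ennreal (s * C2) + ennreal (1 / (\<eta> * (s * b))) * (\<Sum>j. ?\<beta> j * ?\<gamma> j)"
      by (rule posterior_ratio_bound[of "sample_law n f0" \<nu> ?R A B S \<phi> ?\<alpha> ?\<beta> ?\<gamma> C2 b s \<eta>])
        (use P.prob_space_axioms \<nu>.prob_space_axioms lik_ratio_pos R As B(1) Ss \<phi> cover ballS inv b0 b s(1) \<eta> C2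
          in \<open>auto simp: sets_\<nu> S_def\<close>)
    define T where "T = (\<Sum>j. a (j + m))"
    have aT: "summable (\<lambda>j. a (j + m))" using a_sum by (rule summable_ignore_initial_segment)
    have T0: "0 \<le> T" unfolding T_def using aT a0 by (intro suminf_nonneg) auto
    have "(\<Sum>j. ?\<alpha> j) \<le> (\<Sum>j. ennreal (G * a (j + m)))"
    proof (intro suminf_le ennreal_leI mult_left_mono G)
      fix j
      have "1 * exp (- (c * (real (j + m))\<^sup>2)) \<le> a (j + m)"
        unfolding a_def by (intro mult_right_mono one_le_power) auto
      then show "exp (- (c * (real (j + m))\<^sup>2)) \<le> a (j + m)" by simp
    qed auto
    also have "\<dots> = ennreal (G * T)"
      unfolding T_def using G a0 aT by (subst suminf_ennreal2) (auto intro: summable_mult simp: suminf_mult)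
    finally have 1: "(\<Sum>j. ?\<alpha> j) \<le> ennreal (G * T)" .
    have "(\<Sum>j. ?\<beta> j * ?\<gamma> j) = (\<Sum>j. ennreal (C1 * \<epsilon> ^ ?D * a (j + m)))"
    proof (rule arg_cong[where f = suminf], rule ext)
      fix j
      have eq: "exp (- (c * (real (j + m))\<^sup>2)) * (C1 * r (Suc j) ^ ?D) = C1 * \<epsilon> ^ ?D * a (j + m)"
        unfolding r_def a_def power_mult_distrib by (simp add: mult_ac add_ac)
      show "?\<beta> j * ?\<gamma> j = ennreal (C1 * \<epsilon> ^ ?D * a (j + m))"
        unfolding eq[symmetric] by (rule ennreal_mult'[symmetric]) simp
    qed
    also have "\<dots> = ennreal (C1 * \<epsilon> ^ ?D * T)"
      unfolding T_def using C1 \<epsilon> a0 aT by (subst suminf_ennreal2) (auto intro: summable_mult simp: suminf_mult)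
    finally have 2: "(\<Sum>j. ?\<beta> j * ?\<gamma> j) = ennreal (C1 * \<epsilon> ^ ?D * T)" .
    \<comment> \<open>The powers of \<open>\<epsilon>\<close> cancel because the upper and lower
      bounds on the prior mass have the same exponent. A mismatch would leave a power of n here and
      force a logarithmic factor into the rate.\<close>
    have "1 / (\<eta> * (s * b)) * (C1 * \<epsilon> ^ ?D * T) \<le> C1 / (\<eta> * (s * c0)) * T"
    proof -
      have "1 / (\<eta> * (s * b)) * (C1 * \<epsilon> ^ ?D * T) = C1 / (\<eta> * s) * T * (\<epsilon> ^ ?D / b)"
        using \<eta> s b0 by (simp add: field_simps)
      also have "\<dots> \<le> C1 / (\<eta> * s) * T * (1 / c0)"
        using b_ge b0 c0 C1 \<eta> s T0 by (intro mult_left_mono) (auto simp: field_simps)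
      finally show ?thesis using \<eta> s c0 by (simp add: field_simps)
    qed
    then have 3: "ennreal (1 / (\<eta> * (s * b))) * (\<Sum>j. ?\<beta> j * ?\<gamma> j) \<le> ennreal (C1 / (\<eta> * (s * c0)) * T)"
      unfolding 2 using \<eta> s b0 by (subst ennreal_mult'[symmetric]) (auto intro: ennreal_leI)
    have "emeasure (sample_law n f0) E \<le> ennreal (G * T) + ennreal (s * C2) + ennreal (C1 / (\<eta> * (s * c0)) * T)"
      by (rule order_trans[OF E(3)]) (intro add_mono 1 3 order_refl)
    also have "\<dots> = ennreal (Q * T + s * C2)"
      using G T0 s C1 C2 \<eta> c0 by (simp add: Q_def ennreal_plus[symmetric] algebra_simps del: ennreal_plus)
    finally have "measure (sample_law n f0) E \<le> Q * T + s * C2"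
      unfolding P.emeasure_eq_measure using Q T0 s C2 by (subst (asm) ennreal_le_iff) auto
    \<comment> \<open>Monotonicity uses the measurability of \<open>E\<close>; the posterior event
      itself is only contained in it.\<close>
    moreover have "measure (sample_law n f0) (?E n) \<le> measure (sample_law n f0) E"
    proof (rule P.finite_measure_mono[OF _ E(1)])
      show "?E n \<subseteq> E"
        using posterior_gt_imp[OF As \<eta>, of n _ f0] E(2) unfolding A_def by auto
    qed
    moreover have "Q * T < e / 2"
    proof -
      have "T < e / (2 * (Q + 1))" using tail[of m] m T0 by (simp add: T_def)
      then have "T * (2 * (Q + 1)) < e" using Q by (simp add: pos_less_divide_eq)
      then show ?thesis using T0 by (simp add: algebra_simps)
    qed
    ultimately show ?thesis using s by simp
  qed
  show "\<exists>no. \<forall>n\<ge>no. norm (measure (sample_law n f0) (?E n) - 0) < e"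
    using main by (intro exI[of _ "max 1 N0"]) simp
qed

end
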